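(* Let $\mathbf{d}\in\mathbb{R}^d$, let $\lambda>0$ be a regularization coefficient, and consider learning the symmetric two-component Gaussian mixture $\mathbf{X}\sim P_{\mathbf{X}}=\frac12\mathcal{N}(\boldsymbol{\mu}_{\mathbf{X}},\Sigma_{\mathbf{X}})+\frac12\mathcal{N}(-\boldsymbol{\mu}_{\mathbf{X}},\Sigma_{\mathbf{X}})$ in $\mathbb{R}^d$ through the minimax problem $\min_{\Lambda,\boldsymbol{\mu}}\mathcal{L}(G_{\Lambda,\boldsymbol{\mu}})$ over a feasible set of generator parameters $\Lambda\in\mathbb{R}^{d\times d}$, $\boldsymbol{\mu}\in\mathbb{R}^d$, where $$\mathcal{L}(G_{\Lambda,\boldsymbol{\mu}})=\max_{A,(\mathbf{b}_i)_{i=1}^4}\ \mathbb{E}\bigl[D_{A,(\mathbf{b}_i)}(\mathbf{X})\bigr]-\mathbb{E}\bigl[D_{A,(\mathbf{b}_i)}(G_{\Lambda,\boldsymbol{\mu}}(\mathbf{Z}))\bigr]-\frac{\lambda}{2}\Bigl(\Vert A\Vert_F^2+\Vert\mathbf{b}_1-\mathbf{d}\Vert_2^2+\Vert\mathbf{b}_2+\mathbf{d}\Vert_2^2+\Vert\mathbf{b}_3-\mathbf{d}\Vert_2^2+\Vert\mathbf{b}_4+\mathbf{d}\Vert_2^2\Bigr),$$ with the additional constraints $\mathbf{b}_1=-\mathbf{b}_2$, $\mathbf{b}_3=-\mathbf{b}_4$ in the maximization, which do not change the optimal solution of the minimax problem. Suppose that $(\boldsymbol{\mu}_{\mathbf{X}},\Sigma_{\mathbf{X}})$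 satisfies the separability condition (defined in the context) along $\mathbf{d}$; that for every feasible $G_{\Lambda,\boldsymbol{\mu}}$ the separability condition holds for $(\boldsymbol{\mu},\Sigma)$, where $\Sigma=\Lambda\Lambda^T$, along every $\widetilde{\mathbf{d}}$ with $\Vert\widetilde{\mathbf{d}}-\mathbf{d}\Vert_2\le\frac{\rho}{\lambda}$, where $\rho$ is the maximum of $\mathbb{E}[\Vert G_{\Lambda,\boldsymbol{\mu}}(\mathbf{Z})\Vert_2]$ over feasible $G_{\Lambda,\boldsymbol{\mu}}$'s; and that $\mathbb{E}[\Vert\mathbf{X}\Vert_2^2]+\mathbb{E}[\Vert G_{\Lambda,\boldsymbol{\mu}}(\mathbf{Z})\Vert_2^2]\le\lambda$ for all feasible $\Lambda,\boldsymbol{\mu}$. Let $\widehat{\mathcal{L}}(G_{\Lambda,\boldsymbol{\mu}})$ denote the empirical objective for $n$ i.i.d. samples $\mathbf{x}_1,\dots,\mathbf{x}_n$ from $P_{\mathbf{X}}$. Then, for every $\delta>0$, with probability at least $1-\delta$ the following bounds hold uniformly for every $\boldsymbol{\mu},\Lambda$ such that $\Vert\boldsymbol{\mu}\boldsymbol{\mu}^T+\Lambda\Lambda^T\Vert_F\le\mathbb{E}[\Vert\mathbf{X}\Vert_2^2]$: $$\bigl|\widehat{\mathcal{L}}(G_{\Lambda,\boldsymbol{\mu}})-\mathcal{L}(G_{\Lambda,\boldsymbol{\mu}})\bigr|\le\mathcal{O}\Bigl(\sqrt{\tfrac{d^2\log(1/\delta)}{\lambda^2n}}\Bigr),$$ 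$$\Bigl\Vert\frac{\partial\widehat{\mathcal{L}}(G_{\Lambda,\boldsymbol{\mu}})}{\partial\boldsymbol{\mu}}(\boldsymbol{\mu})-\frac{\partial\mathcal{L}(G_{\Lambda,\boldsymbol{\mu}})}{\partial\boldsymbol{\mu}}(\boldsymbol{\mu})\Bigr\Vert_2+\Bigl\Vert\frac{\partial\widehat{\mathcal{L}}(G_{\Lambda,\boldsymbol{\mu}})}{\partial\Lambda}(\Lambda)-\frac{\partial\mathcal{L}(G_{\Lambda,\boldsymbol{\mu}})}{\partial\Lambda}(\Lambda)\Bigr\Vert_\sigma\le\mathcal{O}\Bigl(\sqrt{\tfrac{d\log(1/\delta)}{\lambda^2n}}\Bigr).$$
   Context: Separability condition: mean and covariance parameters $(\boldsymbol{\mu},\Sigma)$ satisfy it along a vector $\widetilde{\mathbf{d}}$ if $$2\widetilde{\mathbf{d}}^T\Sigma\widetilde{\mathbf{d}}+\sqrt{\widetilde{\mathbf{d}}^T\Sigma\widetilde{\mathbf{d}}}\le\bigl|\boldsymbol{\mu}^T\widetilde{\mathbf{d}}\bigr|.$$ The generator is the random map $G_{\Lambda,\boldsymbol{\mu}}(\mathbf{z})=Y(\Lambda\mathbf{z}+\boldsymbol{\mu})$ with $Y$ uniform on $\{-1,+1\}$, independent of $\mathbf{Z}\sim\mathcal{N}(\mathbf{0},I_{d\times d})$. The discriminator is $$D_{A,(\mathbf{b}_i)_{i=1}^4}(\mathbf{x})=\frac12\mathbf{x}^TA\mathbf{x}+\log\biggl(\frac{\exp(\mathbf{b}_1^T\mathbf{x})+\exp(\mathbf{b}_2^T\mathbf{x})}{\exp(\mathbf{b}_3^T\mathbf{x})+\exp(\mathbf{b}_4^T\mathbf{x})}\biggr),$$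 with $A\in\mathbb{R}^{d\times d}$ and $\mathbf{b}_i\in\mathbb{R}^d$. The empirical objective $\widehat{\mathcal{L}}$ is $\mathcal{L}$ with the distribution of $\mathbf{X}$ replaced by the empirical distribution of the samples, i.e. $\mathbb{E}[D(\mathbf{X})]$ replaced by $\frac1n\sum_{j=1}^nD(\mathbf{x}_j)$. $\partial/\partial\Lambda$ and $\partial/\partial\boldsymbol{\mu}$ denote derivatives of the objective with respect to $\Lambda$ and $\boldsymbol{\mu}$. $\Vert\cdot\Vert_\sigma$ is the spectral norm and $\Vert\cdot\Vert_F$ the Frobenius norm.
   Formalization: The constant in O(·) may depend on upper bounds for E‖X‖² and ‖d‖ and on a bound δ0 < 1 with δ ≤ δ0, and the bounds are claimed for n ≥ N log(1/δ); with a fully uniform constant, all n and all δ > 0 the claim is false. *)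

theory Defs
  imports "HOL-Probability.Probability"
begin

text \<open>
  The dimension \<open>d\<close> is an ordinary natural number, so that constants can be required to be
  independent of it. A vector of $R^d$ is a function on indices and a square matrix is a curried
  function of two indices; all operations below only look at indices smaller than \<open>d\<close>.
\<close>

type_synonym rvec = "nat \<Rightarrow> real"
type_synonym rmat = "nat \<Rightarrow> nat \<Rightarrow> real"

definition inner_prod :: "nat \<Rightarrow> rvec \<Rightarrow> rvec \<Rightarrow> real" where
  "inner_prod d u v = (\<Sum>i<d. u i * v i)"

definition norm2 :: "nat \<Rightarrow> rvec \<Rightarrow> real" where
  "norm2 d v = L2_set v {..<d}"

definition mat_vec :: "nat \<Rightarrow> rmat \<Rightarrow> rvec \<Rightarrow> rvec" where
  "mat_vec d A v = (\<lambda>i. \<Sum>j<d. A i j * v j)"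

definition gram :: "nat \<Rightarrow> rmat \<Rightarrow> rmat" where
  "gram d L = (\<lambda>i j. \<Sum>k<d. L i k * L j k)"

definition quad_form :: "nat \<Rightarrow> rmat \<Rightarrow> rvec \<Rightarrow> real" where
  "quad_form d A v = inner_prod d v (mat_vec d A v)"

definition frobenius_norm :: "nat \<Rightarrow> rmat \<Rightarrow> real" where
  "frobenius_norm d A = L2_set (\<lambda>(i, j). A i j) ({..<d} \<times> {..<d})"

definition spectral_norm :: "nat \<Rightarrow> rmat \<Rightarrow> real" where
  "spectral_norm d A = (SUP v\<in>{v. norm2 d v \<le> 1}. norm2 d (mat_vec d A v))"

definition psd :: "nat \<Rightarrow> rmat \<Rightarrow> bool" where
  "psd d A \<longleftrightarrow> (\<forall>i<d. \<forall>j<d. A i j = A j i) \<and> (\<forall>v. quad_form d A v \<ge> 0)"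

text \<open>
  \<open>g\<close> is the gradient at \<open>x\<close> (Frechet sense, Euclidean norm) of a function of the coordinates
  in the finite index set \<open>I\<close>. For matrices, \<open>I\<close> is a set of index pairs.
\<close>

definition has_gradient_on ::
  "'i set \<Rightarrow> (('i \<Rightarrow> real) \<Rightarrow> real) \<Rightarrow> ('i \<Rightarrow> real) \<Rightarrow> ('i \<Rightarrow> real) \<Rightarrow> bool" where
  "has_gradient_on I f x g \<longleftrightarrow>
     (\<forall>e>0. \<exists>r>0. \<forall>h. L2_set h I < r \<longrightarrow>
        \<bar>f (\<lambda>i. x i + h i) - f x - (\<Sum>i\<in>I. g i * h i)\<bar> \<le> e * L2_set h I)"

definition has_vec_gradient :: "nat \<Rightarrow> (rvec \<Rightarrow> real) \<Rightarrow> rvec \<Rightarrow> rvec \<Rightarrow> bool" where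
  "has_vec_gradient d f x g \<longleftrightarrow> has_gradient_on {..<d} f x g"

definition has_mat_gradient :: "nat \<Rightarrow> (rmat \<Rightarrow> real) \<Rightarrow> rmat \<Rightarrow> rmat \<Rightarrow> bool" where
  "has_mat_gradient d f X G \<longleftrightarrow>
     has_gradient_on ({..<d} \<times> {..<d}) (\<lambda>M. f (curry M)) (case_prod X) (case_prod G)"

definition std_gaussian :: "nat \<Rightarrow> rvec measure" where
  "std_gaussian d = (\<Pi>\<^sub>M i\<in>{..<d}. density lborel (\<lambda>t. ennreal (std_normal_density t)))"

text \<open>
  The normal law with mean \<open>m\<close> and positive semidefinite (possibly singular) covariance \<open>S\<close>:
  the image of the standard normal law under $z \mapsto m + L z$ with $L L^T = S$. The law
  is the same for every such factor \<open>L\<close>.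
\<close>

definition gaussian :: "nat \<Rightarrow> rvec \<Rightarrow> rmat \<Rightarrow> rvec measure" where
  "gaussian d m S =
     (let L = (SOME L. \<forall>i<d. \<forall>j<d. gram d L i j = S i j)
      in distr (std_gaussian d) (\<Pi>\<^sub>M i\<in>{..<d}. borel) (\<lambda>z. \<lambda>i\<in>{..<d}. m i + mat_vec d L z i))"

definition random_sign :: "real measure" where
  "random_sign = measure_pmf (pmf_of_set {-1, 1})"

definition sym_mixture :: "nat \<Rightarrow> rvec \<Rightarrow> rmat \<Rightarrow> rvec measure" where
  "sym_mixture d m S = random_sign \<bind> (\<lambda>y. gaussian d (\<lambda>i. y * m i) S)"

definition separable :: "nat \<Rightarrow> rvec \<Rightarrow> rmat \<Rightarrow> rvec \<Rightarrow> bool" where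
  "separable d m S v \<longleftrightarrow>
     2 * quad_form d S v + sqrt (quad_form d S v) \<le> \<bar>inner_prod d m v\<bar>"

definition generator :: "nat \<Rightarrow> rmat \<Rightarrow> rvec \<Rightarrow> real \<times> rvec \<Rightarrow> rvec" where
  "generator d \<Lambda> \<mu> = (\<lambda>(y, z). \<lambda>i\<in>{..<d}. y * (mat_vec d \<Lambda> z i + \<mu> i))"

text \<open>Joint law of the independent pair \<open>(Y, Z)\<close> that drives the generator.\<close>

definition gen_noise :: "nat \<Rightarrow> (real \<times> rvec) measure" where
  "gen_noise d = random_sign \<Otimes>\<^sub>M std_gaussian d"

definition discriminator ::
  "nat \<Rightarrow> rmat \<Rightarrow> rvec \<Rightarrow> rvec \<Rightarrow> rvec \<Rightarrow> rvec \<Rightarrow> rvec \<Rightarrow> real" where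
  "discriminator d A b1 b2 b3 b4 x =
     quad_form d A x / 2 +
     ln ((exp (inner_prod d b1 x) + exp (inner_prod d b2 x)) /
         (exp (inner_prod d b3 x) + exp (inner_prod d b4 x)))"

text \<open>
  In the following, \<open>w\<close> is the reference vector around which the discriminator is regularised,
  and \<open>P\<close> is the law of the data (the population law or an empirical law).
\<close>

definition regularizer ::
  "nat \<Rightarrow> rvec \<Rightarrow> rmat \<Rightarrow> rvec \<Rightarrow> rvec \<Rightarrow> rvec \<Rightarrow> rvec \<Rightarrow> real" where
  "regularizer d w A b1 b2 b3 b4 =
     (frobenius_norm d A)\<^sup>2 +
     (norm2 d (\<lambda>i. b1 i - w i))\<^sup>2 + (norm2 d (\<lambda>i. b2 i + w i))\<^sup>2 +
     (norm2 d (\<lambda>i. b3 i - w i))\<^sup>2 + (norm2 d (\<lambda>i. b4 i + w i))\<^sup>2"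

definition gan_objective ::
  "nat \<Rightarrow> real \<Rightarrow> rvec \<Rightarrow> rvec measure \<Rightarrow> rmat \<Rightarrow> rvec \<Rightarrow>
   rmat \<Rightarrow> rvec \<Rightarrow> rvec \<Rightarrow> rvec \<Rightarrow> rvec \<Rightarrow> real" where
  "gan_objective d lam w P \<Lambda> \<mu> A b1 b2 b3 b4 =
     (\<integral>x. discriminator d A b1 b2 b3 b4 x \<partial>P)
     - (\<integral>q. discriminator d A b1 b2 b3 b4 (generator d \<Lambda> \<mu> q) \<partial>gen_noise d)
     - lam / 2 * regularizer d w A b1 b2 b3 b4"

text \<open>
  The maximum exists: the discriminator is linear in \<open>A\<close> and grows at most linearly in the
  vectors, whereas the penalty is quadratic. Hence it is a supremum of a bounded set of reals.
\<close>

definition gan_loss ::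
  "nat \<Rightarrow> real \<Rightarrow> rvec \<Rightarrow> rvec measure \<Rightarrow> rmat \<Rightarrow> rvec \<Rightarrow> real" where
  "gan_loss d lam w P \<Lambda> \<mu> =
     (SUP (A, b1, b2, b3, b4)\<in>{(A, b1, b2, b3, b4).
          (\<forall>i<d. b1 i = - b2 i) \<and> (\<forall>i<d. b3 i = - b4 i)}.
        gan_objective d lam w P \<Lambda> \<mu> A b1 b2 b3 b4)"

definition empirical :: "nat \<Rightarrow> (nat \<Rightarrow> rvec) \<Rightarrow> rvec measure" where
  "empirical n xs = measure_pmf (map_pmf xs (pmf_of_set {..<n}))"

definition second_moment :: "nat \<Rightarrow> rvec measure \<Rightarrow> real" where
  "second_moment d P = (\<integral>x. (norm2 d x)\<^sup>2 \<partial>P)"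

definition gen_first_moment :: "nat \<Rightarrow> rmat \<Rightarrow> rvec \<Rightarrow> real" where
  "gen_first_moment d \<Lambda> \<mu> = (\<integral>q. norm2 d (generator d \<Lambda> \<mu> q) \<partial>gen_noise d)"

definition gen_second_moment :: "nat \<Rightarrow> rmat \<Rightarrow> rvec \<Rightarrow> real" where
  "gen_second_moment d \<Lambda> \<mu> = (\<integral>q. (norm2 d (generator d \<Lambda> \<mu> q))\<^sup>2 \<partial>gen_noise d)"

text \<open>\<open>F\<close> is the feasible set of generator parameters; an attained maximum makes it nonempty.\<close>

definition is_max_first_moment :: "nat \<Rightarrow> (rmat \<times> rvec) set \<Rightarrow> real \<Rightarrow> bool" where
  "is_max_first_moment d F \<rho> \<longleftrightarrow>
     (\<exists>(\<Lambda>, \<mu>)\<in>F. gen_first_moment d \<Lambda> \<mu> = \<rho>) \<and>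
     (\<forall>(\<Lambda>, \<mu>)\<in>F. gen_first_moment d \<Lambda> \<mu> \<le> \<rho>)"

end

theory Submission
  imports Defs
begin

text \<open>
  With $b_2 = -b_1$ and $b_4 = -b_3$ the discriminator is a quadratic form plus
  $\log\cosh(b_1^T x) - \log\cosh(b_3^T x)$, so the inner maximisation splits into three independent
  problems, in $A$, $b_1$ and $b_3$. Since $\log\cosh$ is convex with second derivative at most 1,
  the moment condition makes each of them $\lambda$-strongly concave up to a constant, also for the
  empirical law on the event below. Hence the maximisers exist, an envelope argument gives the
  gradients, and value and gradients depend on the data law only through its second moments and the
  vectors $E[X \tanh(b^T X)]$ for $b$ in a ball, with Lipschitz constant of order $1/\lambda$; in
  the value the two $\log\cosh$ terms cancel up to the distance of the two maximisers, which is again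
  of order $1/\lambda$.

  The deviations of these quantities are controlled without any dimension dependence by
  symmetrisation and the Ledoux--Talagrand contraction principle, applied to exponential moments of
  each coordinate; the coordinates are recombined by the convexity of
  $y \mapsto \cosh\sqrt{y}$ with weights proportional to their variances.
\<close>

subsection \<open>The log-cosh function and hyperbolic inequalities\<close>

text \<open>A cover of the ball of discriminator vectors would bring in the dimension. Contraction
  avoids it: inside an exponential of a maximum \<open>tanh\<close> gives way to the identity, and a
  maximum of linear functionals over a ball is at most a multiple of a norm. What remains sees the
  law only through the sum of its coordinate variances, so the bound obtained is free of
  \<open>d\<close>; the powers of \<open>d\<close> in the theorem enter at the very end through
  \<open>d \<ge> 1\<close>.

  The second obstacle is that \<open>lam\<close> may be arbitrarily small while the constants must
  not depend on it. Maximisers are located only within a distance of order \<open>a / lam\<close>,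
  where \<open>a\<^sup>2\<close> is slightly more than the second moment. The moment condition keeps
  the second moment below \<open>lam\<close>, so the total variance is at most
  \<open>2 * lam\<close> and cancels the \<open>1 / lam\<close> of that radius. Empirical second
  moments exceed \<open>lam\<close> a little; concavity survives up to \<open>3 / 2 * lam\<close>,
  which is the room left for the sampling error, and the margin \<open>lam / 8\<close> in all growth
  inequalities is the curvature that then remains.\<close>

definition logcosh :: "real \<Rightarrow> real" where
  "logcosh t = ln (cosh t)"

lemma logcosh_minus [simp]: "logcosh (- t) = logcosh t"
  by (simp add: logcosh_def)

lemma has_real_derivative_logcosh:
  "(logcosh has_real_derivative tanh t) (at t)"
  unfolding logcosh_def by (auto intro!: derivative_eq_intros simp: tanh_def)

lemma DERIV_logcosh [THEN DERIV_chain2, derivative_intros]: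
  "(logcosh has_real_derivative tanh t) (at t)"
  by (rule has_real_derivative_logcosh)

lemma continuous_on_logcosh [continuous_intros]:
  "continuous_on A f \<Longrightarrow> continuous_on A (\<lambda>x. logcosh (f x))"
  unfolding logcosh_def by (auto intro!: continuous_intros)

lemma borel_measurable_logcosh [measurable]: "logcosh \<in> borel_measurable borel"
  by (intro borel_measurable_continuous_onI continuous_on_logcosh continuous_on_id)

lemma borel_measurable_tanh [measurable]: "(tanh :: real \<Rightarrow> real) \<in> borel_measurable borel"
  by (intro borel_measurable_continuous_onI continuous_on_tanh continuous_on_id) auto

lemma borel_measurable_cosh [measurable]: "(cosh :: real \<Rightarrow> real) \<in> borel_measurable borel"
  by (intro borel_measurable_continuous_onI continuous_on_cosh continuous_on_id)

lemma abs_tanh_le_1: "\<bar>tanh (t::real)\<bar> \<le> 1"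
  using tanh_real_bounds[of t] by (auto simp: abs_le_iff)

lemma bounded_derivative_imp_Lipschitz:
  fixes f :: "real \<Rightarrow> real"
  assumes "\<And>t. (f has_real_derivative f' t) (at t)" and "\<And>t. \<bar>f' t\<bar> \<le> B"
  shows "\<bar>f x - f y\<bar> \<le> B * \<bar>x - y\<bar>"
  using field_differentiable_bound[of UNIV f f' B x y] assms by auto

lemma tanh_Lipschitz: "\<bar>tanh x - tanh y\<bar> \<le> \<bar>x - (y::real)\<bar>"
proof -
  have "\<bar>1 - (tanh t)\<^sup>2\<bar> \<le> 1" for t :: real
    using abs_square_le_1[of "tanh t"] abs_tanh_le_1[of t] by (simp add: abs_le_iff)
  then show ?thesis
    using bounded_derivative_imp_Lipschitz[of tanh "\<lambda>t. 1 - (tanh t)\<^sup>2" 1 x y]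
      has_field_derivative_tanh[OF _ DERIV_ident, of _ UNIV] by (metis cosh_real_nonzero mult_1 mult.right_neutral)
qed

lemma logcosh_Lipschitz: "\<bar>logcosh x - logcosh y\<bar> \<le> \<bar>x - y\<bar>"
  using bounded_derivative_imp_Lipschitz[OF has_real_derivative_logcosh abs_tanh_le_1, of x y] by simp

lemma abs_logcosh_le: "\<bar>logcosh x\<bar> \<le> \<bar>x\<bar>"
  using logcosh_Lipschitz[of x 0] by (simp add: logcosh_def)

text \<open>As a function of the step \<open>s\<close>, the remainder has derivative
  \<open>tanh (x + s) - tanh x\<close>, which is at most \<open>\<bar>h\<bar>\<close> in absolute
  value for \<open>s\<close> between \<open>- \<bar>h\<bar>\<close> and \<open>\<bar>h\<bar>\<close>
  because \<open>tanh\<close> is 1-Lipschitz.\<close>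

lemma logcosh_Taylor: "\<bar>logcosh (x + h) - logcosh x - h * tanh x\<bar> \<le> h\<^sup>2"
proof -
  define f where "f = (\<lambda>s. logcosh (x + s) - s * tanh x)"
  have der: "(f has_real_derivative tanh (x + s) - tanh x) (at s)" for s
    unfolding f_def by (auto intro!: derivative_eq_intros)
  have "\<bar>f h - f 0\<bar> \<le> \<bar>h\<bar> * \<bar>h - 0\<bar>"
  proof -
    have "\<bar>tanh (x + s) - tanh x\<bar> \<le> \<bar>h\<bar>" if "s \<in> {-\<bar>h\<bar>..\<bar>h\<bar>}" for s
      using tanh_Lipschitz[of "x + s" x] that by auto
    moreover have "(f has_real_derivative tanh (x + s) - tanh x) (at s within A)" for s A
      using der by (rule DERIV_subset) simp
    moreover have "h \<in> {-\<bar>h\<bar>..\<bar>h\<bar>}" by (simp add: abs_if)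
    ultimately show ?thesis
      using field_differentiable_bound[of "{-\<bar>h\<bar>..\<bar>h\<bar>}" f "\<lambda>s. tanh (x + s) - tanh x" "\<bar>h\<bar>" h 0]
      by auto
  qed
  then show ?thesis
    by (simp add: f_def power2_eq_square algebra_simps)
qed

text \<open>A mixed second difference of \<open>logcosh (inner_prod d b x)\<close> in the vector and
  in the point: \<open>\<alpha>\<close> stands for the effect of moving the vector,
  \<open>\<beta>\<close> for that of moving the point, and \<open>\<gamma>\<close> for the cross
  term of the bilinear argument.\<close>

lemma logcosh_four_point:
  "\<bar>logcosh (p + \<alpha> + \<beta> + \<gamma>) - logcosh (p + \<alpha>) - logcosh (p + \<beta>) + logcosh p\<bar> \<le> \<bar>\<gamma>\<bar> + \<bar>\<alpha>\<bar> * \<bar>\<beta>\<bar>"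
proof -
  define f where "f = (\<lambda>s. logcosh (s + \<alpha>) - logcosh s)"
  have "\<bar>f (p + \<beta>) - f p\<bar> \<le> \<bar>\<alpha>\<bar> * \<bar>(p + \<beta>) - p\<bar>"
  proof (rule bounded_derivative_imp_Lipschitz)
    show "(f has_real_derivative tanh (s + \<alpha>) - tanh s) (at s)" for s
      unfolding f_def by (auto intro!: derivative_eq_intros)
    show "\<bar>tanh (s + \<alpha>) - tanh s\<bar> \<le> \<bar>\<alpha>\<bar>" for s
      using tanh_Lipschitz[of "s + \<alpha>" s] by simp
  qed
  moreover have "\<bar>logcosh (p + \<alpha> + \<beta> + \<gamma>) - logcosh (p + \<alpha> + \<beta>)\<bar> \<le> \<bar>\<gamma>\<bar>"
    using logcosh_Lipschitz[of "p + \<alpha> + \<beta> + \<gamma>" "p + \<alpha> + \<beta>"] by simp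
  ultimately show ?thesis
    by (simp add: f_def add.commute add.left_commute)
qed

text \<open>Convexity and smoothness in midpoint form, which is how the inner maximisation uses
  curvature. Both are monotonicity statements in half the distance \<open>s\<close> of the
  arguments: the derivative of \<open>g\<close> lies between 0 and \<open>2 * s\<close>.\<close>

lemma logcosh_midpoint:
  "0 \<le> logcosh x + logcosh y - 2 * logcosh ((x + y) / 2)"
  "logcosh x + logcosh y - 2 * logcosh ((x + y) / 2) \<le> (x - y)\<^sup>2 / 4"
proof -
  define m e where "m = (x + y) / 2" and "e = (x - y) / 2"
  have xy: "x = m + e" "y = m - e"
    by (simp_all add: m_def e_def field_simps)
  define g where "g = (\<lambda>s. logcosh (m + s) + logcosh (m - s))"
  have der: "(g has_real_derivative tanh (m + s) - tanh (m - s)) (at s)" for s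
    unfolding g_def by (auto intro!: derivative_eq_intros)
  define k where "k = (\<lambda>s. s\<^sup>2 - g s)"
  have derk: "(k has_real_derivative 2 * s - (tanh (m + s) - tanh (m - s))) (at s)" for s
    unfolding k_def by (auto intro!: derivative_eq_intros der)
  have "g 0 \<le> g \<bar>e\<bar>"
    by (rule DERIV_nonneg_imp_nondecreasing[of 0]) (auto intro!: exI der)
  moreover have "k 0 \<le> k \<bar>e\<bar>"
  proof (rule DERIV_nonneg_imp_nondecreasing[of 0])
    fix s :: real assume "0 \<le> s" "s \<le> \<bar>e\<bar>"
    moreover have "tanh (m + s) - tanh (m - s) \<le> 2 * s"
      using tanh_Lipschitz[of "m + s" "m - s"] \<open>0 \<le> s\<close> by linarith
    ultimately show "\<exists>y. DERIV k s :> y \<and> 0 \<le> y"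
      using derk by (intro exI[of _ "2 * s - (tanh (m + s) - tanh (m - s))"]) auto
  qed simp
  moreover have "g \<bar>e\<bar> = logcosh x + logcosh y"
    by (auto simp: g_def xy abs_if)
  ultimately show "0 \<le> logcosh x + logcosh y - 2 * logcosh ((x + y) / 2)"
    "logcosh x + logcosh y - 2 * logcosh ((x + y) / 2) \<le> (x - y)\<^sup>2 / 4"
    by (simp_all add: g_def k_def flip: m_def) (simp add: e_def power2_eq_square field_simps)
qed

section \<open>Estimates for hyperbolic cosines\<close>

lemma exp_le_cosh: "exp t \<le> 2 * cosh (t::real)"
  by (simp add: cosh_def)

lemma cosh_le_exp: "cosh (t::real) \<le> exp \<bar>t\<bar>"
  by (subst cosh_real_abs[symmetric]) (simp add: cosh_def)

lemma exp_abs_le_cosh: "exp \<bar>t\<bar> \<le> 2 * cosh (t::real)"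
  using exp_le_cosh[of "\<bar>t\<bar>"] by simp

lemma convex_on_cosh: "convex_on UNIV (cosh :: real \<Rightarrow> real)"
  by (rule f''_ge0_imp_convex[where f' = sinh and f'' = cosh])
     (auto intro!: derivative_eq_intros)

lemma sinh_le_mult_cosh: "0 \<le> u \<Longrightarrow> sinh u \<le> u * cosh (u::real)"
proof -
  assume "0 \<le> u"
  have "(\<lambda>s. s * cosh s - sinh s) 0 \<le> (\<lambda>s. s * cosh s - sinh s) u"
    by (rule DERIV_nonneg_imp_nondecreasing[OF \<open>0 \<le> u\<close>])
       (auto intro!: exI derivative_eq_intros)
  then show ?thesis by simp
qed

text \<open>The excess over 1 carries the factor \<open>u\<^sup>2\<close>, so that averaging yields
  a bound quadratic in a scaling parameter. It comes from the mean value inequality and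
  \<open>sinh s \<le> s * cosh s\<close>.\<close>

lemma cosh_le_quadratic_exp: "cosh u \<le> 1 + u\<^sup>2 * exp \<bar>u::real\<bar>"
proof -
  define v where "v = \<bar>u\<bar>"
  have v: "0 \<le> v" by (simp add: v_def)
  have "\<bar>cosh v - cosh 0\<bar> \<le> (v * cosh v) * \<bar>v - 0\<bar>"
  proof -
    have "\<bar>sinh s\<bar> \<le> v * cosh v" if "s \<in> {0..v}" for s
    proof -
      have "sinh s \<le> s * cosh s" using sinh_le_mult_cosh that by simp
      also have "\<dots> \<le> v * cosh v"
        using that by (intro mult_mono) (auto simp: cosh_real_nonneg_le_iff)
      finally show ?thesis using that by simp
    qed
    moreover have "(cosh has_real_derivative sinh s) (at s within {0..v})" for s :: real
      by (auto intro!: derivative_eq_intros)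
    ultimately show ?thesis
      using field_differentiable_bound[of "{0..v}" cosh sinh "v * cosh v" v 0] v by auto
  qed
  then have "cosh v \<le> 1 + v\<^sup>2 * cosh v" using v by (simp add: power2_eq_square mult_ac)
  also have "\<dots> \<le> 1 + v\<^sup>2 * exp v"
    using cosh_le_exp[of v] v by (intro add_left_mono mult_left_mono) auto
  finally show ?thesis by (simp add: v_def)
qed

text \<open>In the exponential series of \<open>cosh\<close> only even powers of the norm occur, and these are convex
  functions of the squared coordinates.\<close>

lemma cosh_L2_set_le:
  fixes v p :: "'i \<Rightarrow> real"
  assumes I: "finite I" and p: "\<And>i. i \<in> I \<Longrightarrow> 0 < p i" and p1: "(\<Sum>i\<in>I. p i) = 1"
  shows "cosh (s * L2_set v I) \<le> (\<Sum>i\<in>I. p i * cosh (s * v i / sqrt (p i)))"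
proof -
  define a where "a = (\<lambda>(x::real) n::nat. if even n then x ^ n /\<^sub>R fact n else 0)"
  have S1: "a (s * L2_set v I) sums cosh (s * L2_set v I)"
    unfolding a_def by (rule cosh_converges)
  have S2: "(\<lambda>n. \<Sum>i\<in>I. p i * a (s * v i / sqrt (p i)) n) sums (\<Sum>i\<in>I. p i * cosh (s * v i / sqrt (p i)))"
    unfolding a_def by (intro sums_sum sums_mult cosh_converges)
  have "a (s * L2_set v I) n \<le> (\<Sum>i\<in>I. p i * a (s * v i / sqrt (p i)) n)" for n
  proof (cases "even n")
    case True
    then obtain j where n: "n = 2 * j" by auto
    \<comment> \<open>With these values the scaled squared norm is the \<open>p\<close>-average of
      \<open>y\<close>, so Jensen's inequality for the \<open>j\<close>-th power on the half-line
      settles the term of degree \<open>2 * j\<close>.\<close>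
    define y where "y = (\<lambda>i. (s * v i)\<^sup>2 / p i)"
    have "(s * L2_set v I) ^ n = (\<Sum>i\<in>I. p i * y i) ^ j"
    proof -
      have "(s * L2_set v I)\<^sup>2 = (\<Sum>i\<in>I. (s * v i)\<^sup>2)"
        by (simp add: L2_set_def power_mult_distrib sum_nonneg sum_distrib_left)
      also have "\<dots> = (\<Sum>i\<in>I. p i * y i)"
        using p by (intro sum.cong) (auto simp: y_def less_imp_neq[symmetric])
      finally show ?thesis by (simp add: n power_mult)
    qed
    also have "\<dots> \<le> (\<Sum>i\<in>I. p i * y i ^ j)"
    proof -
      have "convex_on {0..} (\<lambda>x::real. x ^ j)"
        by (cases "even j") (auto intro: convex_power_even convex_power_odd convex_on_subset)
      then show ?thesis
        using convex_on_sum[of I "{0..}" "\<lambda>x. x ^ j" p y] I p p1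
        by (cases "I = {}") (auto simp: y_def less_imp_le)
    qed
    also have "\<dots> = (\<Sum>i\<in>I. p i * (s * v i / sqrt (p i)) ^ n)"
      using p by (intro sum.cong) (auto simp: y_def n power_mult power_divide less_imp_le)
    finally have "(s * L2_set v I) ^ n \<le> (\<Sum>i\<in>I. p i * (s * v i / sqrt (p i)) ^ n)" .
    moreover have "(\<Sum>i\<in>I. p i * a (s * v i / sqrt (p i)) n)
        = inverse (fact n) * (\<Sum>i\<in>I. p i * (s * v i / sqrt (p i)) ^ n)"
      using True by (simp add: a_def sum_distrib_left mult_ac)
    ultimately show ?thesis
      using True by (simp add: a_def)
  qed (simp add: a_def)
  from sums_le[OF this S1 S2] show ?thesis .
qed

section \<open>Contraction for exponentials of maxima\<close>

lemma exp_add_le_exp_add: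
  fixes a b a' b' :: real
  assumes "b \<le> a" "b \<le> b'" "a - b \<le> a' - b'"
  shows "exp a + exp b' \<le> exp a' + exp b"
proof -
  have "exp a - exp b = exp b * (exp (a - b) - 1)"
    by (simp add: exp_diff field_simps)
  also have "\<dots> \<le> exp b' * (exp (a' - b') - 1)"
    using assms by (intro mult_mono) auto
  also have "\<dots> = exp a' - exp b'"
    by (simp add: exp_diff field_simps)
  finally show ?thesis by simp
qed

text \<open>Here \<open>i\<close> and \<open>j\<close> attain the two maxima that the left-hand side
  replaces. Both are also candidates in either maximum on the right; the question is only which of
  them to use with which sign.\<close>

lemma exp_Max_contraction_aux:
  fixes a u t :: "'b \<Rightarrow> real"
  assumes T: "finite T" "i \<in> T" "j \<in> T" and t: "0 \<le> t i"
    and ut: "\<And>b. b \<in> T \<Longrightarrow> \<bar>u b\<bar> \<le> \<bar>t b\<bar>"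
    and utt: "\<And>b c. b \<in> T \<Longrightarrow> c \<in> T \<Longrightarrow> \<bar>u b - u c\<bar> \<le> \<bar>t b - t c\<bar>"
    and i: "\<And>b. b \<in> T \<Longrightarrow> a b + u b \<le> a i + u i"
    and j: "\<And>b. b \<in> T \<Longrightarrow> a b - u b \<le> a j - u j"
  shows "exp (a i + u i) + exp (a j - u j)
    \<le> exp (Max ((\<lambda>b. a b + t b) ` T)) + exp (Max ((\<lambda>b. a b - t b) ` T))"
proof -
  have M: "exp (a b + t b) \<le> exp (Max ((\<lambda>b. a b + t b) ` T))"
    "exp (a b - t b) \<le> exp (Max ((\<lambda>b. a b - t b) ` T))" if "b \<in> T" for b
    using that T by (auto intro!: Max_ge)
  note Mij = M[OF T(2)] M[OF T(3)]
  note f = ut[OF T(2)] ut[OF T(3)] utt[OF T(2) T(3)] i[OF T(3)] j[OF T(2)]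
  \<comment> \<open>If \<open>t i\<close> and \<open>t j\<close> have opposite signs, each
    exponential is bounded on its own. Otherwise the index with the larger \<open>t\<close> takes
    the plus sign: its gain outweighs the loss at the other index because \<open>exp\<close> is
    convex and \<open>i\<close>, \<open>j\<close> are maximal.\<close>
  consider "t j \<le> 0" | "0 \<le> t j" "t j \<le> t i" | "t i \<le> t j"
    using t by linarith
  then show ?thesis
  proof cases
    case 1
    then have "exp (a i + u i) \<le> exp (a i + t i)" "exp (a j - u j) \<le> exp (a j - t j)"
      using f t by auto
    then show ?thesis using Mij by linarith
  next
    case 2
    then have "exp (a j - u j) + exp (a i + u i) \<le> exp (a i + t i) + exp (a j - t j)"
      using f t by (intro exp_add_le_exp_add) auto
    then show ?thesis using Mij by linarith
  next
    case 3
    then have "exp (a i + u i) + exp (a j - u j) \<le> exp (a j + t j) + exp (a i - t i)"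
      using f t by (intro exp_add_le_exp_add) auto
    then show ?thesis using Mij by linarith
  qed
qed

text \<open>One step of the Ledoux--Talagrand contraction principle for Rademacher averages.\<close>

lemma exp_Max_contraction:
  fixes a u t :: "'b \<Rightarrow> real"
  assumes T: "finite T" "T \<noteq> {}"
    and ut: "\<And>b. b \<in> T \<Longrightarrow> \<bar>u b\<bar> \<le> \<bar>t b\<bar>"
    and utt: "\<And>b c. b \<in> T \<Longrightarrow> c \<in> T \<Longrightarrow> \<bar>u b - u c\<bar> \<le> \<bar>t b - t c\<bar>"
  shows "exp (Max ((\<lambda>b. a b + u b) ` T)) + exp (Max ((\<lambda>b. a b - u b) ` T))
    \<le> exp (Max ((\<lambda>b. a b + t b) ` T)) + exp (Max ((\<lambda>b. a b - t b) ` T))"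
proof -
  have arg: "\<exists>i\<in>T. Max (f ` T) = f i \<and> (\<forall>b\<in>T. f b \<le> f i)" for f :: "'b \<Rightarrow> real"
  proof -
    have "Max (f ` T) \<in> f ` T" using T by (intro Max_in) auto
    then obtain i where "i \<in> T" "Max (f ` T) = f i" by auto
    moreover have "f b \<le> Max (f ` T)" if "b \<in> T" for b using that T by (auto intro: Max_ge)
    ultimately show ?thesis by auto
  qed
  obtain i where i: "i \<in> T" "Max ((\<lambda>b. a b + u b) ` T) = a i + u i" "\<forall>b\<in>T. a b + u b \<le> a i + u i"
    using arg[of "\<lambda>b. a b + u b"] by blast
  obtain j where j: "j \<in> T" "Max ((\<lambda>b. a b - u b) ` T) = a j - u j" "\<forall>b\<in>T. a b - u b \<le> a j - u j"
    using arg[of "\<lambda>b. a b - u b"] by blast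
  show ?thesis
  proof (cases "0 \<le> t i")
    case True
    then show ?thesis
      using exp_Max_contraction_aux[of T i j t u a] i j T ut utt by simp
  next
    \<comment> \<open>Replacing \<open>t\<close> by its negative exchanges the two summands on the
      right and preserves the hypotheses.\<close>
    case False
    then show ?thesis
      using exp_Max_contraction_aux[of T i j "\<lambda>b. - t b" u a] i j T ut utt
      by (simp add: abs_minus_commute add.commute)
  qed
qed

subsection \<open>Symmetrisation and contraction for subgaussian laws\<close>

lemma ennreal_average:
  assumes "0 \<le> x" "0 \<le> y"
  shows "ennreal ((x + y) / 2) = ennreal (1/2) * (ennreal x + ennreal y)"
proof -
  have "ennreal (1/2) * (ennreal x + ennreal y) = ennreal (1/2) * ennreal (x + y)"
    using assms by simp
  also have "\<dots> = ennreal ((1/2) * (x + y))"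
    using assms by (intro ennreal_mult'[symmetric]) auto
  finally show ?thesis by simp
qed

lemma std_normal_nn_integral_exp:
  "(\<integral>\<^sup>+x. ennreal (exp (t * x)) \<partial>density lborel (\<lambda>x. ennreal (std_normal_density x))) = ennreal (exp (t\<^sup>2 / 2))"
proof -
  have "std_normal_density x * exp (t * x) = exp (t\<^sup>2 / 2) * normal_density t 1 x" for x
    by (simp add: normal_density_def exp_add[symmetric] power2_eq_square field_simps)
  then have "(\<integral>\<^sup>+x. ennreal (exp (t * x)) \<partial>density lborel (\<lambda>x. ennreal (std_normal_density x)))
      = (\<integral>\<^sup>+x. ennreal (exp (t\<^sup>2 / 2)) * ennreal (normal_density t 1 x) \<partial>lborel)"
    by (subst nn_integral_density) (auto simp: ennreal_mult'[symmetric])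
  also have "\<dots> = ennreal (exp (t\<^sup>2 / 2))"
    by (subst nn_integral_cmult) (auto simp: nn_integral_eq_integral)
  finally show ?thesis .
qed

text \<open>The product of the density with \<open>exp (x\<^sup>2 / 4)\<close> is
  \<open>sqrt 2\<close> times the density of a centered normal law of variance 2.\<close>

lemma std_normal_nn_integral_exp_sq:
  "(\<integral>\<^sup>+x. ennreal (exp (x\<^sup>2 / 4)) \<partial>density lborel (\<lambda>x. ennreal (std_normal_density x))) = ennreal (sqrt 2)"
proof -
  have "std_normal_density x * exp (x\<^sup>2 / 4) = sqrt 2 * normal_density 0 (sqrt 2) x" for x
  proof -
    have "sqrt (2 * pi * (sqrt 2)\<^sup>2) = sqrt (2 * pi) * sqrt 2"
      by (subst real_sqrt_mult) auto
    then show ?thesis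
      by (simp add: normal_density_def exp_add[symmetric])
  qed
  then have "(\<integral>\<^sup>+x. ennreal (exp (x\<^sup>2 / 4)) \<partial>density lborel (\<lambda>x. ennreal (std_normal_density x)))
      = (\<integral>\<^sup>+x. ennreal (sqrt 2) * ennreal (normal_density 0 (sqrt 2) x) \<partial>lborel)"
    by (subst nn_integral_density) (auto simp: ennreal_mult'[symmetric])
  also have "\<dots> = ennreal (sqrt 2)"
    by (subst nn_integral_cmult) (auto simp: nn_integral_eq_integral)
  finally show ?thesis .
qed

lemma std_normal_nn_integral_cosh:
  "(\<integral>\<^sup>+x. ennreal (cosh (x * t)) \<partial>density lborel (\<lambda>x. ennreal (std_normal_density x))) = ennreal (exp (t\<^sup>2 / 2))"
proof -
  have "ennreal (cosh (x * t)) = ennreal (1/2) * (ennreal (exp (t * x)) + ennreal (exp ((-t) * x)))" for x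
    by (subst ennreal_average[symmetric]) (auto simp: cosh_def mult.commute)
  then have "(\<integral>\<^sup>+x. ennreal (cosh (x * t)) \<partial>density lborel (\<lambda>x. ennreal (std_normal_density x)))
     = ennreal (1/2) * (ennreal (exp (t\<^sup>2 / 2)) + ennreal (exp ((-t)\<^sup>2 / 2)))"
    unfolding std_normal_nn_integral_exp[symmetric]
    by (simp add: nn_integral_cmult nn_integral_add)
  also have "\<dots> = ennreal (exp (t\<^sup>2 / 2))"
    by (subst ennreal_average[symmetric]) auto
  finally show ?thesis .
qed

lemma prob_space_std_normal: "prob_space (density lborel (\<lambda>x. ennreal (std_normal_density x)))"
  by (rule prob_space_normal_density) simp

text \<open>Jensen's inequality in \<open>ennreal\<close>, where the right-hand side may be
  infinite. In the finite case the tangent line of \<open>exp\<close> at the mean suffices.\<close>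

lemma (in prob_space) exp_expectation_le:
  assumes g: "integrable M g"
  shows "ennreal (exp (expectation g)) \<le> (\<integral>\<^sup>+x. ennreal (exp (g x)) \<partial>M)"
proof (cases "(\<integral>\<^sup>+x. ennreal (exp (g x)) \<partial>M) = \<infinity>")
  case False
  have [measurable]: "g \<in> borel_measurable M" using g by auto
  have int: "integrable M (\<lambda>x. exp (g x))"
    using False by (intro integrableI_nonneg) (auto simp: top.not_eq_extremum)
  define c where "c = expectation g"
  have "exp c = expectation (\<lambda>x. exp c * (1 + (g x - c)))"
    using g by (simp add: c_def prob_space)
  also have "\<dots> \<le> expectation (\<lambda>x. exp (g x))"
  proof (rule integral_mono)
    show "exp c * (1 + (g x - c)) \<le> exp (g x)" for x
      using mult_left_mono[OF exp_ge_add_one_self[of "g x - c"], of "exp c"] by (simp add: exp_diff)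
  qed (use g int in auto)
  finally show ?thesis
    using int by (simp add: nn_integral_eq_integral c_def)
qed simp

lemma cosh_midpoint_le: "cosh ((x + y) / 2) \<le> (cosh x + cosh (y::real)) / 2"
  using convex_onD[OF convex_on_cosh, of "1/2" x y] by (simp add: add_divide_distrib)

lemma exp_half_sum_le: "exp ((x + y) / 2) \<le> (exp x + exp (y::real)) / 2"
proof -
  have "0 \<le> (exp (x/2) - exp (y/2))\<^sup>2" by simp
  also have "\<dots> = exp x + exp y - 2 * exp ((x + y) / 2)"
    by (simp add: power2_eq_square algebra_simps flip: exp_add)
  finally show ?thesis by simp
qed

text \<open>Symmetrisation without an independent copy. A centered value is the midpoint of
  \<open>2 * f b x\<close> and \<open>- 2 * expectation (f b)\<close>; convexity of
  \<open>exp\<close> separates the two, and Jensen's inequality bounds the second by the mean of the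
  maximum with the negative sign. The factor 2 is the price.\<close>

lemma (in prob_space) exp_Max_centered_le:
  fixes f :: "'b \<Rightarrow> 'a \<Rightarrow> real" and a :: "'b \<Rightarrow> real"
  assumes T: "finite T" "T \<noteq> {}" and f: "\<And>b. b \<in> T \<Longrightarrow> integrable M (f b)"
  shows "(\<integral>\<^sup>+x. ennreal (exp (Max ((\<lambda>b. a b + (f b x - expectation (f b))) ` T))) \<partial>M)
     \<le> (\<integral>\<^sup>+x. ennreal ((exp (Max ((\<lambda>b. a b + 2 * f b x) ` T)) + exp (Max ((\<lambda>b. a b - 2 * f b x) ` T))) / 2) \<partial>M)"
proof -
  have fm [measurable]: "f b \<in> borel_measurable M" if "b \<in> T" for b using f[OF that] by auto
  define A where "A = (\<lambda>x. exp (Max ((\<lambda>b. a b + 2 * f b x) ` T)))"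
  define B where "B = (\<lambda>x. exp (Max ((\<lambda>b. a b - 2 * f b x) ` T)))"
  have [measurable]: "A \<in> borel_measurable M" "B \<in> borel_measurable M"
    using T(1) by (auto simp: A_def B_def intro!: borel_measurable_exp borel_measurable_Max)
  have Jensen: "ennreal (exp (a b - 2 * expectation (f b))) \<le> (\<integral>\<^sup>+x. ennreal (B x) \<partial>M)" if "b \<in> T" for b
  proof -
    have "exp (a b - 2 * expectation (f b)) = exp (expectation (\<lambda>x. a b - 2 * f b x))"
      using f[OF that] by (simp add: prob_space)
    also have "ennreal \<dots> \<le> (\<integral>\<^sup>+x. ennreal (exp (a b - 2 * f b x)) \<partial>M)"
      using f[OF that] by (intro exp_expectation_le) auto
    also have "\<dots> \<le> (\<integral>\<^sup>+x. ennreal (B x) \<partial>M)"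
      using that T by (intro nn_integral_mono ennreal_leI) (auto simp: B_def intro!: Max_ge)
    finally show ?thesis .
  qed
  have pw: "ennreal (exp (Max ((\<lambda>b. a b + (f b x - expectation (f b))) ` T)))
      \<le> ennreal (1/2) * ennreal (A x) + ennreal (1/2) * (\<integral>\<^sup>+x. ennreal (B x) \<partial>M)" for x
  proof -
    have "Max ((\<lambda>b. a b + (f b x - expectation (f b))) ` T) \<in> (\<lambda>b. a b + (f b x - expectation (f b))) ` T"
      using T by (intro Max_in) auto
    then obtain b where b: "b \<in> T"
      "Max ((\<lambda>b. a b + (f b x - expectation (f b))) ` T) = a b + (f b x - expectation (f b))" by auto
    have "exp (a b + (f b x - expectation (f b)))
       = exp (((a b + 2 * f b x) + (a b - 2 * expectation (f b))) / 2)"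
      by (simp add: field_simps)
    also have "\<dots> \<le> (exp (a b + 2 * f b x) + exp (a b - 2 * expectation (f b))) / 2"
      by (rule exp_half_sum_le)
    also have "\<dots> \<le> (A x + exp (a b - 2 * expectation (f b))) / 2"
      using b T by (auto simp: A_def intro!: Max_ge)
    finally have "ennreal (exp (a b + (f b x - expectation (f b))))
        \<le> ennreal ((A x + exp (a b - 2 * expectation (f b))) / 2)"
      by (rule ennreal_leI)
    also have "\<dots> = ennreal (1/2) * ennreal (A x) + ennreal (1/2) * ennreal (exp (a b - 2 * expectation (f b)))"
      by (subst ennreal_average) (auto simp: A_def distrib_left)
    also have "\<dots> \<le> ennreal (1/2) * ennreal (A x) + ennreal (1/2) * (\<integral>\<^sup>+x. ennreal (B x) \<partial>M)"
      by (intro add_left_mono mult_left_mono Jensen b) auto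
    finally show ?thesis using b by simp
  qed
  have "(\<integral>\<^sup>+x. ennreal (exp (Max ((\<lambda>b. a b + (f b x - expectation (f b))) ` T))) \<partial>M)
     \<le> (\<integral>\<^sup>+x. ennreal (1/2) * ennreal (A x) + ennreal (1/2) * (\<integral>\<^sup>+x. ennreal (B x) \<partial>M) \<partial>M)"
    by (intro nn_integral_mono pw)
  also have "\<dots> = ennreal (1/2) * (\<integral>\<^sup>+x. ennreal (A x) \<partial>M) + ennreal (1/2) * (\<integral>\<^sup>+x. ennreal (B x) \<partial>M)"
    by (subst nn_integral_add) (auto simp: nn_integral_cmult emeasure_space_1)
  also have "\<dots> = (\<integral>\<^sup>+x. ennreal ((A x + B x) / 2) \<partial>M)"
  proof -
    have eq: "ennreal ((A x + B x) / 2) = ennreal (1/2) * ennreal (A x) + ennreal (1/2) * ennreal (B x)" for x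
      by (subst ennreal_average) (auto simp: A_def B_def distrib_left)
    show ?thesis
      unfolding eq by (subst nn_integral_add) (auto simp: nn_integral_cmult)
  qed
  finally show ?thesis by (simp add: A_def B_def)
qed

section \<open>Laws with sub-Gaussian coordinates\<close>

locale coord_law = prob_space P for P :: "rvec measure" +
  fixes d :: nat
  assumes coord_measurable [measurable]: "k < d \<Longrightarrow> (\<lambda>x. x k) \<in> borel_measurable P"
begin

lemma inner_prod_measurable [measurable]: "inner_prod d b \<in> borel_measurable P"
  unfolding inner_prod_def by (rule borel_measurable_sum) auto

end

text \<open>Sub-Gaussianity about 0, one coordinate at a time and with no centering;
  \<open>cosh\<close> covers both signs of \<open>t\<close> at once. For the mixture,
  \<open>q k\<close> will be the second moment of the coordinate plus a small positive amount.
  Strict positivity allows division by \<open>q k\<close>.\<close>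

locale subgaussian_law = coord_law +
  fixes q :: "nat \<Rightarrow> real"
  assumes q_pos: "k < d \<Longrightarrow> 0 < q k"
    and subgaussian: "k < d \<Longrightarrow> (\<integral>\<^sup>+x. ennreal (cosh (t * x k)) \<partial>P) \<le> ennreal (exp (t\<^sup>2 * q k / 2))"
begin

text \<open>The square is linearised by averaging \<open>cosh (t x)\<close> over a standard normal \<open>t\<close>.\<close>

lemma nn_integral_exp_square_le:
  assumes k: "k < d"
  shows "(\<integral>\<^sup>+x. ennreal (exp ((x k)\<^sup>2 / (4 * q k))) \<partial>P) \<le> ennreal (sqrt 2)"
proof -
  let ?N = "density lborel (\<lambda>x. ennreal (std_normal_density x))"
  interpret N: prob_space ?N by (rule prob_space_std_normal)
  interpret pair_sigma_finite P ?N ..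
  note [measurable] = coord_measurable[OF k]
  \<comment> \<open>For this \<open>s\<close>, averaging \<open>cosh (t * (s * x k))\<close> over
    \<open>t\<close> gives \<open>exp ((x k)\<^sup>2 / (4 * q k))\<close>, while averaging over
    \<open>x\<close> first leaves at most \<open>exp (t\<^sup>2 / 4)\<close>, which the normal law
    still integrates.\<close>
  define s where "s = 1 / sqrt (2 * q k)"
  have s2: "s\<^sup>2 = 1 / (2 * q k)" using q_pos[OF k] by (simp add: s_def power_divide)
  have "(\<integral>\<^sup>+x. ennreal (exp ((x k)\<^sup>2 / (4 * q k))) \<partial>P) = (\<integral>\<^sup>+x. (\<integral>\<^sup>+t. ennreal (cosh (t * (s * x k))) \<partial>?N) \<partial>P)"
    by (simp add: std_normal_nn_integral_cosh power_mult_distrib s2)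
  also have "\<dots> = (\<integral>\<^sup>+t. (\<integral>\<^sup>+x. ennreal (cosh (t * (s * x k))) \<partial>P) \<partial>?N)"
    by (rule Fubini'[symmetric]) measurable
  also have "\<dots> \<le> (\<integral>\<^sup>+t. ennreal (exp (t\<^sup>2 / 4)) \<partial>?N)"
  proof (rule nn_integral_mono)
    fix t
    have "(\<integral>\<^sup>+x. ennreal (cosh (t * (s * x k))) \<partial>P) \<le> ennreal (exp ((t * s)\<^sup>2 * q k / 2))"
      using subgaussian[OF k, of "t * s"] by (simp add: mult.assoc)
    also have "(t * s)\<^sup>2 * q k / 2 = t\<^sup>2 / 4"
      using q_pos[OF k] by (simp add: power_mult_distrib s2)
    finally show "(\<integral>\<^sup>+x. ennreal (cosh (t * (s * x k))) \<partial>P) \<le> ennreal (exp (t\<^sup>2 / 4))" .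
  qed
  also have "\<dots> = ennreal (sqrt 2)" by (rule std_normal_nn_integral_exp_sq)
  finally show ?thesis .
qed

lemma integrable_exp_square:
  assumes "k < d"
  shows "integrable P (\<lambda>x. exp ((x k)\<^sup>2 / (4 * q k)))"
  using coord_measurable[OF assms] nn_integral_exp_square_le[OF assms]
  by (intro integrableI_nonneg) (auto simp: order_le_less_trans)

lemma integrable_coord_square:
  assumes k: "k < d"
  shows "integrable P (\<lambda>x. (x k)\<^sup>2)"
proof (rule Bochner_Integration.integrable_bound)
  show "integrable P (\<lambda>x. 4 * q k * exp ((x k)\<^sup>2 / (4 * q k)))"
    using integrable_exp_square[OF k] by simp
  have "y\<^sup>2 \<le> 4 * q k * exp (y\<^sup>2 / (4 * q k))" for y :: real
  proof -
    have "y\<^sup>2 / (4 * q k) \<le> exp (y\<^sup>2 / (4 * q k))"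
      using exp_ge_add_one_self[of "y\<^sup>2 / (4 * q k)"] by linarith
    then show ?thesis using q_pos[OF k] by (simp add: field_simps)
  qed
  then show "AE x in P. norm ((x k)\<^sup>2) \<le> norm (4 * q k * exp ((x k)\<^sup>2 / (4 * q k)))"
    using q_pos[OF k] by (simp add: abs_mult)
qed (use coord_measurable[OF k] in measurable)

text \<open>Since \<open>cosh\<close> is even, no term linear in \<open>\<rho>\<close> arises: near
  0 the normalised square behaves like a sub-Gaussian variable although it is not centered.\<close>

lemma nn_integral_cosh_square_le:
  assumes k: "k < d" and \<rho>: "\<bar>\<rho>\<bar> \<le> 1 / 8"
  shows "(\<integral>\<^sup>+x. ennreal (cosh (\<rho> * ((x k)\<^sup>2 / q k))) \<partial>P) \<le> ennreal (exp (100 * \<rho>\<^sup>2))"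
proof -
  note [measurable] = coord_measurable[OF k]
  \<comment> \<open>One factor \<open>exp (y / 8)\<close> absorbs the square
    \<open>y\<^sup>2\<close>, another one the exponential of \<open>\<rho> * y\<close>; this is
    where the range of \<open>\<rho>\<close> is spent. Their product is exactly the function whose
    mean is at most \<open>sqrt 2\<close>, and \<open>64 * sqrt 2 \<le> 100\<close>.\<close>
  have pw: "cosh (\<rho> * y) \<le> 1 + 64 * \<rho>\<^sup>2 * exp (y / 4)" if "0 \<le> y" for y
  proof -
    have "y\<^sup>2 / 64 \<le> exp (y / 8)"
    proof -
      have "y / 16 * 2 \<le> exp (y/16 - 1) * exp 1"
        using exp_ge_add_one_self[of "y/16 - 1"] exp_ge_add_one_self[of 1] that by (intro mult_mono) auto
      then have "y / 8 \<le> exp (y / 16)" by (simp add: exp_diff)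
      then have "(y/8)\<^sup>2 \<le> (exp (y/16))\<^sup>2"
        using that by (intro power_mono) auto
      moreover have "(exp (y/16))\<^sup>2 = exp (y/8)"
        by (simp add: power2_eq_square exp_add[symmetric])
      ultimately show ?thesis by (simp add: power_divide)
    qed
    have "cosh (\<rho> * y) \<le> 1 + (\<rho> * y)\<^sup>2 * exp \<bar>\<rho> * y\<bar>" by (rule cosh_le_quadratic_exp)
    also have "\<dots> \<le> 1 + (\<rho>\<^sup>2 * (64 * exp (y/8))) * exp (y/8)"
    proof -
      have "\<bar>\<rho> * y\<bar> \<le> y / 8"
        using mult_right_mono[OF \<rho> that] that by (simp add: abs_mult)
      moreover have "(\<rho> * y)\<^sup>2 \<le> \<rho>\<^sup>2 * (64 * exp (y/8))"
        using \<open>y\<^sup>2 / 64 \<le> exp (y / 8)\<close> by (auto simp: power_mult_distrib intro!: mult_left_mono)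
      ultimately show ?thesis by (intro add_left_mono mult_mono) auto
    qed
    also have "\<dots> = 1 + 64 * \<rho>\<^sup>2 * exp (y / 4)"
      by (simp add: exp_add[symmetric])
    finally show ?thesis .
  qed
  have "(\<integral>\<^sup>+x. ennreal (cosh (\<rho> * ((x k)\<^sup>2 / q k))) \<partial>P)
      \<le> (\<integral>\<^sup>+x. 1 + ennreal (64 * \<rho>\<^sup>2) * ennreal (exp ((x k)\<^sup>2 / (4 * q k))) \<partial>P)"
  proof (rule nn_integral_mono)
    fix x
    have "ennreal (cosh (\<rho> * ((x k)\<^sup>2 / q k))) \<le> ennreal (1 + 64 * \<rho>\<^sup>2 * exp (((x k)\<^sup>2 / q k) / 4))"
      using q_pos[OF k] by (intro ennreal_leI pw) simp
    also have "\<dots> = 1 + ennreal (64 * \<rho>\<^sup>2) * ennreal (exp ((x k)\<^sup>2 / (4 * q k)))"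
      by (subst ennreal_plus) (auto simp: ennreal_mult' mult.commute)
    finally show "ennreal (cosh (\<rho> * ((x k)\<^sup>2 / q k))) \<le> 1 + ennreal (64 * \<rho>\<^sup>2) * ennreal (exp ((x k)\<^sup>2 / (4 * q k)))" .
  qed
  also have "\<dots> = 1 + ennreal (64 * \<rho>\<^sup>2) * (\<integral>\<^sup>+x. ennreal (exp ((x k)\<^sup>2 / (4 * q k))) \<partial>P)"
    by (subst nn_integral_add) (auto simp: nn_integral_cmult emeasure_space_1)
  also have "\<dots> \<le> 1 + ennreal (64 * \<rho>\<^sup>2) * ennreal (sqrt 2)"
    by (intro add_left_mono mult_left_mono nn_integral_exp_square_le k) auto
  also have "\<dots> = ennreal (1 + 64 * \<rho>\<^sup>2 * sqrt 2)"
    by (subst ennreal_plus) (auto simp: ennreal_mult')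
  also have "\<dots> \<le> ennreal (exp (100 * \<rho>\<^sup>2))"
  proof (rule ennreal_leI)
    have "sqrt 2 \<le> 100 / (64::real)" by (rule real_le_lsqrt) (auto simp: power2_eq_square)
    then have "64 * \<rho>\<^sup>2 * sqrt 2 \<le> 64 * \<rho>\<^sup>2 * (100/64)" by (intro mult_left_mono) auto
    moreover have "64 * \<rho>\<^sup>2 * (100/64) = 100 * \<rho>\<^sup>2" by simp
    ultimately show "1 + 64 * \<rho>\<^sup>2 * sqrt 2 \<le> exp (100 * \<rho>\<^sup>2)"
      using exp_ge_add_one_self[of "100 * \<rho>\<^sup>2"] by linarith
  qed
  finally show ?thesis .
qed

text \<open>The product of two coordinates is at most the mean of their normalised squares, up to
  the factor \<open>\<rho> = 2 * \<bar>r\<bar> * sqrt (q k * q l)\<close>, and convexity of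
  \<open>cosh\<close> reduces to a single coordinate. The condition on \<open>r\<close> says that
  \<open>\<rho> \<le> 1 / 8\<close>, and 400 is 4 times 100.\<close>

lemma nn_integral_cosh_mult_le:
  assumes k: "k < d" and l: "l < d" and r: "256 * r\<^sup>2 * (q k * q l) \<le> 1"
  shows "(\<integral>\<^sup>+x. ennreal (cosh (2 * r * (x k * x l))) \<partial>P) \<le> ennreal (exp (400 * r\<^sup>2 * (q k * q l)))"
proof -
  note [measurable] = coord_measurable[OF k] coord_measurable[OF l]
  define \<rho> where "\<rho> = 2 * \<bar>r\<bar> * sqrt (q k * q l)"
  have qq: "0 < q k" "0 < q l" using q_pos k l by auto
  have \<rho>2: "\<rho>\<^sup>2 = 4 * r\<^sup>2 * (q k * q l)"
    using qq by (simp add: \<rho>_def power_mult_distrib)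
  have \<rho>0: "0 \<le> \<rho>" using qq by (simp add: \<rho>_def)
  have \<rho>8: "\<bar>\<rho>\<bar> \<le> 1 / 8"
  proof -
    have "\<rho>\<^sup>2 \<le> (1/8)\<^sup>2" using r unfolding \<rho>2 by (simp add: power_divide)
    then have "\<rho> \<le> 1 / 8" by (rule power2_le_imp_le) simp
    then show ?thesis using \<rho>0 by linarith
  qed
  have pw: "cosh (2 * r * (y * z)) \<le> (cosh (\<rho> * (y\<^sup>2 / q k)) + cosh (\<rho> * (z\<^sup>2 / q l))) / 2" for y z :: real
  proof -
    have "\<bar>2 * r * (y * z)\<bar> \<le> (\<rho> * (y\<^sup>2 / q k) + \<rho> * (z\<^sup>2 / q l)) / 2"
    proof -
      define u where "u = \<bar>y\<bar> / sqrt (q k)"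
      define v where "v = \<bar>z\<bar> / sqrt (q l)"
      have "0 \<le> (u - v)\<^sup>2" by simp
      then have "2 * (u * v) \<le> u\<^sup>2 + v\<^sup>2" by (simp add: power2_eq_square algebra_simps)
      then have "\<rho> * (2 * (u * v)) \<le> \<rho> * (u\<^sup>2 + v\<^sup>2)" using \<rho>0 by (intro mult_left_mono)
      moreover have "\<rho> * (u * v) = \<bar>2 * r * (y * z)\<bar>"
        using qq by (simp add: \<rho>_def u_def v_def real_sqrt_mult abs_mult)
      moreover have "u\<^sup>2 = y\<^sup>2 / q k" "v\<^sup>2 = z\<^sup>2 / q l"
        using qq by (simp_all add: u_def v_def power_divide)
      ultimately show ?thesis by (simp add: algebra_simps)
    qed
    then have "cosh \<bar>2 * r * (y * z)\<bar> \<le> cosh ((\<rho> * (y\<^sup>2 / q k) + \<rho> * (z\<^sup>2 / q l)) / 2)"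
      by (subst cosh_real_nonneg_le_iff) auto
    also have "\<dots> \<le> (cosh (\<rho> * (y\<^sup>2 / q k)) + cosh (\<rho> * (z\<^sup>2 / q l))) / 2"
      by (rule cosh_midpoint_le)
    finally show ?thesis by simp
  qed
  have "(\<integral>\<^sup>+x. ennreal (cosh (2 * r * (x k * x l))) \<partial>P)
     \<le> (\<integral>\<^sup>+x. ennreal (1/2) * (ennreal (cosh (\<rho> * ((x k)\<^sup>2 / q k))) + ennreal (cosh (\<rho> * ((x l)\<^sup>2 / q l)))) \<partial>P)"
    using pw by (intro nn_integral_mono) (subst ennreal_average[symmetric], auto intro: ennreal_leI)
  also have "\<dots> = ennreal (1/2) * ((\<integral>\<^sup>+x. ennreal (cosh (\<rho> * ((x k)\<^sup>2 / q k))) \<partial>P) + (\<integral>\<^sup>+x. ennreal (cosh (\<rho> * ((x l)\<^sup>2 / q l))) \<partial>P))"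
    by (simp add: nn_integral_cmult nn_integral_add)
  also have "\<dots> \<le> ennreal (1/2) * (ennreal (exp (100 * \<rho>\<^sup>2)) + ennreal (exp (100 * \<rho>\<^sup>2)))"
    by (intro mult_left_mono add_mono nn_integral_cosh_square_le k l \<rho>8) auto
  also have "\<dots> = ennreal (exp (400 * r\<^sup>2 * (q k * q l)))"
    by (subst ennreal_average[symmetric]) (auto simp: \<rho>2)
  finally show ?thesis .
qed

lemma integrable_coord_mult_Lipschitz:
  assumes k: "k < d" and \<phi>0: "\<phi> 0 = 0" and \<phi>: "\<And>x y. \<bar>\<phi> x - \<phi> y\<bar> \<le> \<bar>x - y\<bar>"
    and [measurable]: "\<phi> \<in> borel_measurable borel"
  shows "integrable P (\<lambda>x. x k * \<phi> (inner_prod d b x))"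
proof (rule Bochner_Integration.integrable_bound)
  note [measurable] = coord_measurable[OF k]
  show "(\<lambda>x. x k * \<phi> (inner_prod d b x)) \<in> borel_measurable P" by measurable
  show "integrable P (\<lambda>x. \<Sum>l<d. \<bar>b l\<bar> * ((x k)\<^sup>2 + (x l)\<^sup>2))"
    using integrable_coord_square k by auto
  have "\<bar>x k * \<phi> (inner_prod d b x)\<bar> \<le> (\<Sum>l<d. \<bar>b l\<bar> * ((x k)\<^sup>2 + (x l)\<^sup>2))" for x
  proof -
    have "\<bar>x k * \<phi> (inner_prod d b x)\<bar> \<le> \<bar>x k\<bar> * \<bar>inner_prod d b x\<bar>"
      using \<phi>[of "inner_prod d b x" 0] \<phi>0 by (auto simp: abs_mult intro!: mult_left_mono)
    also have "\<dots> \<le> \<bar>x k\<bar> * (\<Sum>l<d. \<bar>b l * x l\<bar>)"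
      unfolding inner_prod_def by (intro mult_left_mono sum_abs) auto
    also have "\<dots> = (\<Sum>l<d. \<bar>b l\<bar> * \<bar>x k * x l\<bar>)"
      by (simp add: sum_distrib_left abs_mult mult_ac)
    also have "\<dots> \<le> (\<Sum>l<d. \<bar>b l\<bar> * ((x k)\<^sup>2 + (x l)\<^sup>2))"
    proof (intro sum_mono mult_left_mono)
      show "\<bar>x k * x l\<bar> \<le> (x k)\<^sup>2 + (x l)\<^sup>2" for l
      proof -
        have "2 * \<bar>x k * x l\<bar> \<le> (x k)\<^sup>2 + (x l)\<^sup>2"
          using sum_squares_bound[of "\<bar>x k\<bar>" "\<bar>x l\<bar>"] by (simp add: abs_mult mult.assoc)
        then show ?thesis using abs_ge_zero[of "x k * x l"] by linarith
      qed
    qed auto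
    finally show ?thesis .
  qed
  then show "AE x in P. norm (x k * \<phi> (inner_prod d b x)) \<le> norm (\<Sum>l<d. \<bar>b l\<bar> * ((x k)\<^sup>2 + (x l)\<^sup>2))"
    by (intro AE_I2) (smt (verit) real_norm_def)
qed

abbreviation sample_measure :: "nat \<Rightarrow> (nat \<Rightarrow> rvec) measure" where
  "sample_measure n \<equiv> \<Pi>\<^sub>M i\<in>{..<n}. P"

lemma prob_space_sample: "prob_space (sample_measure n)"
  by (rule prob_space_PiM) (rule prob_space_axioms)

definition centered :: "(real \<Rightarrow> real) \<Rightarrow> nat \<Rightarrow> rvec \<Rightarrow> rvec \<Rightarrow> real" where
  "centered \<phi> k b x = x k * \<phi> (inner_prod d b x) - expectation (\<lambda>x. x k * \<phi> (inner_prod d b x))"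

lemma centered_measurable [measurable]:
  assumes [measurable]: "k < d" "\<phi> \<in> borel_measurable borel"
  shows "centered \<phi> k b \<in> borel_measurable P"
  unfolding centered_def using coord_measurable[OF assms(1)] by measurable

lemma sample_centered_measurable [measurable]:
  "i < n \<Longrightarrow> k < d \<Longrightarrow> \<phi> \<in> borel_measurable borel \<Longrightarrow>
   (\<lambda>xs. centered \<phi> k b (xs i)) \<in> borel_measurable (sample_measure n)"
  by (rule measurable_compose[where f = "\<lambda>xs. xs i", OF _ centered_measurable]) (auto intro!: measurable_component_singleton)

text \<open>The vector \<open>v\<close> is the state of an induction over samples: a sample that has
  been symmetrised and contracted contributes a signed multiple of itself to \<open>v\<close> and
  leaves the sum.\<close>

definition centered_Max :: "(real \<Rightarrow> real) \<Rightarrow> nat \<Rightarrow> rvec set \<Rightarrow> nat \<Rightarrow> rvec \<Rightarrow> (nat \<Rightarrow> rvec) \<Rightarrow> real" where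
  "centered_Max \<phi> k T n v xs = Max ((\<lambda>b. inner_prod d b v + (\<Sum>i<n. centered \<phi> k b (xs i))) ` T)"

lemma centered_Max_measurable [measurable]:
  "finite T \<Longrightarrow> k < d \<Longrightarrow> \<phi> \<in> borel_measurable borel \<Longrightarrow>
   centered_Max \<phi> k T n v \<in> borel_measurable (sample_measure n)"
  unfolding centered_Max_def
  by (intro borel_measurable_Max borel_measurable_add borel_measurable_sum sample_centered_measurable) auto

text \<open>Symmetrisation and contraction replace, one sample at a time, the centered nonlinear summand by
  a random sign times a linear one; the hyperbolic cosines are eigenfunctions of that last step.\<close>

lemma nn_integral_exp_Max_sample_le:
  assumes T: "finite T" "T \<noteq> {}" and k: "k < d"
    and \<phi>0: "\<phi> 0 = 0" and \<phi>: "\<And>x y. \<bar>\<phi> x - \<phi> y\<bar> \<le> \<bar>x - y\<bar>"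
    and \<phi>m [measurable]: "\<phi> \<in> borel_measurable borel"
    and L: "finite L" "L \<subseteq> {..<d}" and c: "\<And>l. l \<in> L \<Longrightarrow> 0 \<le> c l" and G: "0 \<le> G"
    and maj: "\<And>v. exp (Max ((\<lambda>b. inner_prod d b v) ` T)) \<le> (\<Sum>l\<in>L. c l * cosh (r l * v l))"
    and mgf: "\<And>l. l \<in> L \<Longrightarrow> (\<integral>\<^sup>+x. ennreal (cosh (2 * r l * (x k * x l))) \<partial>P) \<le> ennreal G"
  shows "(\<integral>\<^sup>+xs. ennreal (exp (centered_Max \<phi> k T n v xs)) \<partial>sample_measure n)
     \<le> ennreal ((\<Sum>l\<in>L. c l * cosh (r l * v l)) * G ^ n)"
proof (induction n arbitrary: v)
  case 0
  then show ?case
    using maj[of v] by (simp add: centered_Max_def nn_integral_empty product_sigma_finite_def sigma_finite_measure_axioms PiM_empty nn_integral_count_space_finite ennreal_leI)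
next
  case (Suc n)
  interpret product_sigma_finite "\<lambda>_::nat. P"
    by standard
  interpret Pn: prob_space "sample_measure n"
    by (rule prob_space_PiM) (rule prob_space_axioms)
  interpret PP: pair_sigma_finite "sample_measure n" P ..
  note [measurable] = coord_measurable[OF k]
  have [measurable]: "(\<lambda>x. x l) \<in> borel_measurable P" if "l \<in> L" for l
    using that L by (intro coord_measurable) auto
  define f where "f = (\<lambda>b x. x k * \<phi> (inner_prod d b x))"
  define a where "a = (\<lambda>\<omega> b. inner_prod d b v + (\<Sum>i<n. centered \<phi> k b (\<omega> i)))"
  define Q where "Q = (\<lambda>v. \<integral>\<^sup>+xs. ennreal (exp (centered_Max \<phi> k T n v xs)) \<partial>sample_measure n)"
  define H where "H = (\<lambda>\<omega> y. (exp (Max ((\<lambda>b. a \<omega> b + 2 * (y k * inner_prod d b y)) ` T))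
       + exp (Max ((\<lambda>b. a \<omega> b - 2 * (y k * inner_prod d b y)) ` T))) / 2)"
  have am [measurable]: "(\<lambda>\<omega>. a \<omega> b) \<in> borel_measurable (sample_measure n)" for b
    unfolding a_def using k by measurable
  have ap [measurable]: "(\<lambda>z. a (fst z) b) \<in> borel_measurable (sample_measure n \<Otimes>\<^sub>M P)" for b
    using measurable_compose[OF measurable_fst am] by simp
  have [measurable]: "(\<lambda>z. snd z k) \<in> borel_measurable (sample_measure n \<Otimes>\<^sub>M P)"
    "(\<lambda>z. inner_prod d b (snd z)) \<in> borel_measurable (sample_measure n \<Otimes>\<^sub>M P)" for b
    using measurable_compose[OF measurable_snd coord_measurable[OF k]]
      measurable_compose[OF measurable_snd inner_prod_measurable] by auto
  have [measurable]: "(\<lambda>z. Max ((\<lambda>b. a (fst z) b + 2 * (snd z k * inner_prod d b (snd z))) ` T)) \<in> borel_measurable (sample_measure n \<Otimes>\<^sub>M P)"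
    "(\<lambda>z. Max ((\<lambda>b. a (fst z) b - 2 * (snd z k * inner_prod d b (snd z))) ` T)) \<in> borel_measurable (sample_measure n \<Otimes>\<^sub>M P)"
    by (intro borel_measurable_Max T; measurable)+
  have Hm: "(\<lambda>z. H (fst z) (snd z)) \<in> borel_measurable (sample_measure n \<Otimes>\<^sub>M P)"
    unfolding H_def by measurable
  have "(\<integral>\<^sup>+xs. ennreal (exp (centered_Max \<phi> k T (Suc n) v xs)) \<partial>sample_measure (Suc n))
    = (\<integral>\<^sup>+\<omega>. (\<integral>\<^sup>+y. ennreal (exp (Max ((\<lambda>b. a \<omega> b + (f b y - expectation (f b))) ` T))) \<partial>P) \<partial>sample_measure n)"
  proof -
    have "(\<lambda>xs. ennreal (exp (centered_Max \<phi> k T (Suc n) v xs))) \<in> borel_measurable (sample_measure (Suc n))"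
      using T k by measurable
    then have "(\<integral>\<^sup>+xs. ennreal (exp (centered_Max \<phi> k T (Suc n) v xs)) \<partial>sample_measure (Suc n))
      = (\<integral>\<^sup>+\<omega>. (\<integral>\<^sup>+y. ennreal (exp (centered_Max \<phi> k T (Suc n) v (fun_upd \<omega> n y))) \<partial>P) \<partial>sample_measure n)"
      unfolding lessThan_Suc by (intro product_nn_integral_insert) auto
    then show ?thesis
      by (simp add: centered_Max_def a_def f_def centered_def add.assoc)
  qed
  \<comment> \<open>With the other samples frozen in \<open>a\<close>, the last sample is
    symmetrised, and contraction then replaces \<open>\<phi>\<close> by the identity for each value
    \<open>y\<close>.\<close>
  also have "\<dots> \<le> (\<integral>\<^sup>+\<omega>. (\<integral>\<^sup>+y. ennreal (H \<omega> y) \<partial>P) \<partial>sample_measure n)"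
  proof (rule nn_integral_mono)
    fix \<omega> :: "nat \<Rightarrow> rvec"
    have "(\<integral>\<^sup>+y. ennreal (exp (Max ((\<lambda>b. a \<omega> b + (f b y - expectation (f b))) ` T))) \<partial>P)
      \<le> (\<integral>\<^sup>+y. ennreal ((exp (Max ((\<lambda>b. a \<omega> b + 2 * f b y) ` T)) + exp (Max ((\<lambda>b. a \<omega> b - 2 * f b y) ` T))) / 2) \<partial>P)"
      by (intro exp_Max_centered_le T) (auto simp: f_def intro!: integrable_coord_mult_Lipschitz k \<phi>0 \<phi> \<phi>m)
    also have "\<dots> \<le> (\<integral>\<^sup>+y. ennreal (H \<omega> y) \<partial>P)"
    proof (intro nn_integral_mono ennreal_leI)
      fix y :: rvec
      have "exp (Max ((\<lambda>b. a \<omega> b + 2 * f b y) ` T)) + exp (Max ((\<lambda>b. a \<omega> b - 2 * f b y) ` T))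
        \<le> exp (Max ((\<lambda>b. a \<omega> b + 2 * (y k * inner_prod d b y)) ` T)) + exp (Max ((\<lambda>b. a \<omega> b - 2 * (y k * inner_prod d b y)) ` T))"
      proof (rule exp_Max_contraction[OF T])
        fix b c
        show "\<bar>2 * f b y - 2 * f c y\<bar> \<le> \<bar>2 * (y k * inner_prod d b y) - 2 * (y k * inner_prod d c y)\<bar>"
          using mult_left_mono[OF \<phi>[of "inner_prod d b y" "inner_prod d c y"], of "\<bar>2 * y k\<bar>"]
          by (simp add: f_def abs_mult[symmetric] algebra_simps)
        show "\<bar>2 * f b y\<bar> \<le> \<bar>2 * (y k * inner_prod d b y)\<bar>"
          using mult_left_mono[OF \<phi>[of "inner_prod d b y" 0], of "\<bar>2 * y k\<bar>"] \<phi>0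
          by (simp add: f_def abs_mult[symmetric] algebra_simps)
      qed
      then show "(exp (Max ((\<lambda>b. a \<omega> b + 2 * f b y) ` T)) + exp (Max ((\<lambda>b. a \<omega> b - 2 * f b y) ` T))) / 2 \<le> H \<omega> y"
        by (simp add: H_def)
    qed
    finally show "(\<integral>\<^sup>+y. ennreal (exp (Max ((\<lambda>b. a \<omega> b + (f b y - expectation (f b))) ` T))) \<partial>P)
      \<le> (\<integral>\<^sup>+y. ennreal (H \<omega> y) \<partial>P)" .
  qed
  \<comment> \<open>The other samples go inside, so that for a fixed last sample \<open>y\<close>
    the induction hypothesis applies with \<open>v\<close> shifted by \<open>2 * y k\<close> times
    \<open>y\<close> in either direction.\<close>
  also have "\<dots> = (\<integral>\<^sup>+y. (\<integral>\<^sup>+\<omega>. ennreal (H \<omega> y) \<partial>sample_measure n) \<partial>P)"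
    using Hm by (intro PP.Fubini'[symmetric]) (simp add: case_prod_beta')
  also have "\<dots> \<le> (\<integral>\<^sup>+y. (\<Sum>l\<in>L. ennreal (c l * cosh (r l * v l) * G ^ n) * ennreal (cosh (2 * r l * (y k * y l)))) \<partial>P)"
  proof (rule nn_integral_mono)
    fix y :: rvec
    define w where "w = (\<lambda>l. 2 * y k * y l)"
    have ip: "inner_prod d b (\<lambda>l. v l + w l) = inner_prod d b v + 2 * (y k * inner_prod d b y)"
      "inner_prod d b (\<lambda>l. v l - w l) = inner_prod d b v - 2 * (y k * inner_prod d b y)" for b
      by (simp_all add: inner_prod_def w_def sum.distrib sum_subtractf sum_distrib_left algebra_simps)
    have "(\<integral>\<^sup>+\<omega>. ennreal (H \<omega> y) \<partial>sample_measure n) = ennreal (1/2) * (Q (\<lambda>l. v l + w l) + Q (\<lambda>l. v l - w l))"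
    proof -
      have e: "a \<omega> b + 2 * (y k * inner_prod d b y) = inner_prod d b (\<lambda>l. v l + w l) + (\<Sum>i<n. centered \<phi> k b (\<omega> i))"
        "a \<omega> b - 2 * (y k * inner_prod d b y) = inner_prod d b (\<lambda>l. v l - w l) + (\<Sum>i<n. centered \<phi> k b (\<omega> i))" for \<omega> b
        by (simp_all add: ip a_def)
      have [measurable]: "centered_Max \<phi> k T n u \<in> borel_measurable (sample_measure n)" for u
        using T k by measurable
      show ?thesis
        unfolding H_def e Q_def centered_Max_def[symmetric]
        by (subst ennreal_average) (auto simp: nn_integral_cmult nn_integral_add)
    qed
    also have "\<dots> \<le> ennreal (1/2) * (ennreal ((\<Sum>l\<in>L. c l * cosh (r l * (v l + w l))) * G ^ n) + ennreal ((\<Sum>l\<in>L. c l * cosh (r l * (v l - w l))) * G ^ n))"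
      unfolding Q_def by (intro mult_left_mono add_mono Suc.IH) auto
    also have "\<dots> = ennreal (((\<Sum>l\<in>L. c l * cosh (r l * (v l + w l))) * G ^ n + (\<Sum>l\<in>L. c l * cosh (r l * (v l - w l))) * G ^ n) / 2)"
      using c G by (intro ennreal_average[symmetric] mult_nonneg_nonneg sum_nonneg) auto
    also have "((\<Sum>l\<in>L. c l * cosh (r l * (v l + w l))) * G ^ n + (\<Sum>l\<in>L. c l * cosh (r l * (v l - w l))) * G ^ n) / 2
       = (\<Sum>l\<in>L. c l * cosh (r l * v l) * G ^ n * cosh (2 * r l * (y k * y l)))"
    proof -
      have *: "c l * cosh (r l * (v l + w l)) * G ^ n + c l * cosh (r l * (v l - w l)) * G ^ n
          = 2 * (c l * cosh (r l * v l) * G ^ n * cosh (2 * r l * (y k * y l)))" for l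
      proof -
        have "r l * (v l + w l) = r l * v l + 2 * r l * (y k * y l)"
          "r l * (v l - w l) = r l * v l - 2 * r l * (y k * y l)"
          by (simp_all add: w_def algebra_simps)
        then have "cosh (r l * (v l + w l)) + cosh (r l * (v l - w l)) = 2 * (cosh (r l * v l) * cosh (2 * r l * (y k * y l)))"
          by (simp add: cosh_add cosh_diff)
        moreover have "c l * cosh (r l * (v l + w l)) * G ^ n + c l * cosh (r l * (v l - w l)) * G ^ n
            = c l * G ^ n * (cosh (r l * (v l + w l)) + cosh (r l * (v l - w l)))"
          by (simp add: algebra_simps)
        ultimately show ?thesis by (simp only: mult_ac)
      qed
      show ?thesis
        by (simp add: sum_distrib_right sum.distrib[symmetric] * sum_distrib_left[symmetric])
    qed
    also have "ennreal \<dots> = (\<Sum>l\<in>L. ennreal (c l * cosh (r l * v l) * G ^ n) * ennreal (cosh (2 * r l * (y k * y l))))"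
      using c G by (subst sum_ennreal[symmetric]) (auto simp: ennreal_mult' intro!: sum.cong)
    finally show "(\<integral>\<^sup>+\<omega>. ennreal (H \<omega> y) \<partial>sample_measure n)
       \<le> (\<Sum>l\<in>L. ennreal (c l * cosh (r l * v l) * G ^ n) * ennreal (cosh (2 * r l * (y k * y l))))" .
  qed
  also have "\<dots> = (\<Sum>l\<in>L. ennreal (c l * cosh (r l * v l) * G ^ n) * (\<integral>\<^sup>+y. ennreal (cosh (2 * r l * (y k * y l))) \<partial>P))"
    by (subst nn_integral_sum) (auto simp: nn_integral_cmult)
  also have "\<dots> \<le> (\<Sum>l\<in>L. ennreal (c l * cosh (r l * v l) * G ^ n) * ennreal G)"
    by (intro sum_mono mult_left_mono mgf) auto
  also have "\<dots> = ennreal ((\<Sum>l\<in>L. c l * cosh (r l * v l)) * G ^ Suc n)"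
    using c G by (simp add: ennreal_mult'[symmetric] sum_distrib_right sum_distrib_left mult_ac)
  finally show ?case .
qed

end

subsection \<open>Uniform concentration of the samples\<close>

lemma abs_inner_prod_le: "\<bar>inner_prod d u v\<bar> \<le> norm2 d u * norm2 d v"
proof -
  have "\<bar>inner_prod d u v\<bar> \<le> (\<Sum>i<d. \<bar>u i\<bar> * \<bar>v i\<bar>)"
    unfolding inner_prod_def by (rule order_trans[OF sum_abs]) (simp add: abs_mult)
  also have "\<dots> \<le> norm2 d u * norm2 d v"
    unfolding norm2_def by (rule L2_set_mult_ineq)
  finally show ?thesis .
qed

lemma norm2_nonneg [simp]: "0 \<le> norm2 d v"
  by (simp add: norm2_def L2_set_nonneg)

lemma inner_prod_scale: "inner_prod d (\<lambda>i. c * u i) v = c * inner_prod d u v"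
  by (simp add: inner_prod_def sum_distrib_left mult_ac)

lemma inner_prod_basis:
  "l < d \<Longrightarrow> inner_prod d (\<lambda>j. if j = l then c else 0) v = c * v l"
  by (simp add: inner_prod_def if_distrib[of "\<lambda>x. x * _"] cong: if_cong)

lemma inner_prod_basis_right:
  "l < d \<Longrightarrow> inner_prod d v (\<lambda>j. if j = l then c else 0) = v l * c"
  by (simp add: inner_prod_def if_distrib[of "\<lambda>x. _ * x"] cong: if_cong)

text \<open>The type \<open>rvec\<close> carries the product topology, so continuity has to come
  from convergence of finitely many coordinates.\<close>

lemma continuous_on_coordinatewise_Lipschitz:
  fixes e :: "rvec \<Rightarrow> real"
  assumes "\<And>b b'. \<bar>e b' - e b\<bar> \<le> (\<Sum>l<d. \<bar>b' l - b l\<bar> * C l)"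
  shows "continuous_on UNIV e"
  unfolding continuous_on_def
proof
  fix b :: rvec
  have coord: "((\<lambda>b'. b' l) \<longlongrightarrow> b l) (at b)" for l
  proof -
    have "continuous_on UNIV (\<lambda>b::rvec. b l)" by (rule continuous_on_product_coordinates)
    then show ?thesis by (simp add: continuous_on_def)
  qed
  have "((\<lambda>b'. \<Sum>l<d. \<bar>b' l - b l\<bar> * C l) \<longlongrightarrow> (\<Sum>l<d. \<bar>b l - b l\<bar> * C l)) (at b)"
    by (intro tendsto_intros coord)
  then have "((\<lambda>b'. \<Sum>l<d. \<bar>b' l - b l\<bar> * C l) \<longlongrightarrow> 0) (at b)"
    by simp
  then have "((\<lambda>b'. e b' - e b) \<longlongrightarrow> 0) (at b)"
    by (rule Lim_null_comparison[rotated]) (simp add: assms)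
  then show "(e \<longlongrightarrow> e b) (at b)" by (rule LIM_zero_cancel)
qed

lemma continuous_norm2:
  assumes "\<And>k. k < d \<Longrightarrow> continuous_on A (\<lambda>b. f b k)"
  shows "continuous_on A (\<lambda>b. norm2 d (f b))"
  unfolding norm2_def L2_set_def using assms by (intro continuous_intros) auto

lemma continuous_inner_prod: "continuous_on A (\<lambda>b. inner_prod d b x)"
  unfolding inner_prod_def
  by (intro continuous_intros continuous_on_subset[OF continuous_on_product_coordinates]) auto

context subgaussian_law
begin

definition total_var :: real where "total_var = (\<Sum>k<d. q k)"

lemma total_var_pos: "0 < d \<Longrightarrow> 0 < total_var"
  unfolding total_var_def using q_pos by (intro sum_pos) auto

text \<open>The weights \<open>p\<close> proportional to the variances equalise everything: after
  rescaling, \<open>(r l)\<^sup>2 * (q k * q l)\<close> has one value for all \<open>k\<close> and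
  \<open>l\<close>, in which the law appears only through \<open>total_var\<close>. Neither the size
  of \<open>T\<close> nor the dimension enters the bound.\<close>

lemma nn_integral_exp_Max_tanh_le:
  assumes T: "finite T" "T \<noteq> {}" "\<And>b. b \<in> T \<Longrightarrow> norm2 d b \<le> \<beta>"
    and k: "k < d" and s: "0 < s" and \<sigma>: "256 * (s * \<beta> * total_var)\<^sup>2 \<le> 1" and \<epsilon>: "\<bar>\<epsilon>\<bar> = 1"
  shows "(\<integral>\<^sup>+xs. ennreal (exp (Max ((\<lambda>b. s / sqrt (q k / total_var) * \<epsilon> * (\<Sum>i<n. centered tanh k b (xs i))) ` T))) \<partial>sample_measure n)
     \<le> ennreal (2 * exp (400 * (s * \<beta> * total_var)\<^sup>2) ^ n)"
proof -
  define p where "p = (\<lambda>l. q l / total_var)"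
  have d: "0 < d" using k by simp
  note m = total_var_pos[OF d]
  have p: "0 < p l" if "l < d" for l using q_pos[OF that] m by (simp add: p_def)
  have p1: "(\<Sum>l<d. p l) = 1"
    using m by (simp add: p_def total_var_def flip: sum_divide_distrib)
  define \<alpha> where "\<alpha> = s / sqrt (p k)"
  have \<alpha>: "0 < \<alpha>" using s p[OF k] by (simp add: \<alpha>_def)
  have \<beta>: "0 \<le> \<beta>" using T norm2_nonneg order_trans by (metis all_not_in_conv)
  \<comment> \<open>The scale \<open>\<alpha>\<close> is moved from the function into the vectors
    because contraction asks for a 1-Lipschitz function; the sign \<open>\<epsilon>\<close> is
    absorbed as well.\<close>
  define \<phi> where "\<phi> = (\<lambda>t. \<epsilon> * \<alpha> * tanh (t / \<alpha>))"
  define T' where "T' = (\<lambda>b l. \<alpha> * b l) ` T"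
  define r where "r = (\<lambda>l. \<alpha> * \<beta> / sqrt (p l))"
  have cent: "centered \<phi> k (\<lambda>l. \<alpha> * b l) x = \<alpha> * \<epsilon> * centered tanh k b x" for b x
    using \<alpha> by (simp add: centered_def \<phi>_def inner_prod_scale right_diff_distrib mult_ac
        flip: integral_mult_right_zero)
  have r2: "(r l)\<^sup>2 * (q k * q l) = (s * \<beta> * total_var)\<^sup>2" if "l < d" for l
    using p[OF k] p[OF that] m q_pos[OF k] q_pos[OF that]
    by (simp add: r_def \<alpha>_def power_mult_distrib power_divide) (simp add: p_def field_simps power2_eq_square)
  have "(\<integral>\<^sup>+xs. ennreal (exp (centered_Max \<phi> k T' n (\<lambda>_. 0) xs)) \<partial>sample_measure n)
    \<le> ennreal ((\<Sum>l<d. (2 * p l) * cosh (r l * 0)) * exp (400 * (s * \<beta> * total_var)\<^sup>2) ^ n)"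
  proof (rule nn_integral_exp_Max_sample_le)
    show "finite T'" "T' \<noteq> {}" using T by (auto simp: T'_def)
    show "\<phi> 0 = 0" by (simp add: \<phi>_def)
    show "\<phi> \<in> borel_measurable borel" unfolding \<phi>_def by measurable
    show "\<bar>\<phi> x - \<phi> y\<bar> \<le> \<bar>x - y\<bar>" for x y
    proof -
      have "\<bar>\<phi> x - \<phi> y\<bar> = \<alpha> * \<bar>tanh (x / \<alpha>) - tanh (y / \<alpha>)\<bar>"
        using \<alpha> \<epsilon> by (simp add: \<phi>_def abs_mult mult.assoc flip: right_diff_distrib)
      also have "\<dots> \<le> \<alpha> * \<bar>x / \<alpha> - y / \<alpha>\<bar>"
        using \<alpha> by (intro mult_left_mono tanh_Lipschitz) auto
      also have "\<dots> = \<bar>x - y\<bar>"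
        using \<alpha> by (simp add: abs_divide flip: diff_divide_distrib)
      finally show ?thesis .
    qed
    show "(\<integral>\<^sup>+x. ennreal (cosh (2 * r l * (x k * x l))) \<partial>P) \<le> ennreal (exp (400 * (s * \<beta> * total_var)\<^sup>2))"
      if "l \<in> {..<d}" for l
      using nn_integral_cosh_mult_le[OF k, of l "r l"] that r2[of l] \<sigma> by (simp add: mult.assoc)
    show "exp (Max ((\<lambda>b. inner_prod d b v) ` T')) \<le> (\<Sum>l<d. (2 * p l) * cosh (r l * v l))" for v
    proof -
      \<comment> \<open>All of \<open>T'\<close> lies in the ball of radius
        \<open>\<alpha> * \<beta>\<close>, so the maximum is controlled by a norm; this norm is then
        split into coordinates by the weighted \<open>cosh\<close> inequality.\<close>
      have "Max ((\<lambda>b. inner_prod d b v) ` T') \<le> \<bar>\<alpha> * \<beta> * norm2 d v\<bar>"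
      proof (rule Max.boundedI)
        show "finite ((\<lambda>b. inner_prod d b v) ` T')" "(\<lambda>b. inner_prod d b v) ` T' \<noteq> {}"
          using T by (auto simp: T'_def)
        fix y assume "y \<in> (\<lambda>b. inner_prod d b v) ` T'"
        then obtain b where "b \<in> T" and y: "y = \<alpha> * inner_prod d b v"
          by (auto simp: T'_def inner_prod_scale)
        then have "inner_prod d b v \<le> \<beta> * norm2 d v"
          using abs_inner_prod_le[of d b v] mult_right_mono[OF T(3)[OF \<open>b \<in> T\<close>], of "norm2 d v"] by auto
        then show "y \<le> \<bar>\<alpha> * \<beta> * norm2 d v\<bar>"
          using \<alpha> \<beta> by (simp add: y abs_mult mult.assoc)
      qed
      then have "exp (Max ((\<lambda>b. inner_prod d b v) ` T')) \<le> 2 * cosh (\<alpha> * \<beta> * norm2 d v)"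
        using exp_abs_le_cosh[of "\<alpha> * \<beta> * norm2 d v"] by (meson exp_le_cancel_iff order_trans)
      also have "\<dots> \<le> 2 * (\<Sum>l<d. p l * cosh (\<alpha> * \<beta> * v l / sqrt (p l)))"
        unfolding norm2_def using p p1 by (intro mult_left_mono cosh_L2_set_le) auto
      also have "\<dots> = (\<Sum>l<d. (2 * p l) * cosh (r l * v l))"
        by (simp add: sum_distrib_left r_def mult.assoc)
      finally show ?thesis .
    qed
  qed (use k p in \<open>auto simp: less_imp_le\<close>)
  also have "(\<Sum>l<d. (2 * p l) * cosh (r l * 0)) = 2"
    using p1 by (simp flip: sum_distrib_left)
  finally have fin: "(\<integral>\<^sup>+xs. ennreal (exp (centered_Max \<phi> k T' n (\<lambda>_. 0) xs)) \<partial>sample_measure n)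
    \<le> ennreal (2 * exp (400 * (s * \<beta> * total_var)\<^sup>2) ^ n)" .
  have z: "inner_prod d b (\<lambda>_. 0) = 0" for b by (simp add: inner_prod_def)
  from fin[unfolded centered_Max_def T'_def image_image cent z sum_distrib_left[symmetric] add_0_left] show ?thesis
    by (simp add: \<alpha>_def p_def)
qed

section \<open>Deviations of second moments and tail bounds\<close>

definition cov_dev :: "nat \<Rightarrow> nat \<Rightarrow> rvec \<Rightarrow> real" where
  "cov_dev k l x = x k * x l - expectation (\<lambda>x. x k * x l)"

lemma cov_dev_measurable [measurable]: "k < d \<Longrightarrow> l < d \<Longrightarrow> cov_dev k l \<in> borel_measurable P"
  unfolding cov_dev_def using coord_measurable[of k] coord_measurable[of l] by measurable

lemma sample_cov_dev_measurable [measurable]: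
  "i < n \<Longrightarrow> k < d \<Longrightarrow> l < d \<Longrightarrow> (\<lambda>xs. cov_dev k l (xs i)) \<in> borel_measurable (sample_measure n)"
  by (rule measurable_compose[where f = "\<lambda>xs. xs i", OF _ cov_dev_measurable]) (auto intro!: measurable_component_singleton)

text \<open>The induction over samples also serves here, with the identity as \<open>\<phi>\<close>
  and a one-element set containing a multiple of the \<open>l\<close>-th basis vector, so that the
  maximum is trivial.\<close>

lemma nn_integral_exp_cov_dev_le:
  assumes k: "k < d" and l: "l < d" and \<alpha>: "256 * \<alpha>\<^sup>2 * (q k * q l) \<le> 1"
  shows "(\<integral>\<^sup>+xs. ennreal (exp (\<alpha> * (\<Sum>i<n. cov_dev k l (xs i)))) \<partial>sample_measure n)
     \<le> ennreal (2 * exp (400 * \<alpha>\<^sup>2 * (q k * q l)) ^ n)"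
proof -
  define b where "b = (\<lambda>j. if j = l then \<alpha> else 0)"
  have ip: "inner_prod d b v = \<alpha> * v l" for v using l by (simp add: b_def inner_prod_basis)
  have "(\<integral>\<^sup>+xs. ennreal (exp (centered_Max (\<lambda>t. t) k {b} n (\<lambda>_. 0) xs)) \<partial>sample_measure n)
    \<le> ennreal ((\<Sum>l\<in>{l}. 2 * cosh (\<alpha> * 0)) * exp (400 * \<alpha>\<^sup>2 * (q k * q l)) ^ n)"
  proof (rule nn_integral_exp_Max_sample_le)
    show "(\<integral>\<^sup>+x. ennreal (cosh (2 * \<alpha> * (x k * x j))) \<partial>P) \<le> ennreal (exp (400 * \<alpha>\<^sup>2 * (q k * q l)))"
      if "j \<in> {l}" for j
      using nn_integral_cosh_mult_le[OF k l \<alpha>] that by simp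
    show "exp (Max ((\<lambda>b. inner_prod d b v) ` {b})) \<le> (\<Sum>l\<in>{l}. 2 * cosh (\<alpha> * v l))" for v
      using exp_le_cosh[of "\<alpha> * v l"] by (simp add: ip)
  qed (use k l in auto)
  moreover have "centered (\<lambda>t. t) k b x = \<alpha> * cov_dev k l x" for x
    by (simp add: centered_def cov_dev_def ip right_diff_distrib mult_ac flip: integral_mult_right_zero)
  ultimately show ?thesis
    by (simp add: centered_Max_def ip flip: sum_distrib_left)
qed

lemma Markov_cosh:
  assumes \<Psi> [measurable]: "\<Psi> \<in> borel_measurable (sample_measure n)"
    and A: "A \<in> sets (sample_measure n)" "\<And>xs. xs \<in> A \<Longrightarrow> cosh x \<le> \<Psi> xs"
    and bd: "(\<integral>\<^sup>+xs. ennreal (\<Psi> xs) \<partial>sample_measure n) \<le> ennreal (4 * c)" and c: "0 \<le> c"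
  shows "emeasure (sample_measure n) A \<le> ennreal (8 * c * exp (- x))"
proof -
  have "emeasure (sample_measure n) A \<le> emeasure (sample_measure n) {xs \<in> space (sample_measure n). 1 \<le> ennreal (1 / cosh x) * ennreal (\<Psi> xs)}"
  proof (rule emeasure_mono)
    show "A \<subseteq> {xs \<in> space (sample_measure n). 1 \<le> ennreal (1 / cosh x) * ennreal (\<Psi> xs)}"
    proof safe
      fix xs assume "xs \<in> A"
      then show "xs \<in> space (sample_measure n)" using A(1) sets.sets_into_space by blast
      have "1 \<le> (1 / cosh x) * \<Psi> xs" using A(2)[OF \<open>xs \<in> A\<close>] by (simp add: field_simps)
      then show "1 \<le> ennreal (1 / cosh x) * ennreal (\<Psi> xs)"
        by (subst ennreal_mult'[symmetric]) (auto simp del: ennreal_1 simp flip: ennreal_1 intro!: ennreal_leI)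
    qed
  qed measurable
  also have "\<dots> \<le> ennreal (1 / cosh x) * (\<integral>\<^sup>+xs. ennreal (\<Psi> xs) * indicator (space (sample_measure n)) xs \<partial>sample_measure n)"
    using nn_integral_Markov_inequality[of "\<lambda>xs. ennreal (\<Psi> xs)" "space (sample_measure n)" "sample_measure n" "ennreal (1 / cosh x)"]
    by (simp add: Int_def conj_commute)
  also have "(\<integral>\<^sup>+xs. ennreal (\<Psi> xs) * indicator (space (sample_measure n)) xs \<partial>sample_measure n) = (\<integral>\<^sup>+xs. ennreal (\<Psi> xs) \<partial>sample_measure n)"
    by (rule nn_integral_cong) auto
  also have "ennreal (1 / cosh x) * \<dots> \<le> ennreal (1 / cosh x) * ennreal (4 * c)"
    by (intro mult_left_mono bd) auto
  also have "\<dots> = ennreal (4 * c / cosh x)"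
    by (simp flip: ennreal_mult')
  also have "\<dots> \<le> ennreal (8 * c * exp (- x))"
  proof (rule ennreal_leI)
    have "exp x \<le> 2 * cosh x" by (rule exp_le_cosh)
    then have "1 / cosh x \<le> 2 * exp (- x)" by (simp add: exp_minus field_simps)
    then have "4 * c * (1 / cosh x) \<le> 4 * c * (2 * exp (- x))"
      using c by (intro mult_left_mono) auto
    then show "4 * c / cosh x \<le> 8 * c * exp (- x)" by simp
  qed
  finally show ?thesis .
qed

text \<open>The coordinates are weighted by \<open>p\<close> so that all of them have the same exponential moments.\<close>

lemma weighted_L2_tail:
  fixes S :: "'i \<Rightarrow> 'b \<Rightarrow> (nat \<Rightarrow> rvec) \<Rightarrow> real"
  assumes I: "finite I" and p: "\<And>i. i \<in> I \<Longrightarrow> 0 < p i" and p1: "(\<Sum>i\<in>I. p i) = 1"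
    and T: "finite T" "T \<noteq> {}" and s: "0 < s" and x: "0 \<le> x" and \<Gamma>: "0 \<le> \<Gamma>"
    and Sm [measurable]: "\<And>i b. i \<in> I \<Longrightarrow> S i b \<in> borel_measurable (sample_measure n)"
    and S: "\<And>i \<epsilon>. i \<in> I \<Longrightarrow> \<bar>\<epsilon>\<bar> = 1 \<Longrightarrow>
      (\<integral>\<^sup>+xs. ennreal (exp (Max ((\<lambda>b. s / sqrt (p i) * \<epsilon> * S i b xs) ` T))) \<partial>sample_measure n) \<le> ennreal (2 * \<Gamma>)"
  shows "emeasure (sample_measure n) {xs \<in> space (sample_measure n). \<exists>b\<in>T. x < L2_set (\<lambda>i. S i b xs) I}
     \<le> ennreal (8 * \<Gamma> * exp (- (s * x)))"
proof -
  define M where "M = (\<lambda>\<epsilon> i xs. Max ((\<lambda>b. s / sqrt (p i) * \<epsilon> * S i b xs) ` T))"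
  have Mm [measurable]: "M \<epsilon> i \<in> borel_measurable (sample_measure n)" if "i \<in> I" for \<epsilon> i
    unfolding M_def using that T(1) by (intro borel_measurable_Max) auto
  \<comment> \<open>Because \<open>M\<close> already maximises over \<open>b\<close> inside the
    exponential, this single function dominates the \<open>cosh\<close> of the scaled norm for all
    \<open>b\<close> in \<open>T\<close> at once, while its mean is bounded index by index.\<close>
  define \<Psi> where "\<Psi> = (\<lambda>xs. \<Sum>i\<in>I. p i * (exp (M 1 i xs) + exp (M (-1) i xs)))"
  have \<Psi>m: "\<Psi> \<in> borel_measurable (sample_measure n)" unfolding \<Psi>_def
    by (intro borel_measurable_sum borel_measurable_times borel_measurable_add borel_measurable_const
        measurable_compose[OF Mm borel_measurable_exp]) auto
  have "(\<integral>\<^sup>+xs. ennreal (\<Psi> xs) \<partial>sample_measure n)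
     = (\<integral>\<^sup>+xs. (\<Sum>i\<in>I. ennreal (p i) * (ennreal (exp (M 1 i xs)) + ennreal (exp (M (-1) i xs)))) \<partial>sample_measure n)"
    unfolding \<Psi>_def using p
    by (intro nn_integral_cong, subst sum_ennreal[symmetric])
      (auto simp: ennreal_mult' less_imp_le intro!: sum.cong)
  also have "\<dots> = (\<Sum>i\<in>I. ennreal (p i) * ((\<integral>\<^sup>+xs. ennreal (exp (M 1 i xs)) \<partial>sample_measure n)
      + (\<integral>\<^sup>+xs. ennreal (exp (M (-1) i xs)) \<partial>sample_measure n)))"
    using Mm by (subst nn_integral_sum) (auto simp: nn_integral_cmult nn_integral_add intro!: sum.cong)
  also have "\<dots> \<le> (\<Sum>i\<in>I. ennreal (p i) * (ennreal (2 * \<Gamma>) + ennreal (2 * \<Gamma>)))"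
    unfolding M_def by (intro sum_mono mult_left_mono add_mono S) auto
  also have "\<dots> = (\<Sum>i\<in>I. ennreal (p i)) * ennreal (4 * \<Gamma>)"
    using \<Gamma> by (simp add: sum_distrib_right flip: ennreal_plus)
  also have "(\<Sum>i\<in>I. ennreal (p i)) = 1"
    using p p1 by (subst sum_ennreal) (auto simp: less_imp_le)
  finally have bd: "(\<integral>\<^sup>+xs. ennreal (\<Psi> xs) \<partial>sample_measure n) \<le> ennreal (4 * \<Gamma>)" by simp
  have L2m: "(\<lambda>xs. L2_set (\<lambda>i. S i b xs) I) \<in> borel_measurable (sample_measure n)" for b
    unfolding L2_set_def
    by (intro borel_measurable_sqrt[THEN measurable_compose[rotated]] borel_measurable_sum borel_measurable_power Sm)
  show ?thesis
  proof (rule Markov_cosh[OF \<Psi>m _ _ bd \<Gamma>])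
    show "{xs \<in> space (sample_measure n). \<exists>b\<in>T. x < L2_set (\<lambda>i. S i b xs) I} \<in> sets (sample_measure n)"
      using T(1) by (intro sets.sets_Collect_finite_Ex borel_measurable_less borel_measurable_const L2m)
    fix xs assume "xs \<in> {xs \<in> space (sample_measure n). \<exists>b\<in>T. x < L2_set (\<lambda>i. S i b xs) I}"
    then obtain b where b: "b \<in> T" "x \<le> L2_set (\<lambda>i. S i b xs) I" by auto
    have "cosh (s * x) \<le> cosh (s * L2_set (\<lambda>i. S i b xs) I)"
      using s x b by (subst cosh_real_nonneg_le_iff) auto
    also have "\<dots> \<le> (\<Sum>i\<in>I. p i * cosh (s * S i b xs / sqrt (p i)))"
      using I p p1 by (intro cosh_L2_set_le) auto
    also have "\<dots> \<le> \<Psi> xs"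
      unfolding \<Psi>_def
    proof (intro sum_mono mult_left_mono)
      fix i assume "i \<in> I"
      have M: "s / sqrt (p i) * \<epsilon> * S i b xs \<le> M \<epsilon> i xs" for \<epsilon>
        unfolding M_def using b T by (intro Max_ge) auto
      define y where "y = s * S i b xs / sqrt (p i)"
      have "exp y \<le> exp (M 1 i xs)" "exp (- y) \<le> exp (M (- 1) i xs)"
        using M[of 1] M[of "-1"] by (simp_all add: y_def)
      moreover have "cosh y \<le> exp y + exp (- y)" by (simp add: cosh_def)
      ultimately show "cosh (s * S i b xs / sqrt (p i)) \<le> exp (M 1 i xs) + exp (M (- 1) i xs)"
        unfolding y_def by linarith
      show "0 \<le> p i" using p \<open>i \<in> I\<close> by (simp add: less_imp_le)
    qed
    finally show "cosh (s * x) \<le> \<Psi> xs" .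
  qed
qed

text \<open>With \<open>u = \<tau> / 800\<close>, the exponent
  \<open>400 * u\<^sup>2 - u * \<tau>\<close> attains its minimum
  \<open>- (\<tau>\<^sup>2 / 1600)\<close>. The condition \<open>\<tau> \<le> 50\<close> keeps
  \<open>u\<close> below \<open>1 / 16\<close>, where the exponential moment bounds are
  valid.\<close>

lemma tail_exponent:
  "0 \<le> \<tau> \<Longrightarrow> \<tau> \<le> 50 \<Longrightarrow> 256 * (\<tau> / 800)\<^sup>2 \<le> (1::real)"
  "8 * exp (400 * (\<tau> / 800)\<^sup>2) ^ n * exp (- (\<tau> / 800 * (n * \<tau>))) = 8 * exp (- (n * \<tau>\<^sup>2 / 1600))"
proof -
  assume "0 \<le> \<tau>" "\<tau> \<le> 50"
  then have "(\<tau> / 800)\<^sup>2 \<le> (1 / 16)\<^sup>2" by (intro power_mono) auto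
  then show "256 * (\<tau> / 800)\<^sup>2 \<le> 1" by (simp add: power2_eq_square)
next
  show "8 * exp (400 * (\<tau> / 800)\<^sup>2) ^ n * exp (- (\<tau> / 800 * (n * \<tau>))) = 8 * exp (- (n * \<tau>\<^sup>2 / 1600))"
    by (simp add: exp_of_nat_mult[symmetric] exp_add[symmetric] power_divide power2_eq_square)
qed

lemma tanh_dev_finite:
  assumes d: "0 < d" and T: "finite T" "T \<noteq> {}" "\<And>b. b \<in> T \<Longrightarrow> norm2 d b \<le> \<beta>"
    and \<beta>: "0 < \<beta>" and \<tau>: "0 < \<tau>" "\<tau> \<le> 50"
  shows "emeasure (sample_measure n) {xs \<in> space (sample_measure n).
      \<exists>b\<in>T. n * (\<beta> * total_var * \<tau>) < norm2 d (\<lambda>k. \<Sum>i<n. centered tanh k b (xs i))}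
     \<le> ennreal (8 * exp (- (n * \<tau>\<^sup>2 / 1600)))"
proof -
  note m = total_var_pos[OF d]
  define s where "s = \<tau> / (800 * \<beta> * total_var)"
  have s: "0 < s" "s * \<beta> * total_var = \<tau> / 800" using \<tau> \<beta> m by (auto simp: s_def)
  have sx: "s * (n * (\<beta> * total_var * \<tau>)) = \<tau> / 800 * (n * \<tau>)"
    unfolding s(2)[symmetric] by (simp add: mult_ac)
  have "emeasure (sample_measure n) {xs \<in> space (sample_measure n).
      \<exists>b\<in>T. n * (\<beta> * total_var * \<tau>) < L2_set (\<lambda>k. \<Sum>i<n. centered tanh k b (xs i)) {..<d}}
     \<le> ennreal (8 * exp (400 * (\<tau> / 800)\<^sup>2) ^ n * exp (- (s * (n * (\<beta> * total_var * \<tau>)))))"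
  proof (rule weighted_L2_tail[where p = "\<lambda>k. q k / total_var"])
    show "(\<Sum>k<d. q k / total_var) = 1"
      using m by (simp add: total_var_def flip: sum_divide_distrib)
    show "(\<integral>\<^sup>+xs. ennreal (exp (Max ((\<lambda>b. s / sqrt (q k / total_var) * \<epsilon> * (\<Sum>i<n. centered tanh k b (xs i))) ` T))) \<partial>sample_measure n)
      \<le> ennreal (2 * exp (400 * (\<tau> / 800)\<^sup>2) ^ n)" if "k \<in> {..<d}" "\<bar>\<epsilon>\<bar> = 1" for k \<epsilon>
      using nn_integral_exp_Max_tanh_le[OF T _ s(1) _ that(2), of k n] that(1) tail_exponent(1)[of \<tau>] \<tau> unfolding s(2) by simp
  qed (use T s \<beta> \<tau> m q_pos in auto)
  then show ?thesis unfolding norm2_def sx tail_exponent .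
qed

lemma cov_dev_tail:
  assumes d: "0 < d" and \<tau>: "0 < \<tau>" "\<tau> \<le> 50"
  shows "emeasure (sample_measure n) {xs \<in> space (sample_measure n).
      n * (total_var * \<tau>) < L2_set (\<lambda>(k, l). \<Sum>i<n. cov_dev k l (xs i)) ({..<d} \<times> {..<d})}
     \<le> ennreal (8 * exp (- (n * \<tau>\<^sup>2 / 1600)))"
proof -
  note m = total_var_pos[OF d]
  let ?I = "{..<d} \<times> {..<d}"
  \<comment> \<open>Products of the one-coordinate weights: they match the scale
    \<open>q k * q l\<close> of a pair and still sum to 1.\<close>
  define p where "p = (\<lambda>(k, l). (q k / total_var) * (q l / total_var))"
  have p: "0 < p kl" if "kl \<in> ?I" for kl using that q_pos m by (auto simp: p_def)
  define s where "s = \<tau> / (800 * total_var)"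
  have s: "0 < s" "s * total_var = \<tau> / 800" using \<tau> m by (auto simp: s_def)
  have sx: "s * (n * (total_var * \<tau>)) = \<tau> / 800 * (n * \<tau>)"
    unfolding s(2)[symmetric] by (simp add: mult_ac)
  \<comment> \<open>The dummy argument of type \<open>unit\<close> supplies the parameter index of
    the general tail bound; the maximum is over one element.\<close>
  define W where "W = (\<lambda>kl (_::unit) xs. \<Sum>i<n. cov_dev (fst kl) (snd kl) (xs i))"
  have "emeasure (sample_measure n) {xs \<in> space (sample_measure n).
      \<exists>b\<in>{()}. n * (total_var * \<tau>) < L2_set (\<lambda>kl. W kl b xs) ?I}
     \<le> ennreal (8 * exp (400 * (\<tau> / 800)\<^sup>2) ^ n * exp (- (s * (n * (total_var * \<tau>)))))"
  proof (rule weighted_L2_tail[where p = p])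
    have "(\<Sum>kl\<in>?I. p kl) = (\<Sum>k<d. q k / total_var) * (\<Sum>l<d. q l / total_var)"
      by (simp add: p_def sum_product sum.cartesian_product)
    then show "(\<Sum>kl\<in>?I. p kl) = 1"
      using m by (simp add: total_var_def flip: sum_divide_distrib)
    show "W kl b \<in> borel_measurable (sample_measure n)" if "kl \<in> ?I" for kl b
      unfolding W_def using that by (auto intro!: borel_measurable_sum sample_cov_dev_measurable)
    show "(\<integral>\<^sup>+xs. ennreal (exp (Max ((\<lambda>b. s / sqrt (p kl) * \<epsilon> * W kl b xs) ` {()}))) \<partial>sample_measure n)
      \<le> ennreal (2 * exp (400 * (\<tau> / 800)\<^sup>2) ^ n)" if kl: "kl \<in> ?I" and \<epsilon>: "\<bar>\<epsilon>\<bar> = 1" for kl \<epsilon>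
    proof -
      obtain k l where kl': "kl = (k, l)" "k < d" "l < d" using kl by auto
      define a where "a = s / sqrt (p kl) * \<epsilon>"
      have "\<epsilon>\<^sup>2 = 1" using \<epsilon> by (metis power2_abs power_one)
      then have "a\<^sup>2 = s\<^sup>2 / p kl" using p[OF kl] by (simp add: a_def power_divide power_mult_distrib)
      then have "a\<^sup>2 * (q k * q l) = (s * total_var)\<^sup>2"
        using q_pos[OF kl'(2)] q_pos[OF kl'(3)] m by (simp add: p_def kl' power2_eq_square field_simps)
      then have eq: "a\<^sup>2 * (q k * q l) = (\<tau> / 800)\<^sup>2" by (simp add: s)
      then have "256 * a\<^sup>2 * (q k * q l) \<le> 1" using tail_exponent(1)[of \<tau>] \<tau> by (simp add: mult.assoc)
      from nn_integral_exp_cov_dev_le[OF kl'(2,3) this, of n] show ?thesis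
        unfolding a_def[symmetric] using eq by (simp add: W_def kl' mult.assoc)
    qed
  qed (use p s \<tau> m in auto)
  then show ?thesis unfolding sx tail_exponent by (simp add: W_def case_prod_beta')
qed

section \<open>From finitely many vectors to a whole ball\<close>

lemma tanh_dev_sets:
  "{xs \<in> space (sample_measure n). c < norm2 d (\<lambda>k. \<Sum>i<n. centered tanh k b (xs i))} \<in> sets (sample_measure n)"
proof -
  have "(\<lambda>xs. norm2 d (\<lambda>k. \<Sum>i<n. centered tanh k b (xs i))) \<in> borel_measurable (sample_measure n)"
    unfolding norm2_def L2_set_def
    by (intro borel_measurable_sqrt[THEN measurable_compose[rotated]] borel_measurable_sum borel_measurable_power
        sample_centered_measurable) auto
  then show ?thesis by measurable
qed

text \<open>The finite bound does not depend on the number of vectors, so it passes to the union of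
  an increasing sequence of events by continuity from below.\<close>

lemma tanh_dev_countable:
  assumes d: "0 < d" and T: "countable T" "\<And>b. b \<in> T \<Longrightarrow> norm2 d b \<le> \<beta>"
    and \<beta>: "0 < \<beta>" and \<tau>: "0 < \<tau>" "\<tau> \<le> 50"
  shows "emeasure (sample_measure n) (\<Union>b\<in>T. {xs \<in> space (sample_measure n).
      n * (\<beta> * total_var * \<tau>) < norm2 d (\<lambda>k. \<Sum>i<n. centered tanh k b (xs i))})
     \<le> ennreal (8 * exp (- (n * \<tau>\<^sup>2 / 1600)))"
proof (cases "T = {}")
  case False
  define B where "B = (\<lambda>b. {xs \<in> space (sample_measure n).
      n * (\<beta> * total_var * \<tau>) < norm2 d (\<lambda>k. \<Sum>i<n. centered tanh k b (xs i))})"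
  define A where "A = (\<lambda>N. \<Union>j\<in>{..N}. B (from_nat_into T j))"
  have B: "B b \<in> sets (sample_measure n)" for b unfolding B_def by (rule tanh_dev_sets)
  have "emeasure (sample_measure n) (\<Union>N. A N) = (SUP N. emeasure (sample_measure n) (A N))"
    using B by (intro SUP_emeasure_incseq[symmetric]) (auto simp: A_def incseq_def, meson atMost_iff order_trans)
  also have "\<dots> \<le> ennreal (8 * exp (- (n * \<tau>\<^sup>2 / 1600)))"
  proof (rule SUP_least)
    fix N
    have "emeasure (sample_measure n) {xs \<in> space (sample_measure n).
      \<exists>b\<in>from_nat_into T ` {..N}. n * (\<beta> * total_var * \<tau>) < norm2 d (\<lambda>k. \<Sum>i<n. centered tanh k b (xs i))}
     \<le> ennreal (8 * exp (- (n * \<tau>\<^sup>2 / 1600)))"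
      using False T(2) from_nat_into[OF False] by (intro tanh_dev_finite d \<beta> \<tau>) auto
    also have "{xs \<in> space (sample_measure n).
      \<exists>b\<in>from_nat_into T ` {..N}. n * (\<beta> * total_var * \<tau>) < norm2 d (\<lambda>k. \<Sum>i<n. centered tanh k b (xs i))} = A N"
      by (auto simp: A_def B_def)
    finally show "emeasure (sample_measure n) (A N) \<le> ennreal (8 * exp (- (n * \<tau>\<^sup>2 / 1600)))" .
  qed
  also have "(\<Union>N. A N) = (\<Union>b\<in>T. B b)"
  proof -
    have "(\<Union>N. A N) = (\<Union>j. B (from_nat_into T j))" by (auto simp: A_def)
    also have "\<dots> = (\<Union>b\<in>range (from_nat_into T). B b)" by auto
    also have "range (from_nat_into T) = T" using False T(1) by (rule range_from_nat_into)
    finally show ?thesis .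
  qed
  finally show ?thesis by (simp add: B_def)
qed simp

lemma integrable_coord_mult: "k < d \<Longrightarrow> l < d \<Longrightarrow> integrable P (\<lambda>x. x k * x l)"
  using integrable_coord_mult_Lipschitz[of k "\<lambda>t. t" "\<lambda>j. if j = l then 1 else 0"]
  by (simp add: inner_prod_basis)

lemma continuous_centered_tanh:
  assumes k: "k < d"
  shows "continuous_on UNIV (\<lambda>b. centered tanh k b x)"
proof -
  define e where "e = (\<lambda>b. expectation (\<lambda>x. x k * tanh (inner_prod d b x)))"
  have int: "integrable P (\<lambda>x. x k * tanh (inner_prod d b x))" for b
    by (intro integrable_coord_mult_Lipschitz k tanh_Lipschitz) auto
  have intkl: "integrable P (\<lambda>x. \<bar>x k * x l\<bar>)" if "l < d" for l
    using integrable_coord_mult[OF k that] by (rule integrable_abs)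
  have e_le: "\<bar>e b' - e b\<bar> \<le> (\<Sum>l<d. \<bar>b' l - b l\<bar> * expectation (\<lambda>x. \<bar>x k * x l\<bar>))" for b b'
  proof -
    have "\<bar>e b' - e b\<bar> = \<bar>expectation (\<lambda>x. x k * tanh (inner_prod d b' x) - x k * tanh (inner_prod d b x))\<bar>"
      unfolding e_def using int by simp
    also have "\<dots> \<le> expectation (\<lambda>x. \<bar>x k * tanh (inner_prod d b' x) - x k * tanh (inner_prod d b x)\<bar>)"
      by (rule integral_abs_bound)
    also have "\<dots> \<le> expectation (\<lambda>x. \<Sum>l<d. \<bar>b' l - b l\<bar> * \<bar>x k * x l\<bar>)"
    proof (rule integral_mono)
      fix x
      have "\<bar>x k * tanh (inner_prod d b' x) - x k * tanh (inner_prod d b x)\<bar>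
          \<le> \<bar>x k\<bar> * \<bar>inner_prod d b' x - inner_prod d b x\<bar>"
        unfolding right_diff_distrib[symmetric] abs_mult by (intro mult_left_mono tanh_Lipschitz) auto
      also have "inner_prod d b' x - inner_prod d b x = (\<Sum>l<d. (b' l - b l) * x l)"
        by (simp add: inner_prod_def sum_subtractf left_diff_distrib)
      also have "\<bar>x k\<bar> * \<bar>\<Sum>l<d. (b' l - b l) * x l\<bar> \<le> \<bar>x k\<bar> * (\<Sum>l<d. \<bar>(b' l - b l) * x l\<bar>)"
        by (intro mult_left_mono sum_abs) auto
      also have "\<dots> = (\<Sum>l<d. \<bar>b' l - b l\<bar> * \<bar>x k * x l\<bar>)"
        by (simp add: sum_distrib_left abs_mult mult_ac)
      finally show "\<bar>x k * tanh (inner_prod d b' x) - x k * tanh (inner_prod d b x)\<bar> \<le> (\<Sum>l<d. \<bar>b' l - b l\<bar> * \<bar>x k * x l\<bar>)" .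
    qed (use int intkl in auto)
    also have "\<dots> = (\<Sum>l<d. \<bar>b' l - b l\<bar> * expectation (\<lambda>x. \<bar>x k * x l\<bar>))"
      using intkl by simp
    finally show ?thesis .
  qed
  have "continuous_on UNIV e"
    using e_le by (rule continuous_on_coordinatewise_Lipschitz)
  then show ?thesis
    unfolding centered_def e_def by (intro continuous_intros continuous_inner_prod) auto
qed

text \<open>For a fixed sample the deviation is continuous in \<open>b\<close>, so the vectors
  violating the bound inside the open ball form an open set; avoiding a countable dense set, it is
  empty. The strict inequality \<open>norm2 d b < \<beta>\<close> is what makes it open, and the
  exceptional event is a countable union, hence measurable.\<close>

lemma tanh_dev_uniform:
  assumes d: "0 < d" and \<beta>: "0 < \<beta>" and \<tau>: "0 < \<tau>" "\<tau> \<le> 50"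
  obtains A where "A \<in> sets (sample_measure n)"
    "emeasure (sample_measure n) A \<le> ennreal (8 * exp (- (n * \<tau>\<^sup>2 / 1600)))"
    "\<And>xs b. xs \<in> space (sample_measure n) - A \<Longrightarrow> norm2 d b < \<beta> \<Longrightarrow>
      norm2 d (\<lambda>k. \<Sum>i<n. centered tanh k b (xs i)) \<le> n * (\<beta> * total_var * \<tau>)"
proof -
  obtain D :: "rvec set" where D: "countable D" "\<And>X. open X \<Longrightarrow> X \<noteq> {} \<Longrightarrow> \<exists>d\<in>D. d \<in> X"
    by (rule countable_dense_setE) blast
  have cn: "continuous_on UNIV (\<lambda>b. norm2 d b)"
    by (intro continuous_norm2 continuous_on_product_coordinates)
  define T where "T = {b\<in>D. norm2 d b < \<beta>}"
  define A where "A = (\<Union>b\<in>T. {xs \<in> space (sample_measure n).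
      n * (\<beta> * total_var * \<tau>) < norm2 d (\<lambda>k. \<Sum>i<n. centered tanh k b (xs i))})"
  have T: "countable T" using D by (simp add: T_def)
  show ?thesis
  proof (rule that)
    show "A \<in> sets (sample_measure n)"
      unfolding A_def using T tanh_dev_sets by (intro sets.countable_UN') auto
    show "emeasure (sample_measure n) A \<le> ennreal (8 * exp (- (n * \<tau>\<^sup>2 / 1600)))"
      unfolding A_def using T by (intro tanh_dev_countable d \<beta> \<tau>) (auto simp: T_def)
    fix xs b assume xs: "xs \<in> space (sample_measure n) - A" and b: "norm2 d b < \<beta>"
    have cont: "continuous_on UNIV (\<lambda>b. norm2 d (\<lambda>k. \<Sum>i<n. centered tanh k b (xs i)))"
      by (intro continuous_norm2 continuous_intros continuous_centered_tanh)
    define X where "X = {b. norm2 d b < \<beta>} \<inter> {b. n * (\<beta> * total_var * \<tau>) < norm2 d (\<lambda>k. \<Sum>i<n. centered tanh k b (xs i))}"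
    have "open X" unfolding X_def
      by (intro open_Int open_Collect_less cont cn continuous_on_const)
    moreover have "D \<inter> X = {}"
      using xs by (auto simp: X_def A_def T_def)
    ultimately have "X = {}" using D(2)[of X] by auto
    then show "norm2 d (\<lambda>k. \<Sum>i<n. centered tanh k b (xs i)) \<le> n * (\<beta> * total_var * \<tau>)"
      using b by (auto simp: X_def not_less)
  qed
qed

end

subsection \<open>The concave inner maximisation\<close>

text \<open>Allows averages to be differentiated along lines from an integrated Taylor bound, in
  place of differentiation under the integral sign.\<close>

lemma DERIV_if_quadratic_remainder:
  fixes f :: "real \<Rightarrow> real"
  assumes "\<And>s. \<bar>f (t + s) - f t - s * D\<bar> \<le> C * s\<^sup>2"
  shows "(f has_real_derivative D) (at t)"
proof -
  have "((\<lambda>h. (f (t + h) - f t) / h - D) \<longlongrightarrow> 0) (at 0)"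
  proof (rule Lim_null_comparison)
    show "\<forall>\<^sub>F h in at 0. norm ((f (t + h) - f t) / h - D) \<le> C * \<bar>h\<bar>"
      unfolding eventually_at_filter
    proof (intro always_eventually allI impI)
      fix h :: real assume "h \<noteq> 0"
      then have "(f (t + h) - f t) / h - D = (f (t + h) - f t - h * D) / h"
        by (simp add: diff_divide_distrib)
      then have "\<bar>(f (t + h) - f t) / h - D\<bar> = \<bar>f (t + h) - f t - h * D\<bar> / \<bar>h\<bar>"
        by (simp only: abs_divide)
      also have "\<dots> \<le> C * h\<^sup>2 / \<bar>h\<bar>"
        using assms by (intro divide_right_mono) auto
      also have "\<dots> = C * \<bar>h\<bar>"
        using \<open>h \<noteq> 0\<close> by (subst power2_abs[symmetric]) (simp add: power2_eq_square del: abs_mult_self_eq)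
      finally show "norm ((f (t + h) - f t) / h - D) \<le> C * \<bar>h\<bar>" by simp
    qed
    show "((\<lambda>h. C * \<bar>h\<bar>) \<longlongrightarrow> 0) (at 0)"
      by (auto intro!: tendsto_eq_intros)
  qed
  then show ?thesis
    unfolding DERIV_def by (rule LIM_zero_cancel)
qed

text \<open>The Cauchy-Schwarz inequality for given bounds on the second moments, from the
  arithmetic-geometric mean inequality with weights \<open>b / a\<close> and
  \<open>a / b\<close>.\<close>

lemma expectation_abs_mult_le:
  fixes Y Z :: "'a \<Rightarrow> real"
  assumes [measurable]: "Y \<in> borel_measurable M" "Z \<in> borel_measurable M"
    and Y: "integrable M (\<lambda>x. (Y x)\<^sup>2)" "(\<integral>x. (Y x)\<^sup>2 \<partial>M) \<le> a\<^sup>2" and a: "0 < a"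
    and Z: "integrable M (\<lambda>x. (Z x)\<^sup>2)" "(\<integral>x. (Z x)\<^sup>2 \<partial>M) \<le> b\<^sup>2" and b: "0 < b"
  shows "integrable M (\<lambda>x. Y x * Z x)" "(\<integral>x. \<bar>Y x * Z x\<bar> \<partial>M) \<le> a * b"
proof -
  have pw: "\<bar>Y x * Z x\<bar> \<le> ((b / a) * (Y x)\<^sup>2 + (a / b) * (Z x)\<^sup>2) / 2" for x
  proof -
    have "0 \<le> (b * \<bar>Y x\<bar> - a * \<bar>Z x\<bar>)\<^sup>2" by simp
    also have "\<dots> = b\<^sup>2 * (Y x)\<^sup>2 + a\<^sup>2 * (Z x)\<^sup>2 - 2 * (a * b) * \<bar>Y x * Z x\<bar>"
      by (simp add: power2_diff power_mult_distrib abs_mult mult_ac)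
    finally have "2 * (a * b) * \<bar>Y x * Z x\<bar> \<le> b\<^sup>2 * (Y x)\<^sup>2 + a\<^sup>2 * (Z x)\<^sup>2" by simp
    then show ?thesis using a b by (simp add: field_simps power2_eq_square)
  qed
  have int: "integrable M (\<lambda>x. ((b / a) * (Y x)\<^sup>2 + (a / b) * (Z x)\<^sup>2) / 2)"
    using Y(1) Z(1) by auto
  show "integrable M (\<lambda>x. Y x * Z x)"
    by (rule Bochner_Integration.integrable_bound[OF int])
      (measurable, intro AE_I2, unfold real_norm_def, rule order_trans[OF pw abs_ge_self])
  then have "(\<integral>x. \<bar>Y x * Z x\<bar> \<partial>M) \<le> (\<integral>x. ((b / a) * (Y x)\<^sup>2 + (a / b) * (Z x)\<^sup>2) / 2 \<partial>M)"
    by (intro integral_mono int pw integrable_abs)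
  also have "\<dots> = ((b / a) * (\<integral>x. (Y x)\<^sup>2 \<partial>M) + (a / b) * (\<integral>x. (Z x)\<^sup>2 \<partial>M)) / 2"
    using Y(1) Z(1) by simp
  also have "\<dots> \<le> ((b / a) * a\<^sup>2 + (a / b) * b\<^sup>2) / 2"
    using a b by (intro divide_right_mono add_mono mult_left_mono Y Z) auto
  also have "\<dots> = a * b" using a b by (simp add: power2_eq_square)
  finally show "(\<integral>x. \<bar>Y x * Z x\<bar> \<partial>M) \<le> a * b" .
qed

lemma inner_prod_add: "inner_prod d (\<lambda>i. u i + v i) x = inner_prod d u x + inner_prod d v x"
  by (simp add: inner_prod_def algebra_simps sum.distrib)

lemma inner_prod_diff: "inner_prod d (\<lambda>i. u i - v i) x = inner_prod d u x - inner_prod d v x"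
  by (simp add: inner_prod_def algebra_simps sum_subtractf)

lemma norm2_sq: "(norm2 d v)\<^sup>2 = (\<Sum>i<d. (v i)\<^sup>2)"
  by (simp add: norm2_def L2_set_def sum_nonneg)

lemma norm2_scale: "norm2 d (\<lambda>i. c * v i) = \<bar>c\<bar> * norm2 d v"
  unfolding norm2_def L2_set_def
  by (simp add: power_mult_distrib real_sqrt_mult flip: sum_distrib_left)

lemma norm2_triangle: "norm2 d (\<lambda>i. u i + v i) \<le> norm2 d u + norm2 d v"
  unfolding norm2_def by (rule L2_set_triangle_ineq)

lemma norm2_triangle_diff: "norm2 d (\<lambda>i. u i - v i) \<le> norm2 d u + norm2 d v"
  using norm2_triangle[of d u "\<lambda>i. - 1 * v i"] norm2_scale[of d "-1" v] by simp

lemma norm2_minus_commute: "norm2 d (\<lambda>i. u i - v i) = norm2 d (\<lambda>i. v i - u i)"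
  using norm2_scale[of d "-1" "\<lambda>i. u i - v i"] by simp

lemma norm2_midpoint:
  "(norm2 d (\<lambda>i. (u i + v i) / 2 - w i))\<^sup>2
     = ((norm2 d (\<lambda>i. u i - w i))\<^sup>2 + (norm2 d (\<lambda>i. v i - w i))\<^sup>2) / 2 - (norm2 d (\<lambda>i. u i - v i))\<^sup>2 / 4"
proof -
  have "((x + y) / 2 - z)\<^sup>2 = ((x - z)\<^sup>2 + (y - z)\<^sup>2) / 2 - (x - y)\<^sup>2 / 4" for x y z :: real
    by (simp add: power2_eq_square field_simps)
  then show ?thesis
    by (simp add: norm2_sq sum.distrib sum_subtractf flip: sum_divide_distrib)
qed

lemma abs_coord_le_norm2: "i < d \<Longrightarrow> \<bar>v i\<bar> \<le> norm2 d v"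
  using abs_inner_prod_le[of d v "\<lambda>j. if j = i then 1 else 0"]
  by (simp add: inner_prod_basis_right) (simp add: norm2_def L2_set_def if_distrib[of "\<lambda>x. x ^ 2"] cong: if_cong)

lemma norm2_le_if_inner_prod_le:
  assumes "\<And>u. norm2 d u \<le> 1 \<Longrightarrow> inner_prod d u v \<le> B" and "0 \<le> B"
  shows "norm2 d v \<le> B"
proof (cases "norm2 d v = 0")
  case False
  define u where "u = (\<lambda>i. (1 / norm2 d v) * v i)"
  have "norm2 d u = \<bar>1 / norm2 d v\<bar> * norm2 d v"
    unfolding u_def by (rule norm2_scale)
  then have "norm2 d u = 1" using False by simp
  moreover have "inner_prod d u v = norm2 d v"
  proof -
    have "inner_prod d v v = (norm2 d v)\<^sup>2" unfolding norm2_sq inner_prod_def by (simp add: power2_eq_square)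
    then show ?thesis using False unfolding u_def inner_prod_scale by (simp add: power2_eq_square)
  qed
  ultimately show ?thesis using assms(1)[of u] by simp
qed (use assms in simp)

section \<open>Second moments and averaged log-cosh\<close>

definition bilin :: "nat \<Rightarrow> rmat \<Rightarrow> rvec \<Rightarrow> rvec \<Rightarrow> real" where
  "bilin d A x y = (\<Sum>i<d. \<Sum>j<d. A i j * (x i * y j))"

text \<open>The common ground of the population law, the empirical law and the generator law, so
  that all facts about maximisers apply to each of them.\<close>

locale l2_law = coord_law +
  assumes coord_sq: "k < d \<Longrightarrow> integrable P (\<lambda>x. (x k)\<^sup>2)"

sublocale subgaussian_law \<subseteq> l2_law
  by standard (rule integrable_coord_square)

definition avg_logcosh :: "nat \<Rightarrow> rvec measure \<Rightarrow> rvec \<Rightarrow> real" where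
  "avg_logcosh d P b = (\<integral>x. logcosh (inner_prod d b x) \<partial>P)"

definition avg_tanh :: "nat \<Rightarrow> rvec measure \<Rightarrow> rvec \<Rightarrow> rvec" where
  "avg_tanh d P b k = (\<integral>x. x k * tanh (inner_prod d b x) \<partial>P)"

definition moment :: "rvec measure \<Rightarrow> rmat" where
  "moment P i j = (\<integral>x. x i * x j \<partial>P)"

text \<open>In matrix terms: the second-moment matrix is at most \<open>a\<^sup>2\<close> times the
  identity.\<close>

definition moment_bound :: "nat \<Rightarrow> rvec measure \<Rightarrow> real \<Rightarrow> bool" where
  "moment_bound d P a \<longleftrightarrow> (\<forall>u. (\<integral>x. (inner_prod d u x)\<^sup>2 \<partial>P) \<le> a\<^sup>2 * (norm2 d u)\<^sup>2)"

context l2_law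
begin

lemma integrable_coords_mult: "i < d \<Longrightarrow> j < d \<Longrightarrow> integrable P (\<lambda>x. x i * x j)"
proof (rule Bochner_Integration.integrable_bound)
  assume ij: "i < d" "j < d"
  note [measurable] = coord_measurable[OF ij(1)] coord_measurable[OF ij(2)]
  show "integrable P (\<lambda>x. (x i)\<^sup>2 + (x j)\<^sup>2)" using coord_sq ij by auto
  have "\<bar>y * z\<bar> \<le> y\<^sup>2 + z\<^sup>2" for y z :: real
  proof -
    have "2 * \<bar>y * z\<bar> \<le> y\<^sup>2 + z\<^sup>2"
      using sum_squares_bound[of "\<bar>y\<bar>" "\<bar>z\<bar>"] by (simp add: abs_mult mult.assoc)
    then show ?thesis using abs_ge_zero[of "y * z"] by linarith
  qed
  then show "AE x in P. norm (x i * x j) \<le> norm ((x i)\<^sup>2 + (x j)\<^sup>2)" by simp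
  show "(\<lambda>x. x i * x j) \<in> borel_measurable P" by measurable
qed

lemma expectation_bilin:
  "integrable P (\<lambda>x. bilin d A x x)"
  "expectation (\<lambda>x. bilin d A x x) = (\<Sum>i<d. \<Sum>j<d. A i j * moment P i j)"
proof -
  note int = Bochner_Integration.integrable_sum integrable_mult_right integrable_coords_mult
  show "integrable P (\<lambda>x. bilin d A x x)"
    unfolding bilin_def by (intro int) auto
  have "expectation (\<lambda>x. bilin d A x x) = (\<Sum>i<d. expectation (\<lambda>x. \<Sum>j<d. A i j * (x i * x j)))"
    unfolding bilin_def by (intro Bochner_Integration.integral_sum int) auto
  also have "\<dots> = (\<Sum>i<d. \<Sum>j<d. expectation (\<lambda>x. A i j * (x i * x j)))"
    by (intro sum.cong refl Bochner_Integration.integral_sum int) auto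
  finally show "expectation (\<lambda>x. bilin d A x x) = (\<Sum>i<d. \<Sum>j<d. A i j * moment P i j)"
    by (simp add: moment_def)
qed

lemma inner_prod_mult_eq_bilin: "inner_prod d u x * inner_prod d v x = bilin d (\<lambda>i j. u i * v j) x x"
  by (simp add: inner_prod_def bilin_def sum_product mult_ac)

lemma integrable_inner_prod_mult: "integrable P (\<lambda>x. inner_prod d u x * inner_prod d v x)"
  unfolding inner_prod_mult_eq_bilin by (rule expectation_bilin)

lemma expectation_inner_prod_mult:
  "expectation (\<lambda>x. inner_prod d u x * inner_prod d v x) = (\<Sum>i<d. \<Sum>j<d. u i * v j * moment P i j)"
  unfolding inner_prod_mult_eq_bilin by (rule expectation_bilin)

lemma integrable_inner_prod_sq: "integrable P (\<lambda>x. (inner_prod d u x)\<^sup>2)"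
  unfolding power2_eq_square by (rule integrable_inner_prod_mult)

lemma integrable_inner_prod: "integrable P (inner_prod d u)"
  by (rule square_integrable_imp_integrable) (auto intro: integrable_inner_prod_sq)

lemma integrable_logcosh: "integrable P (\<lambda>x. logcosh (inner_prod d u x))"
  by (rule Bochner_Integration.integrable_bound[OF integrable_inner_prod[of u]])
    (auto simp: abs_logcosh_le)

lemma integrable_tanh:
  assumes "integrable P f"
  shows "integrable P (\<lambda>x. f x * tanh (inner_prod d u x))"
proof (rule Bochner_Integration.integrable_bound[OF assms])
  show "(\<lambda>x. f x * tanh (inner_prod d u x)) \<in> borel_measurable P" using assms by measurable
  have "\<bar>f x\<bar> * \<bar>tanh (inner_prod d u x)\<bar> \<le> \<bar>f x\<bar> * 1" for x
    by (intro mult_left_mono abs_tanh_le_1) auto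
  then show "AE x in P. norm (f x * tanh (inner_prod d u x)) \<le> norm (f x)" by (simp add: abs_mult)
qed

lemma integrable_single: "k < d \<Longrightarrow> integrable P (\<lambda>x. x k)"
  by (rule square_integrable_imp_integrable) (auto intro: coord_sq)

lemma expectation_abs_inner_prod_le:
  assumes "moment_bound d P a" "0 < a"
  shows "expectation (\<lambda>x. \<bar>inner_prod d u x\<bar>) \<le> a * norm2 d u"
proof (cases "norm2 d u = 0")
  case True
  then have "inner_prod d u x = 0" for x using abs_inner_prod_le[of d u x] by simp
  then show ?thesis using True by simp
next
  case False
  then have u: "0 < norm2 d u" using norm2_nonneg[of d u] by linarith
  show ?thesis
    using expectation_abs_mult_le(2)[of "inner_prod d u" P "\<lambda>_. 1" "a * norm2 d u" 1]
      integrable_inner_prod_sq assms u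
    by (auto simp: moment_bound_def power_mult_distrib prob_space)
qed

lemma avg_logcosh_Lipschitz:
  assumes "moment_bound d P a" "0 < a"
  shows "\<bar>avg_logcosh d P b - avg_logcosh d P b'\<bar> \<le> a * norm2 d (\<lambda>i. b i - b' i)"
proof -
  have "\<bar>avg_logcosh d P b - avg_logcosh d P b'\<bar>
      = \<bar>expectation (\<lambda>x. logcosh (inner_prod d b x) - logcosh (inner_prod d b' x))\<bar>"
    using integrable_logcosh by (simp add: avg_logcosh_def)
  also have "\<dots> \<le> expectation (\<lambda>x. \<bar>logcosh (inner_prod d b x) - logcosh (inner_prod d b' x)\<bar>)"
    by (rule integral_abs_bound)
  also have "\<dots> \<le> expectation (\<lambda>x. \<bar>inner_prod d (\<lambda>i. b i - b' i) x\<bar>)"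
    using integrable_logcosh integrable_inner_prod
    by (intro integral_mono integrable_abs Bochner_Integration.integrable_diff)
       (auto simp: inner_prod_diff logcosh_Lipschitz)
  also have "\<dots> \<le> a * norm2 d (\<lambda>i. b i - b' i)"
    by (rule expectation_abs_inner_prod_le[OF assms])
  finally show ?thesis .
qed

lemma continuous_avg_logcosh: "continuous_on UNIV (avg_logcosh d P)"
proof (rule continuous_on_coordinatewise_Lipschitz)
  fix b b'
  have "\<bar>avg_logcosh d P b' - avg_logcosh d P b\<bar>
      = \<bar>expectation (\<lambda>x. logcosh (inner_prod d b' x) - logcosh (inner_prod d b x))\<bar>"
    using integrable_logcosh by (simp add: avg_logcosh_def)
  also have "\<dots> \<le> expectation (\<lambda>x. \<bar>logcosh (inner_prod d b' x) - logcosh (inner_prod d b x)\<bar>)"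
    by (rule integral_abs_bound)
  also have "\<dots> \<le> expectation (\<lambda>x. \<Sum>l<d. \<bar>b' l - b l\<bar> * \<bar>x l\<bar>)"
  proof (rule integral_mono)
    fix x
    have "\<bar>logcosh (inner_prod d b' x) - logcosh (inner_prod d b x)\<bar> \<le> \<bar>\<Sum>l<d. (b' l - b l) * x l\<bar>"
      using logcosh_Lipschitz[of "inner_prod d b' x" "inner_prod d b x"]
      by (simp add: inner_prod_def sum_subtractf left_diff_distrib)
    also have "\<dots> \<le> (\<Sum>l<d. \<bar>b' l - b l\<bar> * \<bar>x l\<bar>)"
      by (rule order_trans[OF sum_abs]) (simp add: abs_mult)
    finally show "\<bar>logcosh (inner_prod d b' x) - logcosh (inner_prod d b x)\<bar> \<le> (\<Sum>l<d. \<bar>b' l - b l\<bar> * \<bar>x l\<bar>)" .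
  qed (use integrable_logcosh integrable_single in auto)
  also have "\<dots> = (\<Sum>l<d. \<bar>b' l - b l\<bar> * expectation (\<lambda>x. \<bar>x l\<bar>))"
    using integrable_single by simp
  finally show "\<bar>avg_logcosh d P b' - avg_logcosh d P b\<bar> \<le> (\<Sum>l<d. \<bar>b' l - b l\<bar> * expectation (\<lambda>x. \<bar>x l\<bar>))" .
qed

lemma avg_logcosh_midpoint_convex:
  "2 * avg_logcosh d P (\<lambda>i. (b i + b' i) / 2) \<le> avg_logcosh d P b + avg_logcosh d P b'"
proof -
  have ip: "inner_prod d (\<lambda>i. (b i + b' i) / 2) x = (inner_prod d b x + inner_prod d b' x) / 2" for x
    using inner_prod_scale[of d "1/2" "\<lambda>i. b i + b' i" x] by (simp add: inner_prod_add)
  have "0 \<le> expectation (\<lambda>x. logcosh (inner_prod d b x) + logcosh (inner_prod d b' x)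
      - 2 * logcosh (inner_prod d (\<lambda>i. (b i + b' i) / 2) x))"
    unfolding ip by (intro integral_nonneg_AE AE_I2 logcosh_midpoint)
  then show ?thesis
    using integrable_logcosh by (simp add: avg_logcosh_def)
qed

lemma avg_logcosh_midpoint_smooth:
  assumes "moment_bound d P a"
  shows "avg_logcosh d P b + avg_logcosh d P b' - 2 * avg_logcosh d P (\<lambda>i. (b i + b' i) / 2)
    \<le> a\<^sup>2 * (norm2 d (\<lambda>i. b i - b' i))\<^sup>2 / 4"
proof -
  have ip: "inner_prod d (\<lambda>i. (b i + b' i) / 2) x = (inner_prod d b x + inner_prod d b' x) / 2" for x
    using inner_prod_scale[of d "1/2" "\<lambda>i. b i + b' i" x] by (simp add: inner_prod_add)
  have "avg_logcosh d P b + avg_logcosh d P b' - 2 * avg_logcosh d P (\<lambda>i. (b i + b' i) / 2)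
     = expectation (\<lambda>x. logcosh (inner_prod d b x) + logcosh (inner_prod d b' x)
      - 2 * logcosh (inner_prod d (\<lambda>i. (b i + b' i) / 2) x))"
    using integrable_logcosh by (simp add: avg_logcosh_def)
  also have "\<dots> \<le> expectation (\<lambda>x. (inner_prod d (\<lambda>i. b i - b' i) x)\<^sup>2 / 4)"
  proof (rule integral_mono)
    show "integrable P (\<lambda>x. logcosh (inner_prod d b x) + logcosh (inner_prod d b' x)
      - 2 * logcosh (inner_prod d (\<lambda>i. (b i + b' i) / 2) x))"
      using integrable_logcosh by auto
    show "integrable P (\<lambda>x. (inner_prod d (\<lambda>i. b i - b' i) x)\<^sup>2 / 4)"
      using integrable_inner_prod_sq by auto
    show "logcosh (inner_prod d b x) + logcosh (inner_prod d b' x)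
      - 2 * logcosh (inner_prod d (\<lambda>i. (b i + b' i) / 2) x) \<le> (inner_prod d (\<lambda>i. b i - b' i) x)\<^sup>2 / 4" for x
      unfolding ip inner_prod_diff by (rule logcosh_midpoint)
  qed
  also have "\<dots> \<le> a\<^sup>2 * (norm2 d (\<lambda>i. b i - b' i))\<^sup>2 / 4"
    using assms by (simp add: moment_bound_def)
  finally show ?thesis .
qed

text \<open>Identifies \<open>avg_tanh\<close> as the gradient of \<open>avg_logcosh\<close>, with a
  remainder that is quadratic in \<open>s\<close> for each direction \<open>e\<close>.\<close>

lemma avg_logcosh_Taylor:
  "\<bar>avg_logcosh d P (\<lambda>i. b i + s * e i) - avg_logcosh d P b - s * (\<Sum>k<d. e k * avg_tanh d P b k)\<bar>
    \<le> expectation (\<lambda>x. (inner_prod d e x)\<^sup>2) * s\<^sup>2"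
proof -
  have ip: "inner_prod d (\<lambda>i. b i + s * e i) x = inner_prod d b x + s * inner_prod d e x" for x
    by (simp add: inner_prod_add inner_prod_scale)
  have "(\<Sum>k<d. e k * avg_tanh d P b k) = expectation (\<lambda>x. \<Sum>k<d. e k * (x k * tanh (inner_prod d b x)))"
    using integrable_tanh[OF integrable_single] by (simp add: avg_tanh_def)
  also have "\<dots> = expectation (\<lambda>x. inner_prod d e x * tanh (inner_prod d b x))"
    by (simp add: inner_prod_def sum_distrib_right mult.assoc)
  finally have tanh: "(\<Sum>k<d. e k * avg_tanh d P b k) = expectation (\<lambda>x. inner_prod d e x * tanh (inner_prod d b x))" .
  define f where "f = (\<lambda>x. logcosh (inner_prod d (\<lambda>i. b i + s * e i) x))"
  define g where "g = (\<lambda>x. logcosh (inner_prod d b x))"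
  define h where "h = (\<lambda>x. inner_prod d e x * tanh (inner_prod d b x))"
  have int [simp]: "integrable P f" "integrable P g" "integrable P h"
    unfolding f_def g_def h_def by (intro integrable_logcosh integrable_tanh integrable_inner_prod)+
  have "expectation f - expectation g - s * expectation h = expectation (\<lambda>x. f x - g x - s * h x)"
    by simp
  also have "\<bar>\<dots>\<bar> \<le> expectation (\<lambda>x. \<bar>f x - g x - s * h x\<bar>)"
    by (rule integral_abs_bound)
  also have "\<dots> \<le> expectation (\<lambda>x. (inner_prod d e x)\<^sup>2 * s\<^sup>2)"
  proof (rule integral_mono)
    show "integrable P (\<lambda>x. \<bar>f x - g x - s * h x\<bar>)" by simp
    show "integrable P (\<lambda>x. (inner_prod d e x)\<^sup>2 * s\<^sup>2)"
      using integrable_inner_prod_sq[of e] by simp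
    fix x
    have "\<bar>logcosh (inner_prod d b x + s * inner_prod d e x) - logcosh (inner_prod d b x)
        - s * inner_prod d e x * tanh (inner_prod d b x)\<bar> \<le> (s * inner_prod d e x)\<^sup>2"
      by (rule logcosh_Taylor)
    then show "\<bar>f x - g x - s * h x\<bar> \<le> (inner_prod d e x)\<^sup>2 * s\<^sup>2"
      by (simp only: f_def g_def h_def ip power_mult_distrib mult.assoc mult.commute[of "(inner_prod d e x)\<^sup>2"])
  qed
  finally show ?thesis
    by (simp add: avg_logcosh_def f_def g_def h_def tanh)
qed

end

text \<open>A uniform bound on the deviation of gradients, integrated along the segment from
  \<open>b'\<close> to \<open>b\<close>, which stays in the ball by convexity. Controlling
  differences of deviations rather than deviations themselves is what both the stability of
  maximisers and the cancellation in the value rely on.\<close>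

lemma avg_logcosh_diff_Lipschitz:
  assumes P: "l2_law P d" and Q: "l2_law Q d"
    and \<Delta>: "\<And>c. norm2 d c < \<beta> \<Longrightarrow> norm2 d (\<lambda>k. avg_tanh d P c k - avg_tanh d Q c k) \<le> \<Delta>"
    and b: "norm2 d b < \<beta>" "norm2 d b' < \<beta>"
  shows "\<bar>(avg_logcosh d P b - avg_logcosh d Q b) - (avg_logcosh d P b' - avg_logcosh d Q b')\<bar>
      \<le> \<Delta> * norm2 d (\<lambda>i. b i - b' i)"
proof -
  interpret P: l2_law P d by (rule P)
  interpret Q: l2_law Q d by (rule Q)
  define e where "e = (\<lambda>i. b i - b' i)"
  define bt where "bt = (\<lambda>t i. b' i + t * e i)"
  define F where "F = (\<lambda>t. avg_logcosh d P (bt t) - avg_logcosh d Q (bt t))"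
  define F' where "F' = (\<lambda>t. (\<Sum>k<d. e k * avg_tanh d P (bt t) k) - (\<Sum>k<d. e k * avg_tanh d Q (bt t) k))"
  have der: "(F has_real_derivative F' t) (at t)" for t
  proof (rule DERIV_if_quadratic_remainder)
    fix s
    have "bt (t + s) = (\<lambda>i. bt t i + s * e i)" by (simp add: bt_def algebra_simps)
    then show "\<bar>F (t + s) - F t - s * F' t\<bar> \<le> (P.expectation (\<lambda>x. (inner_prod d e x)\<^sup>2) + Q.expectation (\<lambda>x. (inner_prod d e x)\<^sup>2)) * s\<^sup>2"
      using P.avg_logcosh_Taylor[of "bt t" s e] Q.avg_logcosh_Taylor[of "bt t" s e]
      by (simp add: F_def F'_def algebra_simps abs_le_iff)
  qed
  have F'_le: "\<bar>F' t\<bar> \<le> \<Delta> * norm2 d e" if t: "0 \<le> t" "t \<le> 1" for t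
  proof -
    have "norm2 d (bt t) < \<beta>"
    proof -
      have "bt t = (\<lambda>i. (1 - t) * b' i + t * b i)" by (auto simp: bt_def e_def algebra_simps)
      then have "norm2 d (bt t) \<le> (1 - t) * norm2 d b' + t * norm2 d b"
        using norm2_triangle[of d "\<lambda>i. (1 - t) * b' i" "\<lambda>i. t * b i"] t by (simp add: norm2_scale)
      also have "\<dots> < \<beta>"
        using t b by (intro convex_bound_lt) auto
      finally show ?thesis .
    qed
    have "F' t = inner_prod d e (\<lambda>k. avg_tanh d P (bt t) k - avg_tanh d Q (bt t) k)"
      by (simp add: F'_def inner_prod_def sum_subtractf right_diff_distrib)
    also have "\<bar>\<dots>\<bar> \<le> norm2 d e * norm2 d (\<lambda>k. avg_tanh d P (bt t) k - avg_tanh d Q (bt t) k)"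
      by (rule abs_inner_prod_le)
    also have "\<dots> \<le> norm2 d e * \<Delta>"
      by (intro mult_left_mono \<Delta>) (use \<open>norm2 d (bt t) < \<beta>\<close> in auto)
    finally show ?thesis by (simp add: mult.commute)
  qed
  have "norm (F 1 - F 0) \<le> \<Delta> * norm2 d e * norm (1 - 0 :: real)"
    by (rule field_differentiable_bound[of "{0..1}" F F'])
       (auto intro: DERIV_subset[OF der] F'_le)
  moreover have "bt 1 = b" "bt 0 = b'" by (auto simp: bt_def e_def)
  ultimately show ?thesis by (simp add: F_def e_def)
qed

text \<open>Midpoint strong concavity turns a maximiser into one with quadratic growth, without any
  derivatives.\<close>

lemma penalized_logcosh_argmax:
  assumes P: "l2_law P d" and Q: "l2_law Q d" and lam: "0 < lam"
    and aP: "moment_bound d P aP" "0 < aP" "aP\<^sup>2 \<le> 3 / 2 * lam" and aQ: "moment_bound d Q aQ" "0 < aQ"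
  obtains bs where
    "\<And>b. avg_logcosh d P b - avg_logcosh d Q b - lam * (norm2 d (\<lambda>i. b i - w i))\<^sup>2
       \<le> avg_logcosh d P bs - avg_logcosh d Q bs - lam * (norm2 d (\<lambda>i. bs i - w i))\<^sup>2
         - lam / 8 * (norm2 d (\<lambda>i. b i - bs i))\<^sup>2"
    "norm2 d (\<lambda>i. bs i - w i) \<le> (aP + aQ) / lam"
proof -
  interpret P: l2_law P d by (rule P)
  interpret Q: l2_law Q d by (rule Q)
  define \<psi> where "\<psi> = (\<lambda>b. avg_logcosh d P b - avg_logcosh d Q b - lam * (norm2 d (\<lambda>i. b i - w i))\<^sup>2)"
  define \<rho> where "\<rho> = (aP + aQ) / lam"
  have \<rho>: "0 < \<rho>" "lam * \<rho> = aP + aQ" using lam aP aQ by (auto simp: \<rho>_def)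
  \<comment> \<open>The gain over \<open>\<psi> w\<close> is at most linear in the distance from
    \<open>w\<close> and the penalty is quadratic; they balance at distance \<open>\<rho>\<close>,
    beyond which no maximiser can lie.\<close>
  have upper: "\<psi> b \<le> \<psi> w + lam * norm2 d (\<lambda>i. b i - w i) * (\<rho> - norm2 d (\<lambda>i. b i - w i))" for b
  proof -
    have "\<psi> b - \<psi> w \<le> (aP + aQ) * norm2 d (\<lambda>i. b i - w i) - lam * (norm2 d (\<lambda>i. b i - w i))\<^sup>2"
      using P.avg_logcosh_Lipschitz[OF aP(1,2), of b w] Q.avg_logcosh_Lipschitz[OF aQ, of b w]
      by (simp add: \<psi>_def abs_le_iff algebra_simps norm2_def L2_set_def)
    then show ?thesis unfolding \<rho>(2)[symmetric] by (simp add: algebra_simps power2_eq_square)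
  qed
  \<comment> \<open>A box that is compact in the product topology: the coordinates from
    \<open>d\<close> on, which do not influence \<open>\<psi>\<close>, are frozen at
    \<open>w\<close>.\<close>
  define K where "K = PiE UNIV (\<lambda>i. if i < d then {w i - \<rho>..w i + \<rho>} else {w i})"
  have "compactin (product_topology (\<lambda>_. euclidean) UNIV) K"
    unfolding K_def by (subst compactin_PiE) auto
  then have K: "compact K" by (simp add: euclidean_product_topology)
  have "w \<in> K" using \<rho> by (auto simp: K_def)
  have "continuous_on UNIV \<psi>"
  proof -
    have "continuous_on UNIV (\<lambda>b. norm2 d (\<lambda>i. b i - w i))"
      by (intro continuous_norm2 continuous_intros continuous_on_product_coordinates)
    then show ?thesis unfolding \<psi>_def
      by (intro continuous_intros P.continuous_avg_logcosh Q.continuous_avg_logcosh)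
  qed
  then obtain bs where bs: "bs \<in> K" "\<And>b. b \<in> K \<Longrightarrow> \<psi> b \<le> \<psi> bs"
    using continuous_attains_sup[of K \<psi>] K \<open>w \<in> K\<close> by (metis continuous_on_subset empty_iff subset_UNIV)
  have max: "\<psi> b \<le> \<psi> bs" for b
  proof (cases "norm2 d (\<lambda>i. b i - w i) \<le> \<rho>")
    case True
    \<comment> \<open>Resetting the irrelevant coordinates moves \<open>b\<close> into the box
      without changing \<open>\<psi>\<close>.\<close>
    define b' where "b' = (\<lambda>i. if i < d then b i else w i)"
    have "\<bar>b i - w i\<bar> \<le> \<rho>" if "i < d" for i
      using abs_coord_le_norm2[OF that, of "\<lambda>i. b i - w i"] True by simp
    then have "b' \<in> K" by (fastforce simp: K_def b'_def abs_le_iff)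
    then have "\<psi> b' \<le> \<psi> bs" by (rule bs)
    moreover have "\<psi> b' = \<psi> b"
      by (simp add: \<psi>_def b'_def avg_logcosh_def inner_prod_def norm2_def L2_set_def)
    ultimately show ?thesis by simp
  next
    case False
    then have "lam * norm2 d (\<lambda>i. b i - w i) * (\<rho> - norm2 d (\<lambda>i. b i - w i)) \<le> 0"
      using lam by (intro mult_nonneg_nonpos) auto
    then show ?thesis using upper[of b] bs(2)[OF \<open>w \<in> K\<close>] by simp
  qed
  show ?thesis
  proof (rule that[of bs])
    show "norm2 d (\<lambda>i. bs i - w i) \<le> (aP + aQ) / lam"
    proof (rule ccontr)
      assume "\<not> ?thesis"
      then have "\<rho> < norm2 d (\<lambda>i. bs i - w i)" by (simp add: \<rho>_def)
      then have "lam * norm2 d (\<lambda>i. bs i - w i) * (\<rho> - norm2 d (\<lambda>i. bs i - w i)) < 0"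
        using lam \<rho> by (intro mult_pos_neg) auto
      then show False using upper[of bs] max[of w] by simp
    qed
    fix b
    define c where "c = (\<lambda>i. (b i + bs i) / 2)"
    \<comment> \<open>At the midpoint the penalty gains \<open>lam / 2\<close> times the squared
      distance. The smooth term of \<open>P\<close> costs at most \<open>aP\<^sup>2 / 4\<close>,
      hence at most \<open>3 / 8 * lam\<close>, and the term of \<open>Q\<close> helps since it is
      convex and enters negatively. This leaves \<open>lam / 8\<close>.\<close>
    have "2 * \<psi> c \<ge> \<psi> b + \<psi> bs + lam / 8 * (norm2 d (\<lambda>i. b i - bs i))\<^sup>2"
    proof -
      have "avg_logcosh d P b + avg_logcosh d P bs - 2 * avg_logcosh d P c \<le> aP\<^sup>2 * (norm2 d (\<lambda>i. b i - bs i))\<^sup>2 / 4"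
        unfolding c_def by (rule P.avg_logcosh_midpoint_smooth[OF aP(1)])
      also have "\<dots> \<le> 3 / 2 * lam * (norm2 d (\<lambda>i. b i - bs i))\<^sup>2 / 4"
        using aP(3) by (intro divide_right_mono mult_right_mono) auto
      finally have "avg_logcosh d P b + avg_logcosh d P bs - 2 * avg_logcosh d P c \<le> 3 / 8 * lam * (norm2 d (\<lambda>i. b i - bs i))\<^sup>2"
        by simp
      moreover have "2 * avg_logcosh d Q c \<le> avg_logcosh d Q b + avg_logcosh d Q bs"
        unfolding c_def by (rule Q.avg_logcosh_midpoint_convex)
      moreover have "2 * (norm2 d (\<lambda>i. c i - w i))\<^sup>2 = (norm2 d (\<lambda>i. b i - w i))\<^sup>2 + (norm2 d (\<lambda>i. bs i - w i))\<^sup>2 - (norm2 d (\<lambda>i. b i - bs i))\<^sup>2 / 2"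
        unfolding c_def norm2_midpoint by simp
      then have "lam * (2 * (norm2 d (\<lambda>i. c i - w i))\<^sup>2) = lam * ((norm2 d (\<lambda>i. b i - w i))\<^sup>2 + (norm2 d (\<lambda>i. bs i - w i))\<^sup>2 - (norm2 d (\<lambda>i. b i - bs i))\<^sup>2 / 2)"
        by simp
      ultimately show ?thesis by (simp add: \<psi>_def algebra_simps)
    qed
    then have "\<psi> b \<le> \<psi> bs - lam / 8 * (norm2 d (\<lambda>i. b i - bs i))\<^sup>2"
      using max[of c] by linarith
    then show "avg_logcosh d P b - avg_logcosh d Q b - lam * (norm2 d (\<lambda>i. b i - w i))\<^sup>2
       \<le> avg_logcosh d P bs - avg_logcosh d Q bs - lam * (norm2 d (\<lambda>i. bs i - w i))\<^sup>2
         - lam / 8 * (norm2 d (\<lambda>i. b i - bs i))\<^sup>2"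
      by (simp add: \<psi>_def)
  qed
qed

subsection \<open>Gaussian laws and mixtures\<close>

abbreviation std_normal :: "real measure" where
  "std_normal \<equiv> density lborel (\<lambda>t. ennreal (std_normal_density t))"

lemma std_normal_integral:
  assumes "integrable lborel (\<lambda>x. std_normal_density x * x ^ k)"
  shows "integrable std_normal (\<lambda>x. x ^ k)"
    "(\<integral>x. x ^ k \<partial>std_normal) = (\<integral>x. std_normal_density x * x ^ k \<partial>lborel)"
  using assms by (auto simp: integrable_density integral_density)

lemma std_normal_moments:
  "integrable std_normal (\<lambda>x. x)" "(\<integral>x. x \<partial>std_normal) = 0"
  "integrable std_normal (\<lambda>x. x * x)" "(\<integral>x. x * x \<partial>std_normal) = 1"
  using std_normal_integral[OF integrable_std_normal_moment, of 1]
    std_normal_integral[OF integrable_std_normal_moment, of 2]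
    integral_std_normal_moment_odd[of 0] integral_std_normal_moment_even[of 1]
  by (simp_all add: power2_eq_square)

lemma prob_space_std_gaussian: "prob_space (std_gaussian d)"
  unfolding std_gaussian_def by (rule prob_space_PiM) (rule prob_space_std_normal)

lemma sets_std_gaussian [measurable_cong]: "sets (std_gaussian d) = sets (\<Pi>\<^sub>M i\<in>{..<d}. borel)"
  unfolding std_gaussian_def by (rule sets_PiM_cong) auto

lemma coord_measurable_std_gaussian:
  "k < d \<Longrightarrow> (\<lambda>z. z k) \<in> borel_measurable (std_gaussian d)"
  unfolding measurable_cong_sets[OF sets_std_gaussian refl]
  by (rule measurable_component_singleton) simp

lemma std_gaussian_mult:
  assumes i: "i < d" and j: "j < d"
  shows "integrable (std_gaussian d) (\<lambda>z. z i * z j)"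
    "(\<integral>z. z i * z j \<partial>std_gaussian d) = (if i = j then 1 else 0)"
proof -
  interpret product_sigma_finite "\<lambda>_::nat. std_normal"
    unfolding product_sigma_finite_def
    using prob_space_std_normal prob_space_imp_sigma_finite by blast
  interpret N: prob_space std_normal by (rule prob_space_std_normal)
  define f where "f = (\<lambda>l (t::real). (if l = i then t else 1) * (if l = j then t else 1))"
  have prod: "(\<Prod>l<d. f l (z l)) = z i * z j" for z
    using i j by (simp add: f_def prod.distrib)
  have int: "integrable std_normal (f l)" for l
    by (cases "l = i"; cases "l = j") (auto simp: f_def std_normal_moments)
  show "integrable (std_gaussian d) (\<lambda>z. z i * z j)"
    using product_integrable_prod[where I = "{..<d}" and f = f, OF _ int]
    by (simp add: prod std_gaussian_def)
  have "(\<integral>z. z i * z j \<partial>std_gaussian d) = (\<Prod>l<d. integral\<^sup>L std_normal (f l))"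
    using product_integral_prod[where I = "{..<d}" and f = f, OF _ int]
    by (simp add: prod std_gaussian_def)
  also have "\<dots> = (if i = j then 1 else 0)"
  proof (cases "i = j")
    case True
    then have "integral\<^sup>L std_normal (f l) = 1" for l
      by (cases "l = i") (use N.prob_space in \<open>auto simp: f_def std_normal_moments\<close>)
    then show ?thesis using True by simp
  next
    case False
    then have "integral\<^sup>L std_normal (f i) = 0" by (simp add: f_def std_normal_moments)
    then show ?thesis using False i by (auto intro!: prod_zero)
  qed
  finally show "(\<integral>z. z i * z j \<partial>std_gaussian d) = (if i = j then 1 else 0)" .
qed

lemma std_gaussian_single:
  assumes i: "i < d"
  shows "(\<integral>z. z i \<partial>std_gaussian d) = 0"
proof -
  interpret product_sigma_finite "\<lambda>_::nat. std_normal"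
    unfolding product_sigma_finite_def
    using prob_space_std_normal prob_space_imp_sigma_finite by blast
  interpret N: prob_space std_normal by (rule prob_space_std_normal)
  define f where "f = (\<lambda>l (t::real). if l = i then t else 1)"
  have prod: "(\<Prod>l<d. f l (z l)) = z i" for z
    using i by (simp add: f_def)
  have int: "integrable std_normal (f l)" for l
    by (cases "l = i") (auto simp: f_def std_normal_moments)
  have "(\<integral>z. z i \<partial>std_gaussian d) = (\<Prod>l<d. integral\<^sup>L std_normal (f l))"
    using product_integral_prod[where I = "{..<d}" and f = f, OF _ int]
    by (simp add: prod std_gaussian_def)
  also have "\<dots> = 0"
    using i by (intro prod_zero bexI[of _ i]) (auto simp: f_def std_normal_moments)
  finally show ?thesis .
qed

lemma l2_law_std_gaussian: "l2_law (std_gaussian d) d"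
proof -
  interpret prob_space "std_gaussian d" by (rule prob_space_std_gaussian)
  show ?thesis
    by standard (auto simp: coord_measurable_std_gaussian power2_eq_square std_gaussian_mult)
qed

lemma moment_std_gaussian: "i < d \<Longrightarrow> j < d \<Longrightarrow> moment (std_gaussian d) i j = (if i = j then 1 else 0)"
  by (simp add: moment_def std_gaussian_mult)

lemma std_gaussian_nn_integral_exp:
  "(\<integral>\<^sup>+z. ennreal (exp (inner_prod d a z)) \<partial>std_gaussian d) = ennreal (exp ((norm2 d a)\<^sup>2 / 2))"
proof -
  interpret product_sigma_finite "\<lambda>_::nat. std_normal"
    unfolding product_sigma_finite_def
    using prob_space_std_normal prob_space_imp_sigma_finite by blast
  have "(\<integral>\<^sup>+z. ennreal (exp (inner_prod d a z)) \<partial>std_gaussian d)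
     = (\<integral>\<^sup>+z. (\<Prod>l<d. ennreal (exp (a l * z l))) \<partial>std_gaussian d)"
    by (simp add: inner_prod_def exp_sum prod_ennreal)
  also have "\<dots> = (\<Prod>l<d. \<integral>\<^sup>+t. ennreal (exp (a l * t)) \<partial>std_normal)"
    unfolding std_gaussian_def by (rule product_nn_integral_prod) auto
  also have "\<dots> = (\<Prod>l<d. ennreal (exp ((a l)\<^sup>2 / 2)))"
    by (simp add: std_normal_nn_integral_exp)
  also have "\<dots> = ennreal (exp ((norm2 d a)\<^sup>2 / 2))"
    by (simp add: prod_ennreal norm2_sq sum_divide_distrib exp_sum)
  finally show ?thesis .
qed

section \<open>Affine images of the standard normal law\<close>

definition affine_map :: "nat \<Rightarrow> rmat \<Rightarrow> rvec \<Rightarrow> rvec \<Rightarrow> rvec" where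
  "affine_map d \<Lambda> \<mu> z = (\<lambda>i\<in>{..<d}. mat_vec d \<Lambda> z i + \<mu> i)"

text \<open>The law of the generator before its random sign; since the constrained discriminators
  are even, it can stand in for the generator.\<close>

definition affine_law :: "nat \<Rightarrow> rmat \<Rightarrow> rvec \<Rightarrow> rvec measure" where
  "affine_law d \<Lambda> \<mu> = distr (std_gaussian d) (\<Pi>\<^sub>M i\<in>{..<d}. borel) (affine_map d \<Lambda> \<mu>)"

lemma affine_map_coord: "k < d \<Longrightarrow> affine_map d \<Lambda> \<mu> z k = inner_prod d (\<Lambda> k) z + \<mu> k"
  by (simp add: affine_map_def mat_vec_def inner_prod_def)

lemma affine_map_measurable [measurable]:
  "affine_map d \<Lambda> \<mu> \<in> measurable (std_gaussian d) (\<Pi>\<^sub>M i\<in>{..<d}. borel)"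
proof -
  have "(\<lambda>z. mat_vec d \<Lambda> z i + \<mu> i) \<in> borel_measurable (std_gaussian d)" for i
    unfolding mat_vec_def
    by (intro borel_measurable_add borel_measurable_sum borel_measurable_times
        borel_measurable_const coord_measurable_std_gaussian) auto
  then show ?thesis unfolding affine_map_def by (rule measurable_restrict)
qed

lemma sets_affine_law [simp]: "sets (affine_law d \<Lambda> \<mu>) = sets (\<Pi>\<^sub>M i\<in>{..<d}. borel)"
  by (simp add: affine_law_def)

lemma prob_space_affine_law: "prob_space (affine_law d \<Lambda> \<mu>)"
  unfolding affine_law_def
  by (rule prob_space.prob_space_distr[OF prob_space_std_gaussian]) measurable

lemma measurable_affine_law:
  "f \<in> borel_measurable (affine_law d \<Lambda> \<mu>) \<longleftrightarrow> f \<in> borel_measurable (\<Pi>\<^sub>M i\<in>{..<d}. borel)"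
  by (rule arg_cong[where f = "\<lambda>A. f \<in> A"]) (rule measurable_cong_sets[OF sets_affine_law refl])

lemma integral_affine_law:
  fixes f :: "rvec \<Rightarrow> real"
  assumes "f \<in> borel_measurable (affine_law d \<Lambda> \<mu>)"
  shows "(\<integral>x. f x \<partial>affine_law d \<Lambda> \<mu>) = (\<integral>z. f (affine_map d \<Lambda> \<mu> z) \<partial>std_gaussian d)"
  using assms unfolding measurable_affine_law
  unfolding affine_law_def by (rule integral_distr[OF affine_map_measurable])

lemma nn_integral_affine_law:
  assumes "f \<in> borel_measurable (\<Pi>\<^sub>M i\<in>{..<d}. borel)"
  shows "(\<integral>\<^sup>+x. f x \<partial>affine_law d \<Lambda> \<mu>) = (\<integral>\<^sup>+z. f (affine_map d \<Lambda> \<mu> z) \<partial>std_gaussian d)"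
  unfolding affine_law_def using assms by (subst nn_integral_distr) auto

lemma l2_law_affine_law: "l2_law (affine_law d \<Lambda> \<mu>) d"
proof -
  interpret prob_space "affine_law d \<Lambda> \<mu>" by (rule prob_space_affine_law)
  interpret Z: l2_law "std_gaussian d" d by (rule l2_law_std_gaussian)
  show ?thesis
  proof
    fix k assume k: "k < d"
    have m: "(\<lambda>x. x k) \<in> borel_measurable (\<Pi>\<^sub>M i\<in>{..<d}. borel)"
      by (rule measurable_component_singleton) (use k in simp)
    then show "(\<lambda>x. x k) \<in> borel_measurable (affine_law d \<Lambda> \<mu>)"
      by (simp add: measurable_affine_law)
    have "integrable (std_gaussian d) (\<lambda>z. (affine_map d \<Lambda> \<mu> z k)\<^sup>2)"
      using Z.integrable_inner_prod_sq[of "\<Lambda> k"] Z.integrable_inner_prod[of "\<Lambda> k"] k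
      by (simp add: affine_map_coord power2_sum)
    then show "integrable (affine_law d \<Lambda> \<mu>) (\<lambda>x. (x k)\<^sup>2)"
      unfolding affine_law_def using m by (subst integrable_distr_eq) (auto intro: borel_measurable_power)
  qed
qed

lemma std_gaussian_inner_prod_mult:
  "(\<integral>z. inner_prod d u z * inner_prod d v z \<partial>std_gaussian d) = inner_prod d u v"
proof -
  interpret Z: l2_law "std_gaussian d" d by (rule l2_law_std_gaussian)
  have "(\<integral>z. inner_prod d u z * inner_prod d v z \<partial>std_gaussian d) = (\<Sum>i<d. \<Sum>j<d. u i * v j * (if i = j then 1 else 0))"
    unfolding Z.expectation_inner_prod_mult by (intro sum.cong refl) (simp add: moment_std_gaussian)
  also have "\<dots> = inner_prod d u v"
    by (simp add: inner_prod_def if_distrib[of "\<lambda>x. _ * x"] cong: if_cong)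
  finally show ?thesis .
qed

lemma std_gaussian_inner_prod: "(\<integral>z. inner_prod d u z \<partial>std_gaussian d) = 0"
proof -
  interpret Z: l2_law "std_gaussian d" d by (rule l2_law_std_gaussian)
  show ?thesis unfolding inner_prod_def using Z.integrable_single by (simp add: std_gaussian_single)
qed

text \<open>This identifies the matrix whose Frobenius norm the theorem bounds as the second-moment
  matrix of the generator.\<close>

lemma moment_affine_law:
  assumes ij: "i < d" "j < d"
  shows "moment (affine_law d \<Lambda> \<mu>) i j = \<mu> i * \<mu> j + gram d \<Lambda> i j"
proof -
  interpret Z: l2_law "std_gaussian d" d by (rule l2_law_std_gaussian)
  interpret A: l2_law "affine_law d \<Lambda> \<mu>" d by (rule l2_law_affine_law)
  note [measurable] = A.coord_measurable[OF ij(1)] A.coord_measurable[OF ij(2)]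
  have "moment (affine_law d \<Lambda> \<mu>) i j
     = (\<integral>z. inner_prod d (\<Lambda> i) z * inner_prod d (\<Lambda> j) z + \<mu> j * inner_prod d (\<Lambda> i) z
         + \<mu> i * inner_prod d (\<Lambda> j) z + \<mu> i * \<mu> j \<partial>std_gaussian d)"
    unfolding moment_def using ij
    by (subst integral_affine_law) (auto simp: affine_map_coord algebra_simps intro!: Bochner_Integration.integral_cong)
  also have "\<dots> = inner_prod d (\<Lambda> i) (\<Lambda> j) + \<mu> i * \<mu> j"
    using Z.integrable_inner_prod_mult Z.integrable_inner_prod
    by (simp add: std_gaussian_inner_prod_mult std_gaussian_inner_prod Z.prob_space)
  finally show ?thesis by (simp add: inner_prod_def gram_def)
qed

lemma logcosh_le_half_sq: "logcosh x \<le> x\<^sup>2 / 2"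
  using logcosh_midpoint(2)[of x "- x"] by (simp add: logcosh_def power2_eq_square)

lemma cosh_le_exp_half_sq: "cosh x \<le> exp (x\<^sup>2 / 2)" for x :: real
proof -
  have "cosh x = exp (logcosh x)" by (simp add: logcosh_def)
  then show ?thesis using logcosh_le_half_sq[of x] by simp
qed

text \<open>The Gaussian part contributes the factor
  \<open>exp (t\<^sup>2 * gram d \<Lambda> k k / 2)\<close>, and \<open>cosh (t * \<mu> k)\<close>
  is at most \<open>exp ((t * \<mu> k)\<^sup>2 / 2)\<close>. Squared mean and variance therefore add
  up to the second moment about 0.\<close>

lemma affine_law_subgaussian:
  assumes k: "k < d"
  shows "(\<integral>\<^sup>+x. ennreal (cosh (t * x k)) \<partial>affine_law d \<Lambda> \<mu>)
      \<le> ennreal (exp (t\<^sup>2 * (\<mu> k * \<mu> k + gram d \<Lambda> k k) / 2))"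
proof -
  interpret Z: l2_law "std_gaussian d" d by (rule l2_law_std_gaussian)
  define E where "E = (\<lambda>z. exp (inner_prod d (\<lambda>j. t * \<Lambda> k j) z))"
  define E' where "E' = (\<lambda>z. exp (inner_prod d (\<lambda>j. - t * \<Lambda> k j) z))"
  have [measurable]: "E \<in> borel_measurable (std_gaussian d)" "E' \<in> borel_measurable (std_gaussian d)"
    unfolding E_def E'_def by measurable
  define \<sigma> where "\<sigma> = t\<^sup>2 * gram d \<Lambda> k k / 2"
  have n: "(norm2 d (\<lambda>j. c * \<Lambda> k j))\<^sup>2 = c\<^sup>2 * gram d \<Lambda> k k" for c
    unfolding norm2_sq by (simp add: gram_def power2_eq_square sum_distrib_left mult_ac)
  have E: "(\<integral>\<^sup>+z. ennreal (E z) \<partial>std_gaussian d) = ennreal (exp \<sigma>)"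
    "(\<integral>\<^sup>+z. ennreal (E' z) \<partial>std_gaussian d) = ennreal (exp \<sigma>)"
    unfolding E_def E'_def std_gaussian_nn_integral_exp n \<sigma>_def by simp_all
  have m: "(\<lambda>x. x k) \<in> borel_measurable (\<Pi>\<^sub>M i\<in>{..<d}. borel)"
    by (rule measurable_component_singleton) (use k in simp)
  have "(\<integral>\<^sup>+x. ennreal (cosh (t * x k)) \<partial>affine_law d \<Lambda> \<mu>)
     = (\<integral>\<^sup>+z. ennreal (cosh (t * (inner_prod d (\<Lambda> k) z + \<mu> k))) \<partial>std_gaussian d)"
    using m k by (subst nn_integral_affine_law) (auto simp: affine_map_coord)
  also have "\<dots> = (\<integral>\<^sup>+z. ennreal (exp (t * \<mu> k) / 2) * ennreal (E z) + ennreal (exp (- (t * \<mu> k)) / 2) * ennreal (E' z) \<partial>std_gaussian d)"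
  proof (rule nn_integral_cong)
    fix z
    have "cosh (t * (inner_prod d (\<Lambda> k) z + \<mu> k)) = exp (t * \<mu> k) / 2 * E z + exp (- (t * \<mu> k)) / 2 * E' z"
      unfolding E_def E'_def inner_prod_scale
      by (simp add: cosh_def distrib_left exp_add exp_diff exp_minus field_simps)
    then show "ennreal (cosh (t * (inner_prod d (\<Lambda> k) z + \<mu> k))) = ennreal (exp (t * \<mu> k) / 2) * ennreal (E z) + ennreal (exp (- (t * \<mu> k)) / 2) * ennreal (E' z)"
      by (simp add: E_def E'_def flip: ennreal_mult' ennreal_plus)
  qed
  also have "\<dots> = ennreal (exp (t * \<mu> k) / 2) * ennreal (exp \<sigma>) + ennreal (exp (- (t * \<mu> k)) / 2) * ennreal (exp \<sigma>)"
    by (simp add: nn_integral_add nn_integral_cmult E)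
  also have "\<dots> = ennreal (cosh (t * \<mu> k) * exp \<sigma>)"
    by (simp add: cosh_def field_simps flip: ennreal_mult' ennreal_plus)
  also have "\<dots> \<le> ennreal (exp ((t * \<mu> k)\<^sup>2 / 2) * exp \<sigma>)"
    by (intro ennreal_leI mult_right_mono cosh_le_exp_half_sq) auto
  also have "exp ((t * \<mu> k)\<^sup>2 / 2) * exp \<sigma> = exp (t\<^sup>2 * (\<mu> k * \<mu> k + gram d \<Lambda> k k) / 2)"
    by (simp add: \<sigma>_def exp_add[symmetric] power2_eq_square field_simps)
  finally show ?thesis .
qed

lemma gaussian_eq_affine_law:
  "gaussian d m S = affine_law d (SOME L. \<forall>i<d. \<forall>j<d. gram d L i j = S i j) m"
  unfolding gaussian_def affine_law_def affine_map_def Let_def by (simp add: add.commute)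

text \<open>The factor that \<open>gaussian\<close> selects by \<open>SOME\<close> appears as an
  anonymous \<open>L\<close>; later bounds are phrased through \<open>moment\<close> of the mixture,
  so that \<open>L\<close> drops out again.\<close>

lemma sym_mixture_props:
  obtains L where
    "sets (sym_mixture d m S) = sets (\<Pi>\<^sub>M i\<in>{..<d}. borel)"
    "prob_space (sym_mixture d m S)"
    "\<And>f. f \<in> borel_measurable (\<Pi>\<^sub>M i\<in>{..<d}. borel) \<Longrightarrow>
      (\<integral>\<^sup>+x. f x \<partial>sym_mixture d m S)
        = ((\<integral>\<^sup>+x. f x \<partial>affine_law d L (\<lambda>i. - m i)) + (\<integral>\<^sup>+x. f x \<partial>affine_law d L m)) / 2"
proof -
  define L where "L = (SOME L. \<forall>i<d. \<forall>j<d. gram d L i j = S i j)"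
  define N where "N = (\<lambda>y. affine_law d L (\<lambda>i. y * m i))"
  have P: "sym_mixture d m S = random_sign \<bind> N"
    by (simp add: sym_mixture_def gaussian_eq_affine_law N_def L_def)
  have N: "N \<in> measurable random_sign (subprob_algebra (\<Pi>\<^sub>M i\<in>{..<d}. borel))"
    unfolding random_sign_def N_def using prob_space_affine_law
    by (auto simp: space_subprob_algebra intro: prob_space_imp_subprob_space)
  interpret R: prob_space random_sign unfolding random_sign_def by (rule prob_space_measure_pmf)
  show ?thesis
  proof (rule that[of L])
    show "sets (sym_mixture d m S) = sets (\<Pi>\<^sub>M i\<in>{..<d}. borel)"
      unfolding P by (rule sets_bind) (auto simp: N_def random_sign_def)
    show "prob_space (sym_mixture d m S)"
      unfolding P by (rule R.prob_space_bind[OF _ N]) (simp add: N_def prob_space_affine_law)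
    fix f :: "rvec \<Rightarrow> ennreal" assume f: "f \<in> borel_measurable (\<Pi>\<^sub>M i\<in>{..<d}. borel)"
    have "(\<integral>\<^sup>+x. f x \<partial>sym_mixture d m S) = (\<integral>\<^sup>+y. (\<integral>\<^sup>+x. f x \<partial>N y) \<partial>random_sign)"
      unfolding P by (rule nn_integral_bind[OF f N])
    also have "\<dots> = ((\<integral>\<^sup>+x. f x \<partial>N (-1)) + (\<integral>\<^sup>+x. f x \<partial>N 1)) / 2"
      unfolding random_sign_def by (subst nn_integral_pmf_of_set) auto
    finally show "(\<integral>\<^sup>+x. f x \<partial>sym_mixture d m S)
        = ((\<integral>\<^sup>+x. f x \<partial>affine_law d L (\<lambda>i. - m i)) + (\<integral>\<^sup>+x. f x \<partial>affine_law d L m)) / 2"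
      by (simp add: N_def)
  qed
qed

lemma ennreal_half_double: "(ennreal x + ennreal x) / 2 = ennreal x" if "0 \<le> x"
proof -
  have "(ennreal x + ennreal x) / 2 = ennreal (x + x) / ennreal 2"
    using that by (simp flip: ennreal_plus)
  also have "\<dots> = ennreal x" using that by (subst divide_ennreal) auto
  finally show ?thesis .
qed

text \<open>The two components have the same second moment about 0 in each coordinate, hence so does
  the mixture, and this number serves as variance proxy. Adding \<open>\<eta>\<close> keeps the
  proxy positive for a degenerate coordinate, since weights proportional to the proxies must not
  vanish.\<close>

lemma subgaussian_law_sym_mixture:
  assumes \<eta>: "0 < \<eta>"
  shows "subgaussian_law (sym_mixture d m S) d (\<lambda>k. moment (sym_mixture d m S) k k + \<eta>)"
proof -
  obtain L where sets: "sets (sym_mixture d m S) = sets (\<Pi>\<^sub>M i\<in>{..<d}. borel)"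
    and prob: "prob_space (sym_mixture d m S)"
    and nn: "\<And>f. f \<in> borel_measurable (\<Pi>\<^sub>M i\<in>{..<d}. borel) \<Longrightarrow>
      (\<integral>\<^sup>+x. f x \<partial>sym_mixture d m S)
        = ((\<integral>\<^sup>+x. f x \<partial>affine_law d L (\<lambda>i. - m i)) + (\<integral>\<^sup>+x. f x \<partial>affine_law d L m)) / 2"
    using sym_mixture_props[of d m S] by metis
  define P where "P = sym_mixture d m S"
  interpret P: prob_space P using prob by (simp add: P_def)
  define v where "v = (\<lambda>k. m k * m k + gram d L k k)"
  have v0: "0 \<le> v k" for k by (auto simp: v_def gram_def intro!: add_nonneg_nonneg sum_nonneg)
  have bm: "(\<lambda>x. x k) \<in> borel_measurable (\<Pi>\<^sub>M i\<in>{..<d}. borel)" if "k < d" for k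
    by (rule measurable_component_singleton) (use that in simp)
  have mom: "moment P k k = v k" if k: "k < d" for k
  proof -
    have aff: "(\<integral>\<^sup>+x. ennreal (x k * x k) \<partial>affine_law d L \<mu>) = ennreal (\<mu> k * \<mu> k + gram d L k k)" for \<mu>
    proof -
      interpret A: l2_law "affine_law d L \<mu>" d by (rule l2_law_affine_law)
      have "(\<integral>\<^sup>+x. ennreal (x k * x k) \<partial>affine_law d L \<mu>) = ennreal (moment (affine_law d L \<mu>) k k)"
        unfolding moment_def using A.integrable_coords_mult[OF k k]
        by (rule nn_integral_eq_integral) simp
      then show ?thesis by (simp add: moment_affine_law k)
    qed
    have "(\<integral>\<^sup>+x. ennreal (x k * x k) \<partial>P) = ennreal (v k)"
    proof -
      note [measurable] = bm[OF k]
      have msq: "(\<lambda>x. ennreal (x k * x k)) \<in> borel_measurable (\<Pi>\<^sub>M i\<in>{..<d}. borel)" by measurable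
      have "(\<integral>\<^sup>+x. ennreal (x k * x k) \<partial>P) = (ennreal (v k) + ennreal (v k)) / 2"
        unfolding P_def nn[OF msq] aff by (simp add: v_def)
      then show ?thesis by (simp only: ennreal_half_double[OF v0])
    qed
    moreover have "(\<lambda>x. x k * x k) \<in> borel_measurable P"
      unfolding P_def measurable_cong_sets[OF sets refl] by (intro borel_measurable_times bm[OF k])
    ultimately show ?thesis
      unfolding moment_def using v0 by (subst integral_eq_nn_integral) auto
  qed
  have "subgaussian_law P d (\<lambda>k. moment P k k + \<eta>)"
  proof
    fix k assume k: "k < d"
    show "(\<lambda>x. x k) \<in> borel_measurable P"
      using bm[OF k] by (simp add: P_def measurable_cong_sets[OF sets refl])
    show "0 < moment P k k + \<eta>" using mom[OF k] v0[of k] \<eta> by simp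
    fix t
    have "(\<integral>\<^sup>+x. ennreal (cosh (t * x k)) \<partial>P) =
      ((\<integral>\<^sup>+x. ennreal (cosh (t * x k)) \<partial>affine_law d L (\<lambda>i. - m i)) + (\<integral>\<^sup>+x. ennreal (cosh (t * x k)) \<partial>affine_law d L m)) / 2"
      unfolding P_def
      by (intro nn measurable_compose[OF bm[OF k]] measurable_compose[OF _ measurable_ennreal]) measurable
    also have "\<dots> \<le> (ennreal (exp (t\<^sup>2 * v k / 2)) + ennreal (exp (t\<^sup>2 * v k / 2))) / 2"
      using affine_law_subgaussian[OF k, where t = t and \<Lambda> = L and \<mu> = m]
        affine_law_subgaussian[OF k, where t = t and \<Lambda> = L and \<mu> = "\<lambda>i. - m i"]
      by (intro divide_right_mono_ennreal add_mono) (auto simp: v_def)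
    also have "\<dots> = ennreal (exp (t\<^sup>2 * v k / 2))" by (rule ennreal_half_double) simp
    also have "\<dots> \<le> ennreal (exp (t\<^sup>2 * (moment P k k + \<eta>) / 2))"
      using \<eta> by (intro ennreal_leI) (simp add: mom[OF k] mult_left_mono)
    finally show "(\<integral>\<^sup>+x. ennreal (cosh (t * x k)) \<partial>P) \<le> ennreal (exp (t\<^sup>2 * (moment P k k + \<eta>) / 2))" .
  qed
  then show ?thesis by (simp add: P_def)
qed

lemma (in l2_law) second_moment_eq: "second_moment d P = (\<Sum>k<d. moment P k k)"
  unfolding second_moment_def norm2_sq moment_def unfolding power2_eq_square
  by (intro Bochner_Integration.integral_sum integrable_coords_mult) auto

lemma integral_snd_prob:
  fixes f :: "'b \<Rightarrow> real"
  assumes M: "prob_space M" and N: "prob_space N" and f: "f \<in> borel_measurable N"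
  shows "(\<integral>q. f (snd q) \<partial>(M \<Otimes>\<^sub>M N)) = (\<integral>z. f z \<partial>N)"
proof -
  interpret M: prob_space M by fact
  interpret N: prob_space N by fact
  interpret pair_prob_space M N ..
  have "distr (M \<Otimes>\<^sub>M N) N snd = N"
  proof (rule measure_eqI)
    fix A assume "A \<in> sets (distr (M \<Otimes>\<^sub>M N) N snd)"
    then have A: "A \<in> sets N" by simp
    have "snd -` A \<inter> space (M \<Otimes>\<^sub>M N) = space M \<times> A"
      using sets.sets_into_space[OF A] by (auto simp: space_pair_measure)
    then show "emeasure (distr (M \<Otimes>\<^sub>M N) N snd) A = emeasure N A"
      using A by (subst emeasure_distr) (auto simp: N.emeasure_pair_measure_Times M.emeasure_space_1)
  qed simp
  then have "(\<integral>z. f z \<partial>N) = (\<integral>z. f z \<partial>distr (M \<Otimes>\<^sub>M N) N snd)" by simp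
  also have "\<dots> = (\<integral>q. f (snd q) \<partial>(M \<Otimes>\<^sub>M N))"
    using f by (intro integral_distr) auto
  finally show ?thesis by simp
qed

text \<open>The sign is almost surely \<open>-1\<close> or \<open>1\<close>, and evenness removes
  it. Evenness is phrased on indices below \<open>d\<close> because the restricted functions are
  \<open>undefined\<close> elsewhere.\<close>

lemma integral_generator_even:
  fixes f :: "rvec \<Rightarrow> real"
  assumes f: "f \<in> borel_measurable (affine_law d \<Lambda> \<mu>)"
    and even: "\<And>x y. (\<forall>i<d. y i = - x i) \<Longrightarrow> f y = f x" and coords: "\<And>x y. (\<forall>i<d. y i = x i) \<Longrightarrow> f y = f x"
  shows "(\<integral>q. f (generator d \<Lambda> \<mu> q) \<partial>gen_noise d) = (\<integral>x. f x \<partial>affine_law d \<Lambda> \<mu>)"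
proof -
  interpret R: prob_space random_sign unfolding random_sign_def by (rule prob_space_measure_pmf)
  interpret Z: prob_space "std_gaussian d" by (rule prob_space_std_gaussian)
  interpret RZ: pair_prob_space random_sign "std_gaussian d" ..
  have f': "f \<in> borel_measurable (\<Pi>\<^sub>M i\<in>{..<d}. borel)" using f by (simp add: measurable_affine_law)
  have gm: "generator d \<Lambda> \<mu> \<in> measurable (gen_noise d) (\<Pi>\<^sub>M i\<in>{..<d}. borel)"
  proof -
    have fstm: "fst \<in> borel_measurable (random_sign \<Otimes>\<^sub>M std_gaussian d)"
      by (rule measurable_compose[OF measurable_fst, of "\<lambda>x. x", simplified]) (simp add: random_sign_def)
    have "(\<lambda>q. (\<lambda>i\<in>{..<d}. fst q * (mat_vec d \<Lambda> (snd q) i + \<mu> i))) \<in> measurable (random_sign \<Otimes>\<^sub>M std_gaussian d) (\<Pi>\<^sub>M i\<in>{..<d}. borel)"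
      unfolding mat_vec_def
      by (intro measurable_restrict borel_measurable_times borel_measurable_add borel_measurable_sum
         borel_measurable_const fstm measurable_compose[OF measurable_snd coord_measurable_std_gaussian]) auto
    then show ?thesis unfolding generator_def gen_noise_def case_prod_beta' .
  qed
  have am: "(\<lambda>q. f (affine_map d \<Lambda> \<mu> (snd q))) \<in> borel_measurable (gen_noise d)"
    unfolding gen_noise_def by (intro measurable_compose[OF measurable_snd] measurable_compose[OF affine_map_measurable] f')
  have AE: "AE q in random_sign \<Otimes>\<^sub>M std_gaussian d. fst q \<in> {-1, 1}"
  proof (rule RZ.AE_pair_measure)
    have "fst -` {-1, 1} \<inter> space (random_sign \<Otimes>\<^sub>M std_gaussian d) \<in> sets (random_sign \<Otimes>\<^sub>M std_gaussian d)"
      by (rule measurable_sets[OF measurable_fst]) (simp add: random_sign_def)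
    then show "{x \<in> space (random_sign \<Otimes>\<^sub>M std_gaussian d). fst x \<in> {-1, 1}} \<in> sets (random_sign \<Otimes>\<^sub>M std_gaussian d)"
      by (simp add: vimage_def Int_def conj_commute)
    show "AE x in random_sign. AE y in std_gaussian d. fst (x, y) \<in> {-1, 1}"
      unfolding random_sign_def by (simp add: AE_measure_pmf_iff)
  qed
  have "(\<integral>q. f (generator d \<Lambda> \<mu> q) \<partial>gen_noise d) = (\<integral>q. f (affine_map d \<Lambda> \<mu> (snd q)) \<partial>gen_noise d)"
  proof (rule integral_cong_AE)
    show "(\<lambda>q. f (generator d \<Lambda> \<mu> q)) \<in> borel_measurable (gen_noise d)"
      by (rule measurable_compose[OF gm f'])
    show "AE q in gen_noise d. f (generator d \<Lambda> \<mu> q) = f (affine_map d \<Lambda> \<mu> (snd q))"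
      unfolding gen_noise_def using AE
    proof eventually_elim
      case (elim q)
      then consider "fst q = -1" | "fst q = 1" by auto
      then show ?case
      proof cases
        case 1
        then show ?thesis by (intro even) (auto simp: generator_def affine_map_def case_prod_beta')
      next
        case 2
        then show ?thesis by (intro coords) (auto simp: generator_def affine_map_def case_prod_beta')
      qed
    qed
  qed (rule am)
  also have "\<dots> = (\<integral>z. f (affine_map d \<Lambda> \<mu> z) \<partial>std_gaussian d)"
    unfolding gen_noise_def
    by (intro integral_snd_prob R.prob_space_axioms Z.prob_space_axioms measurable_compose[OF affine_map_measurable f'])
  also have "\<dots> = (\<integral>x. f x \<partial>affine_law d \<Lambda> \<mu>)"
    by (rule integral_affine_law[OF f, symmetric])
  finally show ?thesis .
qed

subsection \<open>The value of the game\<close>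

lemma frobenius_norm_nonneg [simp]: "0 \<le> frobenius_norm d A"
  by (simp add: frobenius_norm_def L2_set_nonneg)

lemma frobenius_norm_sq: "(frobenius_norm d A)\<^sup>2 = (\<Sum>i<d. \<Sum>j<d. (A i j)\<^sup>2)"
  by (simp add: frobenius_norm_def L2_set_def sum_nonneg sum.cartesian_product case_prod_beta')

lemma sum_mult_le_frobenius:
  "\<bar>\<Sum>i<d. \<Sum>j<d. A i j * B i j\<bar> \<le> frobenius_norm d A * frobenius_norm d B"
proof -
  have "\<bar>\<Sum>i<d. \<Sum>j<d. A i j * B i j\<bar> \<le> (\<Sum>(i, j)\<in>{..<d} \<times> {..<d}. \<bar>A i j\<bar> * \<bar>B i j\<bar>)"
    unfolding sum.cartesian_product
    by (rule order_trans[OF sum_abs]) (simp add: case_prod_beta' abs_mult)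
  also have "\<dots> \<le> frobenius_norm d A * frobenius_norm d B"
    unfolding frobenius_norm_def
    using L2_set_mult_ineq[of "case_prod A" "case_prod B" "{..<d} \<times> {..<d}"]
    by (simp add: case_prod_beta')
  finally show ?thesis .
qed

lemma frobenius_norm_outer: "frobenius_norm d (\<lambda>i j. u i * v j) = norm2 d u * norm2 d v"
proof -
  have "(frobenius_norm d (\<lambda>i j. u i * v j))\<^sup>2 = (norm2 d u * norm2 d v)\<^sup>2"
    by (simp add: frobenius_norm_sq power_mult_distrib norm2_sq sum_product)
  then show ?thesis by (simp add: power2_eq_iff_nonneg)
qed

lemma frobenius_norm_scale: "frobenius_norm d (\<lambda>i j. c * A i j) = \<bar>c\<bar> * frobenius_norm d A"
proof -
  have "(frobenius_norm d (\<lambda>i j. c * A i j))\<^sup>2 = (\<bar>c\<bar> * frobenius_norm d A)\<^sup>2"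
    by (simp add: frobenius_norm_sq power_mult_distrib sum_distrib_left)
  then show ?thesis by (simp add: power2_eq_iff_nonneg)
qed

lemma frobenius_norm_triangle:
  "frobenius_norm d (\<lambda>i j. A i j + B i j) \<le> frobenius_norm d A + frobenius_norm d B"
  unfolding frobenius_norm_def
  using L2_set_triangle_ineq[of "case_prod A" "case_prod B" "{..<d} \<times> {..<d}"]
  by (simp add: case_prod_beta')

lemma frobenius_norm_triangle_diff:
  "frobenius_norm d (\<lambda>i j. A i j - B i j) \<le> frobenius_norm d A + frobenius_norm d B"
  using frobenius_norm_triangle[of d A "\<lambda>i j. - 1 * B i j"] frobenius_norm_scale[of d "-1" B] by simp

lemma quad_form_eq_bilin: "quad_form d A x = bilin d A x x"
  by (simp add: quad_form_def inner_prod_def mat_vec_def bilin_def sum_distrib_left mult_ac)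

lemma inner_prod_mat_vec: "inner_prod d (mat_vec d A y) x = bilin d A x y"
  by (simp add: inner_prod_def mat_vec_def bilin_def sum_distrib_left sum_distrib_right mult_ac)

lemma bilin_le: "\<bar>bilin d A x y\<bar> \<le> frobenius_norm d A * (norm2 d x * norm2 d y)"
  unfolding bilin_def using sum_mult_le_frobenius[of A "\<lambda>i j. x i * y j" d] by (simp add: frobenius_norm_outer)

lemma bilin_add_left: "bilin d A (\<lambda>i. x i + y i) z = bilin d A x z + bilin d A y z"
  by (simp add: bilin_def algebra_simps sum.distrib)

lemma bilin_add_right: "bilin d A z (\<lambda>i. x i + y i) = bilin d A z x + bilin d A z y"
  by (simp add: bilin_def algebra_simps sum.distrib)

lemma bilin_diff_matrix: "bilin d (\<lambda>i j. A i j - B i j) x y = bilin d A x y - bilin d B x y"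
  by (simp add: bilin_def algebra_simps sum_subtractf)

lemma bilin_sym:
  assumes "\<And>i j. i < d \<Longrightarrow> j < d \<Longrightarrow> A i j = A j i"
  shows "bilin d A x y = bilin d A y x"
proof -
  have "bilin d A x y = (\<Sum>j<d. \<Sum>i<d. A i j * (x i * y j))"
    unfolding bilin_def by (rule sum.swap)
  also have "\<dots> = bilin d A y x"
    unfolding bilin_def using assms by (intro sum.cong refl) (auto simp: mult_ac)
  finally show ?thesis .
qed

lemma norm2_mat_vec_le: "norm2 d (mat_vec d A x) \<le> frobenius_norm d A * norm2 d x"
proof (rule norm2_le_if_inner_prod_le)
  fix u assume u: "norm2 d u \<le> 1"
  have "inner_prod d u (mat_vec d A x) = bilin d A u x"
    by (simp add: inner_prod_def mat_vec_def bilin_def sum_distrib_left mult_ac)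
  also have "\<dots> \<le> frobenius_norm d A * (norm2 d u * norm2 d x)"
    using bilin_le[of d A u x] by simp
  also have "\<dots> \<le> frobenius_norm d A * (1 * norm2 d x)"
    using u by (intro mult_left_mono mult_right_mono) auto
  finally show "inner_prod d u (mat_vec d A x) \<le> frobenius_norm d A * norm2 d x" by simp
qed simp

section \<open>The reduced discriminator and its increments\<close>

definition disc :: "nat \<Rightarrow> rmat \<Rightarrow> rvec \<Rightarrow> rvec \<Rightarrow> rvec \<Rightarrow> real" where
  "disc d A b c x = quad_form d A x / 2 + logcosh (inner_prod d b x) - logcosh (inner_prod d c x)"

text \<open>The gradient in \<open>x\<close> for symmetric \<open>A\<close>; for a general matrix
  the first term would be that of its symmetric part.\<close>

definition grad_disc :: "nat \<Rightarrow> rmat \<Rightarrow> rvec \<Rightarrow> rvec \<Rightarrow> rvec \<Rightarrow> rvec" where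
  "grad_disc d A b c x = (\<lambda>i. mat_vec d A x i + b i * tanh (inner_prod d b x) - c i * tanh (inner_prod d c x))"

lemma discriminator_eq_disc:
  assumes "\<forall>i<d. b1 i = - b2 i" "\<forall>i<d. b3 i = - b4 i"
  shows "discriminator d A b1 b2 b3 b4 x = disc d A b1 b3 x"
proof -
  have "inner_prod d b2 x = - inner_prod d b1 x" "inner_prod d b4 x = - inner_prod d b3 x"
    using assms by (simp_all add: inner_prod_def sum_negf)
  moreover have "exp s + exp (- s) = 2 * cosh s" for s :: real by (simp add: cosh_def)
  ultimately show ?thesis
    by (simp add: discriminator_def disc_def logcosh_def ln_div)
qed

lemma disc_cong: "(\<And>i. i < d \<Longrightarrow> x i = y i) \<Longrightarrow> disc d A b c x = disc d A b c y"
  by (simp add: disc_def quad_form_eq_bilin bilin_def inner_prod_def)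

lemma disc_minus: "disc d A b c (\<lambda>i. - x i) = disc d A b c x"
proof -
  have "inner_prod d u (\<lambda>i. - x i) = - inner_prod d u x" for u by (simp add: inner_prod_def sum_negf)
  then show ?thesis by (simp add: disc_def quad_form_eq_bilin bilin_def)
qed

lemma abs_half_add_diff_le:
  fixes X Y Z :: real
  assumes "\<bar>X\<bar> / 2 \<le> p" "\<bar>Y\<bar> \<le> q" "\<bar>Z\<bar> \<le> r"
  shows "\<bar>X / 2 + Y - Z\<bar> \<le> p + q + r"
  using assms by linarith

lemma disc_Taylor:
  assumes "\<And>i j. i < d \<Longrightarrow> j < d \<Longrightarrow> A i j = A j i"
  shows "\<bar>disc d A b c (\<lambda>i. x i + k i) - disc d A b c x - inner_prod d (grad_disc d A b c x) k\<bar>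
    \<le> (frobenius_norm d A + (norm2 d b)\<^sup>2 + (norm2 d c)\<^sup>2) * (norm2 d k)\<^sup>2"
proof -
  have ip: "inner_prod d u (\<lambda>i. x i + k i) = inner_prod d u x + inner_prod d u k" for u
    by (simp add: inner_prod_def algebra_simps sum.distrib)
  have q: "quad_form d A (\<lambda>i. x i + k i) = quad_form d A x + 2 * bilin d A k x + bilin d A k k"
    using bilin_sym[of d A x k, OF assms] by (simp add: quad_form_eq_bilin bilin_add_left bilin_add_right)
  have g: "inner_prod d (grad_disc d A b c x) k = bilin d A k x + inner_prod d b k * tanh (inner_prod d b x)
      - inner_prod d c k * tanh (inner_prod d c x)"
  proof -
    have "inner_prod d (grad_disc d A b c x) k = inner_prod d (mat_vec d A x) k
       + inner_prod d b k * tanh (inner_prod d b x) - inner_prod d c k * tanh (inner_prod d c x)"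
      by (simp add: grad_disc_def inner_prod_def algebra_simps sum.distrib sum_subtractf sum_distrib_left sum_distrib_right)
    then show ?thesis by (simp add: inner_prod_mat_vec)
  qed
  have sq: "(inner_prod d u k)\<^sup>2 \<le> (norm2 d u)\<^sup>2 * (norm2 d k)\<^sup>2" for u
    using power_mono[OF abs_inner_prod_le[of d u k], of 2] by (simp add: power_mult_distrib)
  have 1: "\<bar>bilin d A k k\<bar> \<le> frobenius_norm d A * (norm2 d k)\<^sup>2"
    using bilin_le[of d A k k] by (simp add: power2_eq_square)
  have 2: "\<bar>logcosh (inner_prod d u x + inner_prod d u k) - logcosh (inner_prod d u x) - inner_prod d u k * tanh (inner_prod d u x)\<bar>
      \<le> (norm2 d u)\<^sup>2 * (norm2 d k)\<^sup>2" for u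
    using logcosh_Taylor sq by (rule order_trans)
  have "disc d A b c (\<lambda>i. x i + k i) - disc d A b c x - inner_prod d (grad_disc d A b c x) k
     = bilin d A k k / 2
      + (logcosh (inner_prod d b x + inner_prod d b k) - logcosh (inner_prod d b x) - inner_prod d b k * tanh (inner_prod d b x))
      - (logcosh (inner_prod d c x + inner_prod d c k) - logcosh (inner_prod d c x) - inner_prod d c k * tanh (inner_prod d c x))"
    unfolding disc_def ip q g by (simp add: field_simps)
  moreover have "\<bar>bilin d A k k\<bar> / 2 \<le> frobenius_norm d A * (norm2 d k)\<^sup>2" using 1 by linarith
  ultimately show ?thesis
    unfolding distrib_right by (simp only:) (intro abs_half_add_diff_le 2)
qed

text \<open>Bounds how much the effect of moving the point by \<open>k\<close> depends on the
  discriminator. The bound is linear in the distance of the discriminators and vanishes with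
  \<open>k\<close>, so quadratic growth at a maximiser can absorb it to second order.\<close>

lemma disc_mixed_difference:
  "\<bar>(disc d A' b' c' (\<lambda>i. x i + k i) - disc d A' b' c' x) - (disc d A b c (\<lambda>i. x i + k i) - disc d A b c x)\<bar>
    \<le> frobenius_norm d (\<lambda>i j. A' i j - A i j) * (norm2 d x * norm2 d k + (norm2 d k)\<^sup>2)
      + norm2 d (\<lambda>i. b' i - b i) * (norm2 d k + norm2 d b * (norm2 d x * norm2 d k))
      + norm2 d (\<lambda>i. c' i - c i) * (norm2 d k + norm2 d c * (norm2 d x * norm2 d k))"
proof -
  have ip: "inner_prod d u (\<lambda>i. x i + k i) = inner_prod d u x + inner_prod d u k" for u
    by (simp add: inner_prod_def algebra_simps sum.distrib)
  define E where "E = (\<lambda>i j. A' i j - A i j)"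
  have q: "(quad_form d A' (\<lambda>i. x i + k i) - quad_form d A' x) - (quad_form d A (\<lambda>i. x i + k i) - quad_form d A x)
      = bilin d E x k + bilin d E k x + bilin d E k k"
    by (simp add: E_def quad_form_eq_bilin bilin_add_left bilin_add_right bilin_diff_matrix)
  have 1: "\<bar>bilin d E x k + bilin d E k x + bilin d E k k\<bar> / 2
      \<le> frobenius_norm d E * (norm2 d x * norm2 d k + (norm2 d k)\<^sup>2)"
  proof -
    have "\<bar>bilin d E x k\<bar> \<le> frobenius_norm d E * (norm2 d x * norm2 d k)"
      "\<bar>bilin d E k x\<bar> \<le> frobenius_norm d E * (norm2 d x * norm2 d k)"
      "\<bar>bilin d E k k\<bar> \<le> frobenius_norm d E * (norm2 d k)\<^sup>2"
      using bilin_le[of d E x k] bilin_le[of d E k x] bilin_le[of d E k k]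
      by (simp_all add: power2_eq_square mult.commute)
    then show ?thesis by (simp add: distrib_left)
  qed
  have 2: "\<bar>(logcosh (inner_prod d u' x + inner_prod d u' k) - logcosh (inner_prod d u' x))
      - (logcosh (inner_prod d u x + inner_prod d u k) - logcosh (inner_prod d u x))\<bar>
     \<le> norm2 d (\<lambda>i. u' i - u i) * (norm2 d k + norm2 d u * (norm2 d x * norm2 d k))" for u' u
  proof -
    define e where "e = (\<lambda>i. u' i - u i)"
    have e: "inner_prod d u' y = inner_prod d u y + inner_prod d e y" for y
      by (simp add: e_def inner_prod_diff)
    have "\<bar>(logcosh (inner_prod d u' x + inner_prod d u' k) - logcosh (inner_prod d u' x))
      - (logcosh (inner_prod d u x + inner_prod d u k) - logcosh (inner_prod d u x))\<bar>
      \<le> \<bar>inner_prod d e k\<bar> + \<bar>inner_prod d e x\<bar> * \<bar>inner_prod d u k\<bar>"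
      using logcosh_four_point[of "inner_prod d u x" "inner_prod d e x" "inner_prod d u k" "inner_prod d e k"]
      by (simp add: e algebra_simps)
    also have "\<dots> \<le> norm2 d e * norm2 d k + (norm2 d e * norm2 d x) * (norm2 d u * norm2 d k)"
      by (intro add_mono mult_mono abs_inner_prod_le) auto
    finally show ?thesis by (simp add: e_def algebra_simps)
  qed
  have eq: "(disc d A' b' c' (\<lambda>i. x i + k i) - disc d A' b' c' x) - (disc d A b c (\<lambda>i. x i + k i) - disc d A b c x)
    = (bilin d E x k + bilin d E k x + bilin d E k k) / 2
      + ((logcosh (inner_prod d b' x + inner_prod d b' k) - logcosh (inner_prod d b' x))
        - (logcosh (inner_prod d b x + inner_prod d b k) - logcosh (inner_prod d b x)))
      - ((logcosh (inner_prod d c' x + inner_prod d c' k) - logcosh (inner_prod d c' x))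
        - (logcosh (inner_prod d c x + inner_prod d c k) - logcosh (inner_prod d c x)))"
    using q by (simp add: disc_def ip diff_divide_distrib)
  show ?thesis
    unfolding eq using 1 unfolding E_def by (intro abs_half_add_diff_le 2)
qed

lemma (in l2_law) expectation_disc:
  "integrable P (disc d A b c)"
  "expectation (disc d A b c) = (\<Sum>i<d. \<Sum>j<d. A i j * moment P i j) / 2 + avg_logcosh d P b - avg_logcosh d P c"
proof -
  have q: "integrable P (quad_form d A)" and
    q2: "expectation (quad_form d A) = (\<Sum>i<d. \<Sum>j<d. A i j * moment P i j)"
    unfolding quad_form_eq_bilin by (rule expectation_bilin)+
  note lb = integrable_logcosh[of b] and lc = integrable_logcosh[of c]
  show "integrable P (disc d A b c)"
    unfolding disc_def using q lb lc by (intro Bochner_Integration.integrable_add Bochner_Integration.integrable_diff) auto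
  show "expectation (disc d A b c) = (\<Sum>i<d. \<Sum>j<d. A i j * moment P i j) / 2 + avg_logcosh d P b - avg_logcosh d P c"
    unfolding disc_def using q lb lc by (simp add: q2 avg_logcosh_def)
qed

text \<open>The value with both laws explicit, \<open>P\<close> for the data and \<open>Q\<close>
  for the generator. The two factors 2 arise because the vectors of an opposite pair have equal
  penalties.\<close>

definition gan_value where
  "gan_value d lam w P Q A b c =
     (\<integral>x. disc d A b c x \<partial>P) - (\<integral>x. disc d A b c x \<partial>Q)
     - lam / 2 * ((frobenius_norm d A)\<^sup>2 + 2 * (norm2 d (\<lambda>i. b i - w i))\<^sup>2 + 2 * (norm2 d (\<lambda>i. c i - w i))\<^sup>2)"

lemma gan_objective_eq_gan_value:
  assumes "\<forall>i<d. b1 i = - b2 i" "\<forall>i<d. b3 i = - b4 i"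
  shows "gan_objective d lam w P \<Lambda> \<mu> A b1 b2 b3 b4 = gan_value d lam w P (affine_law d \<Lambda> \<mu>) A b1 b3"
proof -
  interpret Q: l2_law "affine_law d \<Lambda> \<mu>" d by (rule l2_law_affine_law)
  have D: "discriminator d A b1 b2 b3 b4 = disc d A b1 b3"
    using discriminator_eq_disc[OF assms] by blast
  have "(\<integral>q. disc d A b1 b3 (generator d \<Lambda> \<mu> q) \<partial>gen_noise d) = (\<integral>x. disc d A b1 b3 x \<partial>affine_law d \<Lambda> \<mu>)"
  proof (rule integral_generator_even)
    show "disc d A b1 b3 \<in> borel_measurable (affine_law d \<Lambda> \<mu>)"
      using Q.expectation_disc(1) by (rule borel_measurable_integrable)
    show "disc d A b1 b3 y = disc d A b1 b3 x" if "\<forall>i<d. y i = - x i" for x y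
      using that disc_cong[of d y "\<lambda>i. - x i"] disc_minus by simp
    show "disc d A b1 b3 y = disc d A b1 b3 x" if "\<forall>i<d. y i = x i" for x y
      using that by (intro disc_cong) simp
  qed
  moreover have "norm2 d (\<lambda>i. b2 i + w i) = norm2 d (\<lambda>i. b1 i - w i)" "norm2 d (\<lambda>i. b4 i + w i) = norm2 d (\<lambda>i. b3 i - w i)"
    using assms unfolding norm2_def L2_set_def
    by (auto intro!: arg_cong[where f = sqrt] sum.cong simp: power2_eq_square algebra_simps)
  ultimately show ?thesis
    by (simp add: gan_objective_def gan_value_def regularizer_def D)
qed

lemma gan_loss_eq_SUP:
  "gan_loss d lam w P \<Lambda> \<mu> = (SUP (A, b, c). gan_value d lam w P (affine_law d \<Lambda> \<mu>) A b c)"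
proof -
  have "(\<lambda>(A, b1, b2, b3, b4). gan_objective d lam w P \<Lambda> \<mu> A b1 b2 b3 b4) `
      {(A, b1, b2, b3, b4). (\<forall>i<d. b1 i = - b2 i) \<and> (\<forall>i<d. b3 i = - b4 i)}
    = range (\<lambda>(A, b, c). gan_value d lam w P (affine_law d \<Lambda> \<mu>) A b c)" (is "?L = ?R")
  proof
    show "?L \<subseteq> ?R"
    proof
      fix v assume "v \<in> ?L"
      then obtain A b1 b2 b3 b4 where "(\<forall>i<d. b1 i = - b2 i)" "(\<forall>i<d. b3 i = - b4 i)"
        "v = gan_objective d lam w P \<Lambda> \<mu> A b1 b2 b3 b4" by auto
      then have "v = (\<lambda>(A, b, c). gan_value d lam w P (affine_law d \<Lambda> \<mu>) A b c) (A, b1, b3)"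
        by (simp add: gan_objective_eq_gan_value)
      then show "v \<in> ?R" by (rule range_eqI)
    qed
    show "?R \<subseteq> ?L"
    proof
      fix v assume "v \<in> ?R"
      then obtain A b c where v: "v = gan_value d lam w P (affine_law d \<Lambda> \<mu>) A b c" by auto
      have "v = gan_objective d lam w P \<Lambda> \<mu> A b (\<lambda>i. - b i) c (\<lambda>i. - c i)"
        unfolding v by (rule gan_objective_eq_gan_value[symmetric]) auto
      then show "v \<in> ?L" by (intro image_eqI[of _ _ "(A, b, \<lambda>i. - b i, c, \<lambda>i. - c i)"]) auto
    qed
  qed
  then show ?thesis unfolding gan_loss_def by simp
qed

text \<open>One problem for both vectors: the second one is obtained by exchanging \<open>P\<close>
  and \<open>Q\<close>. The coefficient is \<open>lam\<close>, as each opposite pair is penalised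
  twice with \<open>lam / 2\<close>.\<close>

definition penalized :: "nat \<Rightarrow> real \<Rightarrow> rvec \<Rightarrow> rvec measure \<Rightarrow> rvec measure \<Rightarrow> rvec \<Rightarrow> real" where
  "penalized d lam w P Q b = avg_logcosh d P b - avg_logcosh d Q b - lam * (norm2 d (\<lambda>i. b i - w i))\<^sup>2"

definition strong_argmax :: "nat \<Rightarrow> real \<Rightarrow> rvec \<Rightarrow> rvec measure \<Rightarrow> rvec measure \<Rightarrow> rvec \<Rightarrow> bool" where
  "strong_argmax d lam w P Q b \<longleftrightarrow>
     (\<forall>b'. penalized d lam w P Q b' \<le> penalized d lam w P Q b - lam / 8 * (norm2 d (\<lambda>i. b' i - b i))\<^sup>2)"

text \<open>The exact maximiser of the part of the value that depends on \<open>A\<close>, a linear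
  term minus \<open>lam / 2\<close> times the squared Frobenius norm.\<close>

definition opt_matrix :: "real \<Rightarrow> rvec measure \<Rightarrow> rvec measure \<Rightarrow> rmat" where
  "opt_matrix lam P Q = (\<lambda>i j. (moment P i j - moment Q i j) / (2 * lam))"

lemma gan_value_split:
  assumes "l2_law P d" "l2_law Q d"
  shows "gan_value d lam w P Q A b c =
    (\<Sum>i<d. \<Sum>j<d. A i j * (moment P i j - moment Q i j)) / 2 - lam / 2 * (frobenius_norm d A)\<^sup>2
    + penalized d lam w P Q b + penalized d lam w Q P c"
  unfolding gan_value_def l2_law.expectation_disc(2)[OF assms(1)] l2_law.expectation_disc(2)[OF assms(2)]
  by (simp add: penalized_def right_diff_distrib sum_subtractf field_simps)

text \<open>For the matrix, completing the square gives growth with constant \<open>lam / 2\<close>;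
  it is weakened to the constant \<open>lam / 8\<close> available for the two vectors.\<close>

lemma gan_value_le:
  assumes PQ: "l2_law P d" "l2_law Q d" and lam: "0 < lam"
    and b: "strong_argmax d lam w P Q b" and c: "strong_argmax d lam w Q P c"
  shows "gan_value d lam w P Q A' b' c' \<le> gan_value d lam w P Q (opt_matrix lam P Q) b c
    - lam / 8 * ((frobenius_norm d (\<lambda>i j. A' i j - opt_matrix lam P Q i j))\<^sup>2
        + (norm2 d (\<lambda>i. b' i - b i))\<^sup>2 + (norm2 d (\<lambda>i. c' i - c i))\<^sup>2)"
proof -
  define A where "A = opt_matrix lam P Q"
  have M: "moment P i j - moment Q i j = 2 * lam * A i j" for i j
    using lam by (simp add: A_def opt_matrix_def)
  have mat: "(\<Sum>i<d. \<Sum>j<d. B i j * (moment P i j - moment Q i j)) / 2 - lam / 2 * (frobenius_norm d B)\<^sup>2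
     = lam / 2 * (\<Sum>i<d. \<Sum>j<d. 2 * (B i j * A i j) - (B i j)\<^sup>2)" for B
    unfolding M frobenius_norm_sq
    by (simp add: sum_subtractf sum_distrib_left right_diff_distrib mult_ac sum_divide_distrib)
  have "lam / 2 * (\<Sum>i<d. \<Sum>j<d. 2 * (A' i j * A i j) - (A' i j)\<^sup>2)
      = lam / 2 * (\<Sum>i<d. \<Sum>j<d. 2 * (A i j * A i j) - (A i j)\<^sup>2) - lam / 2 * (frobenius_norm d (\<lambda>i j. A' i j - A i j))\<^sup>2"
    unfolding frobenius_norm_sq right_diff_distrib[symmetric] sum_subtractf[symmetric]
    by (intro arg_cong[where f = "\<lambda>x. lam / 2 * x"] sum.cong refl) (simp add: power2_eq_square algebra_simps)
  moreover have "lam / 8 * (frobenius_norm d (\<lambda>i j. A' i j - A i j))\<^sup>2 \<le> lam / 2 * (frobenius_norm d (\<lambda>i j. A' i j - A i j))\<^sup>2"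
    using lam by (intro mult_right_mono) auto
  moreover have "penalized d lam w P Q b' \<le> penalized d lam w P Q b - lam / 8 * (norm2 d (\<lambda>i. b' i - b i))\<^sup>2"
    "penalized d lam w Q P c' \<le> penalized d lam w Q P c - lam / 8 * (norm2 d (\<lambda>i. c' i - c i))\<^sup>2"
    using b c unfolding strong_argmax_def by blast+
  ultimately show ?thesis
    unfolding gan_value_split[OF PQ] mat A_def[symmetric] distrib_left by linarith
qed

lemma gan_loss_eq_gan_value:
  assumes PQ: "l2_law P d" and lam: "0 < lam"
    and b: "strong_argmax d lam w P (affine_law d \<Lambda> \<mu>) b" and c: "strong_argmax d lam w (affine_law d \<Lambda> \<mu>) P c"
  shows "gan_loss d lam w P \<Lambda> \<mu>
    = gan_value d lam w P (affine_law d \<Lambda> \<mu>) (opt_matrix lam P (affine_law d \<Lambda> \<mu>)) b c"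
proof -
  define Q where "Q = affine_law d \<Lambda> \<mu>"
  have "gan_value d lam w P Q A' b' c' \<le> gan_value d lam w P Q (opt_matrix lam P Q) b c" for A' b' c'
  proof -
    have "0 \<le> lam / 8 * ((frobenius_norm d (\<lambda>i j. A' i j - opt_matrix lam P Q i j))\<^sup>2
        + (norm2 d (\<lambda>i. b' i - b i))\<^sup>2 + (norm2 d (\<lambda>i. c' i - c i))\<^sup>2)"
      using lam by simp
    then show ?thesis
      using gan_value_le[OF PQ l2_law_affine_law lam b c, of A' b' c'] unfolding Q_def by linarith
  qed
  then show ?thesis
    unfolding gan_loss_eq_SUP Q_def[symmetric]
    by (intro cSup_eq_maximum) (auto intro!: range_eqI[of _ _ "(opt_matrix lam P Q, b, c)"])
qed

subsection \<open>Gradients of the loss\<close>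

text \<open>Separates the size of the parameters from the noise; the noise factor
  \<open>1 + norm2 d z\<close> has a finite second moment.\<close>

lemma norm2_affine_map_le:
  "norm2 d (affine_map d H h z) \<le> (norm2 d h + frobenius_norm d H) * (1 + norm2 d z)"
proof -
  have "norm2 d (affine_map d H h z) = norm2 d (\<lambda>i. mat_vec d H z i + h i)"
    by (simp add: norm2_def L2_set_def affine_map_def)
  also have "\<dots> \<le> frobenius_norm d H * norm2 d z + norm2 d h"
    using norm2_triangle[of d "mat_vec d H z" h] norm2_mat_vec_le[of d H z] by linarith
  also have "\<dots> \<le> (norm2 d h + frobenius_norm d H) * (1 + norm2 d z)"
    by (simp add: distrib_left distrib_right)
  finally show ?thesis .
qed

lemma integrable_sq_std_gaussian: "integrable (std_gaussian d) (\<lambda>z. (1 + norm2 d z)\<^sup>2)"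
proof -
  interpret Z: l2_law "std_gaussian d" d by (rule l2_law_std_gaussian)
  have sq: "integrable (std_gaussian d) (\<lambda>z. (norm2 d z)\<^sup>2)"
    unfolding norm2_sq using Z.coord_sq by auto
  have m: "norm2 d \<in> borel_measurable (std_gaussian d)"
    unfolding norm2_def L2_set_def
    by (intro borel_measurable_sqrt[THEN measurable_compose[rotated]] borel_measurable_sum borel_measurable_power
        Z.coord_measurable) auto
  have "integrable (std_gaussian d) (norm2 d)"
    using Z.square_integrable_imp_integrable[OF m sq] .
  then show ?thesis using sq by (simp add: power2_sum)
qed

lemma disc_affine_law:
  "integrable (std_gaussian d) (\<lambda>z. disc d A b c (affine_map d \<Lambda> \<mu> z))"
  "(\<integral>x. disc d A b c x \<partial>affine_law d \<Lambda> \<mu>) = (\<integral>z. disc d A b c (affine_map d \<Lambda> \<mu> z) \<partial>std_gaussian d)"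
proof -
  interpret Q: l2_law "affine_law d \<Lambda> \<mu>" d by (rule l2_law_affine_law)
  have int: "integrable (affine_law d \<Lambda> \<mu>) (disc d A b c)" by (rule Q.expectation_disc(1))
  then show "integrable (std_gaussian d) (\<lambda>z. disc d A b c (affine_map d \<Lambda> \<mu> z))"
    unfolding affine_law_def by (rule integrable_distr[OF affine_map_measurable])
  show "(\<integral>x. disc d A b c x \<partial>affine_law d \<Lambda> \<mu>) = (\<integral>z. disc d A b c (affine_map d \<Lambda> \<mu> z) \<partial>std_gaussian d)"
    using int by (intro integral_affine_law) auto
qed

lemma disc_affine_map_add:
  "disc d A b c (affine_map d (\<lambda>i j. \<Lambda> i j + H i j) (\<lambda>i. \<mu> i + h i) z)
    = disc d A b c (\<lambda>i. affine_map d \<Lambda> \<mu> z i + affine_map d H h z i)"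
  by (rule disc_cong) (simp add: affine_map_def mat_vec_def algebra_simps sum.distrib)

lemma norm2_grad_disc_le:
  "norm2 d (grad_disc d A b c x) \<le> frobenius_norm d A * norm2 d x + norm2 d b + norm2 d c"
proof -
  have t: "norm2 d (\<lambda>i. u i * tanh (inner_prod d u x)) \<le> norm2 d u" for u
  proof -
    have "norm2 d (\<lambda>i. tanh (inner_prod d u x) * u i) = \<bar>tanh (inner_prod d u x)\<bar> * norm2 d u"
      by (rule norm2_scale)
    also have "\<dots> \<le> 1 * norm2 d u" by (intro mult_right_mono abs_tanh_le_1) auto
    finally show ?thesis by (simp add: mult.commute)
  qed
  have "norm2 d (grad_disc d A b c x) \<le> norm2 d (\<lambda>i. mat_vec d A x i + b i * tanh (inner_prod d b x))
      + norm2 d (\<lambda>i. c i * tanh (inner_prod d c x))"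
    unfolding grad_disc_def by (rule norm2_triangle_diff)
  also have "\<dots> \<le> norm2 d (mat_vec d A x) + norm2 d (\<lambda>i. b i * tanh (inner_prod d b x)) + norm2 d c"
    using norm2_triangle[of d "mat_vec d A x" "\<lambda>i. b i * tanh (inner_prod d b x)"] t[of c] by linarith
  also have "\<dots> \<le> frobenius_norm d A * norm2 d x + norm2 d b + norm2 d c"
    using norm2_mat_vec_le[of d A x] t[of b] by linarith
  finally show ?thesis .
qed

lemma grad_disc_affine_measurable:
  assumes i: "i < d"
  shows "(\<lambda>z. grad_disc d A b c (affine_map d \<Lambda> \<mu> z) i) \<in> borel_measurable (std_gaussian d)"
proof -
  have coord: "(\<lambda>z. affine_map d \<Lambda> \<mu> z k) \<in> borel_measurable (std_gaussian d)" if "k < d" for k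
    by (rule measurable_compose[OF affine_map_measurable measurable_component_singleton]) (use that in simp)
  have [measurable]: "(\<lambda>z. inner_prod d u (affine_map d \<Lambda> \<mu> z)) \<in> borel_measurable (std_gaussian d)" for u
    unfolding inner_prod_def by (intro borel_measurable_sum borel_measurable_times borel_measurable_const coord) auto
  have [measurable]: "(\<lambda>z. mat_vec d A (affine_map d \<Lambda> \<mu> z) i) \<in> borel_measurable (std_gaussian d)"
    unfolding mat_vec_def by (intro borel_measurable_sum borel_measurable_times borel_measurable_const coord) auto
  show ?thesis unfolding grad_disc_def by measurable
qed

lemma integrable_grad_disc_affine:
  assumes i: "i < d"
  shows "integrable (std_gaussian d) (\<lambda>z. grad_disc d A b c (affine_map d \<Lambda> \<mu> z) i)" (is ?th1)
    "j < d \<Longrightarrow> integrable (std_gaussian d) (\<lambda>z. grad_disc d A b c (affine_map d \<Lambda> \<mu> z) i * z j)"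
proof -
  define C where "C = frobenius_norm d A * (norm2 d \<mu> + frobenius_norm d \<Lambda>) + norm2 d b + norm2 d c"
  have C: "0 \<le> C" by (simp add: C_def)
  have le: "\<bar>grad_disc d A b c (affine_map d \<Lambda> \<mu> z) i\<bar> \<le> C * (1 + norm2 d z)" for z
  proof -
    have "\<bar>grad_disc d A b c (affine_map d \<Lambda> \<mu> z) i\<bar> \<le> frobenius_norm d A * norm2 d (affine_map d \<Lambda> \<mu> z) + norm2 d b + norm2 d c"
      using abs_coord_le_norm2[OF i] norm2_grad_disc_le by (rule order_trans)
    also have "\<dots> \<le> frobenius_norm d A * ((norm2 d \<mu> + frobenius_norm d \<Lambda>) * (1 + norm2 d z))
       + norm2 d b * (1 + norm2 d z) + norm2 d c * (1 + norm2 d z)"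
      by (intro add_mono mult_left_mono norm2_affine_map_le) (auto simp: distrib_left)
    finally show ?thesis by (simp add: C_def distrib_right mult.assoc)
  qed
  note m = grad_disc_affine_measurable[OF i, of A b c \<Lambda> \<mu>]
  have int: "integrable (std_gaussian d) (\<lambda>z. C * (1 + norm2 d z)\<^sup>2)"
    using integrable_sq_std_gaussian by auto
  show ?th1
  proof (rule Bochner_Integration.integrable_bound[OF int m])
    have "\<bar>grad_disc d A b c (affine_map d \<Lambda> \<mu> z) i\<bar> \<le> C * (1 + norm2 d z)\<^sup>2" for z
    proof -
      have "1 + norm2 d z \<le> (1 + norm2 d z)\<^sup>2" by (simp add: power2_eq_square algebra_simps)
      then have "C * (1 + norm2 d z) \<le> C * (1 + norm2 d z)\<^sup>2" using C by (rule mult_left_mono)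
      then show ?thesis using le[of z] by linarith
    qed
    then show "AE z in std_gaussian d. norm (grad_disc d A b c (affine_map d \<Lambda> \<mu> z) i) \<le> norm (C * (1 + norm2 d z)\<^sup>2)"
      using C by simp
  qed
  assume j: "j < d"
  show "integrable (std_gaussian d) (\<lambda>z. grad_disc d A b c (affine_map d \<Lambda> \<mu> z) i * z j)"
  proof (rule Bochner_Integration.integrable_bound[OF int])
    show "(\<lambda>z. grad_disc d A b c (affine_map d \<Lambda> \<mu> z) i * z j) \<in> borel_measurable (std_gaussian d)"
      using m coord_measurable_std_gaussian[OF j] by measurable
    have "\<bar>grad_disc d A b c (affine_map d \<Lambda> \<mu> z) i * z j\<bar> \<le> C * (1 + norm2 d z)\<^sup>2" for z
    proof -
      have "\<bar>grad_disc d A b c (affine_map d \<Lambda> \<mu> z) i * z j\<bar> \<le> (C * (1 + norm2 d z)) * (1 + norm2 d z)"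
        unfolding abs_mult using abs_coord_le_norm2[OF j, of z] le[of z] by (intro mult_mono) auto
      then show ?thesis by (simp add: power2_eq_square mult.assoc)
    qed
    then show "AE z in std_gaussian d. norm (grad_disc d A b c (affine_map d \<Lambda> \<mu> z) i * z j) \<le> norm (C * (1 + norm2 d z)\<^sup>2)"
      using C by simp
  qed
qed

text \<open>The derivative with the discriminator frozen; the generator enters the value negatively,
  hence the sign.\<close>

definition grad_mu :: "nat \<Rightarrow> rmat \<Rightarrow> rvec \<Rightarrow> rmat \<Rightarrow> rvec \<Rightarrow> rvec \<Rightarrow> rvec" where
  "grad_mu d \<Lambda> \<mu> A b c i = - (\<integral>z. grad_disc d A b c (affine_map d \<Lambda> \<mu> z) i \<partial>std_gaussian d)"

definition grad_Lambda :: "nat \<Rightarrow> rmat \<Rightarrow> rvec \<Rightarrow> rmat \<Rightarrow> rvec \<Rightarrow> rvec \<Rightarrow> rmat" where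
  "grad_Lambda d \<Lambda> \<mu> A b c i j = - (\<integral>z. grad_disc d A b c (affine_map d \<Lambda> \<mu> z) i * z j \<partial>std_gaussian d)"

lemma expectation_grad_disc_inner_prod:
  "integrable (std_gaussian d) (\<lambda>z. inner_prod d (grad_disc d A b c (affine_map d \<Lambda> \<mu> z)) (affine_map d H h z))"
  "(\<integral>z. inner_prod d (grad_disc d A b c (affine_map d \<Lambda> \<mu> z)) (affine_map d H h z) \<partial>std_gaussian d)
    = - ((\<Sum>i<d. grad_mu d \<Lambda> \<mu> A b c i * h i) + (\<Sum>i<d. \<Sum>j<d. grad_Lambda d \<Lambda> \<mu> A b c i j * H i j))"
proof -
  define \<phi> where "\<phi> = (\<lambda>z. grad_disc d A b c (affine_map d \<Lambda> \<mu> z))"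
  have e: "inner_prod d (\<phi> z) (affine_map d H h z) = (\<Sum>i<d. h i * \<phi> z i + (\<Sum>j<d. H i j * (\<phi> z i * z j)))" for z
    unfolding inner_prod_def[of d "\<phi> z"]
    by (intro sum.cong refl) (simp add: affine_map_coord inner_prod_def distrib_left sum_distrib_left mult_ac)
  note int0 = integrable_grad_disc_affine[where d = d and A = A and b = b and c = c and \<Lambda> = \<Lambda> and \<mu> = \<mu>]
  have int: "integrable (std_gaussian d) (\<lambda>z. \<phi> z i)" "j < d \<Longrightarrow> integrable (std_gaussian d) (\<lambda>z. \<phi> z i * z j)"
    if "i < d" for i j using int0[OF that] by (simp_all add: \<phi>_def)
  have int2: "integrable (std_gaussian d) (\<lambda>z. h i * \<phi> z i + (\<Sum>j<d. H i j * (\<phi> z i * z j)))" if "i < d" for i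
    using that by (intro Bochner_Integration.integrable_add Bochner_Integration.integrable_sum integrable_mult_right int) auto
  have "integrable (std_gaussian d) (\<lambda>z. inner_prod d (\<phi> z) (affine_map d H h z))"
    unfolding e by (intro Bochner_Integration.integrable_sum int2) auto
  then show "integrable (std_gaussian d) (\<lambda>z. inner_prod d (grad_disc d A b c (affine_map d \<Lambda> \<mu> z)) (affine_map d H h z))"
    by (simp add: \<phi>_def)
  have "(\<integral>z. inner_prod d (\<phi> z) (affine_map d H h z) \<partial>std_gaussian d)
     = (\<Sum>i<d. \<integral>z. h i * \<phi> z i + (\<Sum>j<d. H i j * (\<phi> z i * z j)) \<partial>std_gaussian d)"
    unfolding e by (intro Bochner_Integration.integral_sum int2) auto
  also have "\<dots> = (\<Sum>i<d. h i * (\<integral>z. \<phi> z i \<partial>std_gaussian d) + (\<Sum>j<d. H i j * (\<integral>z. \<phi> z i * z j \<partial>std_gaussian d)))"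
  proof (intro sum.cong refl)
    fix i assume "i \<in> {..<d}"
    then have i: "i < d" by simp
    have "(\<integral>z. h i * \<phi> z i + (\<Sum>j<d. H i j * (\<phi> z i * z j)) \<partial>std_gaussian d)
       = (\<integral>z. h i * \<phi> z i \<partial>std_gaussian d) + (\<integral>z. (\<Sum>j<d. H i j * (\<phi> z i * z j)) \<partial>std_gaussian d)"
      using i by (intro Bochner_Integration.integral_add Bochner_Integration.integrable_sum integrable_mult_right int) auto
    also have "(\<integral>z. (\<Sum>j<d. H i j * (\<phi> z i * z j)) \<partial>std_gaussian d) = (\<Sum>j<d. \<integral>z. H i j * (\<phi> z i * z j) \<partial>std_gaussian d)"
      using i by (intro Bochner_Integration.integral_sum integrable_mult_right int) auto
    finally show "(\<integral>z. h i * \<phi> z i + (\<Sum>j<d. H i j * (\<phi> z i * z j)) \<partial>std_gaussian d)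
      = h i * (\<integral>z. \<phi> z i \<partial>std_gaussian d) + (\<Sum>j<d. H i j * (\<integral>z. \<phi> z i * z j \<partial>std_gaussian d))" by simp
  qed
  finally show "(\<integral>z. inner_prod d (grad_disc d A b c (affine_map d \<Lambda> \<mu> z)) (affine_map d H h z) \<partial>std_gaussian d)
    = - ((\<Sum>i<d. grad_mu d \<Lambda> \<mu> A b c i * h i) + (\<Sum>i<d. \<Sum>j<d. grad_Lambda d \<Lambda> \<mu> A b c i j * H i j))"
    by (simp add: \<phi>_def grad_mu_def grad_Lambda_def sum.distrib sum_negf mult.commute)
qed

lemma complete_square_bound:
  fixes lam x s :: real
  assumes "0 < lam"
  shows "x * s - lam / 8 * x\<^sup>2 \<le> 2 * s\<^sup>2 / lam"
proof -
  have "0 \<le> (lam * x - 4 * s)\<^sup>2 / (8 * lam)" using assms by simp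
  also have "\<dots> = lam / 8 * x\<^sup>2 - x * s + 2 * s\<^sup>2 / lam"
    using assms by (simp add: power2_eq_square field_simps)
  finally show ?thesis by simp
qed

text \<open>An envelope theorem: because the inner maximisation is strongly concave, freezing the
  maximiser changes the value only to second order in the perturbation.\<close>

lemma gan_loss_expansion:
  assumes P: "l2_law P d" and lam: "0 < lam"
    and b: "strong_argmax d lam w P (affine_law d \<Lambda> \<mu>) b" and c: "strong_argmax d lam w (affine_law d \<Lambda> \<mu>) P c"
    and A: "A = opt_matrix lam P (affine_law d \<Lambda> \<mu>)"
  obtains C where "0 \<le> C" and "\<And>H h. norm2 d h + frobenius_norm d H \<le> 1 \<Longrightarrow>
    \<bar>gan_loss d lam w P (\<lambda>i j. \<Lambda> i j + H i j) (\<lambda>i. \<mu> i + h i) - gan_loss d lam w P \<Lambda> \<mu>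
      - ((\<Sum>i<d. grad_mu d \<Lambda> \<mu> A b c i * h i) + (\<Sum>i<d. \<Sum>j<d. grad_Lambda d \<Lambda> \<mu> A b c i j * H i j))\<bar>
     \<le> C * (norm2 d h + frobenius_norm d H)\<^sup>2"
proof -
  define Q where "Q = affine_law d \<Lambda> \<mu>"
  interpret P: l2_law P d by (rule P)
  interpret Z: l2_law "std_gaussian d" d by (rule l2_law_std_gaussian)
  define y where "y = (\<lambda>z. 1 + norm2 d z)"
  have y1: "1 \<le> y z" for z by (simp add: y_def)
  have yint: "integrable (std_gaussian d) (\<lambda>z. (y z)\<^sup>2)" unfolding y_def by (rule integrable_sq_std_gaussian)
  define Y where "Y = Z.expectation (\<lambda>z. (y z)\<^sup>2)"
  have Y: "0 \<le> Y" by (simp add: Y_def)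
  define G where "G = norm2 d \<mu> + frobenius_norm d \<Lambda>"
  have G: "0 \<le> G" by (simp add: G_def)
  define C0 where "C0 = (G + 1) + (1 + norm2 d b * G) + (1 + norm2 d c * G)"
  have C0: "0 \<le> C0" using G by (simp add: C0_def)
  define C1 where "C1 = C0 * Y"
  define C2 where "C2 = (frobenius_norm d A + (norm2 d b)\<^sup>2 + (norm2 d c)\<^sup>2) * Y"
  have C2: "0 \<le> C2" using Y by (simp add: C2_def)
  \<comment> \<open>Second-moment matrices are symmetric, so \<open>grad_disc\<close> is the true
    gradient at the maximiser.\<close>
  have Asym: "A i j = A j i" for i j by (simp add: A opt_matrix_def moment_def mult.commute)
  show ?thesis
  proof (rule that[of "C2 + 6 * C1\<^sup>2 / lam"])
    show "0 \<le> C2 + 6 * C1\<^sup>2 / lam" using C2 lam by simp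
    fix H h assume t1: "norm2 d h + frobenius_norm d H \<le> 1"
    define t where "t = norm2 d h + frobenius_norm d H"
    have t: "0 \<le> t" "t \<le> 1" using t1 by (auto simp: t_def)
    define g where "g = affine_map d \<Lambda> \<mu>"
    define k where "k = affine_map d H h"
    have gy: "norm2 d (g z) \<le> G * y z" and ky: "norm2 d (k z) \<le> t * y z" for z
      unfolding g_def k_def G_def t_def y_def by (rule norm2_affine_map_le)+
    define Q' where "Q' = affine_law d (\<lambda>i j. \<Lambda> i j + H i j) (\<lambda>i. \<mu> i + h i)"
    define V where "V = gan_value d lam w P Q"
    define V' where "V' = gan_value d lam w P Q'"
    define D where "D = (\<lambda>A b c z. disc d A b c (\<lambda>i. g z i + k z i) - disc d A b c (g z))"
    have Dint: "integrable (std_gaussian d) (D A b c)" for A b c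
      using disc_affine_law(1)[of d A b c "\<lambda>i j. \<Lambda> i j + H i j" "\<lambda>i. \<mu> i + h i"] disc_affine_law(1)[of d A b c \<Lambda> \<mu>]
      unfolding D_def disc_affine_map_add g_def k_def by (rule Bochner_Integration.integrable_diff)
    have VV': "V' A b c = V A b c - Z.expectation (D A b c)" for A b c
      using disc_affine_law(1)[of d A b c "\<lambda>i j. \<Lambda> i j + H i j" "\<lambda>i. \<mu> i + h i"] disc_affine_law(1)[of d A b c \<Lambda> \<mu>]
      unfolding V_def V'_def gan_value_def Q_def Q'_def disc_affine_law(2) D_def disc_affine_map_add g_def k_def
      by (simp add: Bochner_Integration.integral_diff)
    \<comment> \<open>Changing the discriminator alters the effect of the perturbation by at most
      \<open>C1 * t\<close> times the distance, and the quadratic growth of the unperturbed value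
      dominates this. Each of the three blocks leaves
      \<open>2 * (C1 * t)\<^sup>2 / lam\<close>.\<close>
    have upper: "V' A' b' c' \<le> V' A b c + 6 * C1\<^sup>2 / lam * t\<^sup>2" for A' b' c'
    proof -
      define FA where "FA = frobenius_norm d (\<lambda>i j. A' i j - A i j)"
      define NB where "NB = norm2 d (\<lambda>i. b' i - b i)"
      define NC where "NC = norm2 d (\<lambda>i. c' i - c i)"
      have nn: "0 \<le> FA" "0 \<le> NB" "0 \<le> NC" by (auto simp: FA_def NB_def NC_def)
      have pw: "\<bar>D A' b' c' z - D A b c z\<bar> \<le> ((FA + NB + NC) * t * C0) * (y z)\<^sup>2" for z
      proof -
        have y0: "0 \<le> y z" using y1[of z] by linarith
        have gk: "norm2 d (g z) * norm2 d (k z) \<le> G * t * (y z)\<^sup>2"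
          using mult_mono[OF gy[of z] ky[of z]] G y0 by (simp add: power2_eq_square mult_ac)
        have "t * t \<le> t * 1" using t by (intro mult_left_mono) auto
        then have "t\<^sup>2 * (y z)\<^sup>2 \<le> t * (y z)\<^sup>2" by (intro mult_right_mono) (auto simp: power2_eq_square)
        then have kk: "(norm2 d (k z))\<^sup>2 \<le> t * (y z)\<^sup>2"
          using power_mono[OF ky[of z], of 2] by (simp add: power_mult_distrib)
        have "y z * 1 \<le> y z * y z" using y1[of z] y0 by (intro mult_left_mono) auto
        then have "t * y z \<le> t * (y z)\<^sup>2" using t by (intro mult_left_mono) (auto simp: power2_eq_square)
        then have k1: "norm2 d (k z) \<le> t * (y z)\<^sup>2" using ky[of z] by linarith
        have "\<bar>D A' b' c' z - D A b c z\<bar> \<le> FA * (norm2 d (g z) * norm2 d (k z) + (norm2 d (k z))\<^sup>2)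
          + NB * (norm2 d (k z) + norm2 d b * (norm2 d (g z) * norm2 d (k z)))
          + NC * (norm2 d (k z) + norm2 d c * (norm2 d (g z) * norm2 d (k z)))"
          unfolding D_def FA_def NB_def NC_def by (rule disc_mixed_difference)
        also have "\<dots> \<le> FA * (G * t * (y z)\<^sup>2 + t * (y z)\<^sup>2)
          + NB * (t * (y z)\<^sup>2 + norm2 d b * (G * t * (y z)\<^sup>2))
          + NC * (t * (y z)\<^sup>2 + norm2 d c * (G * t * (y z)\<^sup>2))"
          by (intro add_mono mult_left_mono gk kk k1 nn norm2_nonneg)
        also have "\<dots> = (FA * (G + 1) + NB * (1 + norm2 d b * G) + NC * (1 + norm2 d c * G)) * (t * (y z)\<^sup>2)"
          by (simp add: algebra_simps)
        also have "\<dots> \<le> (FA * C0 + NB * C0 + NC * C0) * (t * (y z)\<^sup>2)"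
          using nn G t by (intro mult_right_mono add_mono mult_left_mono) (auto simp: C0_def)
        also have "\<dots> = ((FA + NB + NC) * t * C0) * (y z)\<^sup>2" by (simp add: algebra_simps)
        finally show ?thesis .
      qed
      have "\<bar>Z.expectation (D A' b' c') - Z.expectation (D A b c)\<bar> = \<bar>Z.expectation (\<lambda>z. D A' b' c' z - D A b c z)\<bar>"
        using Dint by simp
      also have "\<dots> \<le> Z.expectation (\<lambda>z. \<bar>D A' b' c' z - D A b c z\<bar>)" by (rule integral_abs_bound)
      also have "\<dots> \<le> Z.expectation (\<lambda>z. ((FA + NB + NC) * t * C0) * (y z)\<^sup>2)"
        using Dint yint by (intro integral_mono pw integrable_abs Bochner_Integration.integrable_diff) auto
      also have "\<dots> = (FA + NB + NC) * (C1 * t)" by (simp add: Y_def C1_def mult_ac)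
      finally have "\<bar>Z.expectation (D A' b' c') - Z.expectation (D A b c)\<bar> \<le> (FA + NB + NC) * (C1 * t)" .
      moreover have "V A' b' c' \<le> V A b c - lam / 8 * (FA\<^sup>2 + NB\<^sup>2 + NC\<^sup>2)"
        using gan_value_le[OF P l2_law_affine_law lam b c, of A' b' c'] unfolding V_def Q_def FA_def NB_def NC_def A .
      ultimately have "V' A' b' c' \<le> V' A b c + ((FA + NB + NC) * (C1 * t) - lam / 8 * (FA\<^sup>2 + NB\<^sup>2 + NC\<^sup>2))"
        unfolding VV' by linarith
      also have "(FA + NB + NC) * (C1 * t) - lam / 8 * (FA\<^sup>2 + NB\<^sup>2 + NC\<^sup>2)
         = (FA * (C1 * t) - lam / 8 * FA\<^sup>2) + (NB * (C1 * t) - lam / 8 * NB\<^sup>2) + (NC * (C1 * t) - lam / 8 * NC\<^sup>2)"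
        by (simp add: algebra_simps)
      also have "\<dots> \<le> 2 * (C1 * t)\<^sup>2 / lam + 2 * (C1 * t)\<^sup>2 / lam + 2 * (C1 * t)\<^sup>2 / lam"
        by (intro add_mono complete_square_bound lam)
      also have "\<dots> = 6 * C1\<^sup>2 / lam * t\<^sup>2" by (simp add: power_mult_distrib)
      finally show ?thesis by simp
    qed
    have loss': "gan_loss d lam w P (\<lambda>i j. \<Lambda> i j + H i j) (\<lambda>i. \<mu> i + h i) = (SUP (A, b, c). V' A b c)"
      unfolding gan_loss_eq_SUP V'_def Q'_def ..
    have ub: "gan_loss d lam w P (\<lambda>i j. \<Lambda> i j + H i j) (\<lambda>i. \<mu> i + h i) \<le> V' A b c + 6 * C1\<^sup>2 / lam * t\<^sup>2"
      unfolding loss' by (rule cSUP_least) (use upper in auto)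
    have "bdd_above (range (\<lambda>(A, b, c). V' A b c))"
      by (rule bdd_aboveI[of _ "V' A b c + 6 * C1\<^sup>2 / lam * t\<^sup>2"]) (use upper in auto)
    from cSUP_upper[OF UNIV_I this, of "(A, b, c)"]
    have lb: "V' A b c \<le> gan_loss d lam w P (\<lambda>i j. \<Lambda> i j + H i j) (\<lambda>i. \<mu> i + h i)"
      unfolding loss' by simp
    have loss: "gan_loss d lam w P \<Lambda> \<mu> = V A b c"
      unfolding V_def Q_def A by (rule gan_loss_eq_gan_value[OF P lam b c])
    define L where "L = (\<Sum>i<d. grad_mu d \<Lambda> \<mu> A b c i * h i) + (\<Sum>i<d. \<Sum>j<d. grad_Lambda d \<Lambda> \<mu> A b c i j * H i j)"
    note ig = expectation_grad_disc_inner_prod[of d A b c \<Lambda> \<mu> H h, folded g_def k_def L_def]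
    have "\<bar>Z.expectation (D A b c) - - L\<bar>
       = \<bar>Z.expectation (\<lambda>z. D A b c z - inner_prod d (grad_disc d A b c (g z)) (k z))\<bar>"
      unfolding ig(2)[symmetric] using Dint ig(1) by simp
    also have "\<dots> \<le> Z.expectation (\<lambda>z. \<bar>D A b c z - inner_prod d (grad_disc d A b c (g z)) (k z)\<bar>)"
      by (rule integral_abs_bound)
    also have "\<dots> \<le> Z.expectation (\<lambda>z. ((frobenius_norm d A + (norm2 d b)\<^sup>2 + (norm2 d c)\<^sup>2) * t\<^sup>2) * (y z)\<^sup>2)"
    proof (rule integral_mono)
      show "integrable (std_gaussian d) (\<lambda>z. \<bar>D A b c z - inner_prod d (grad_disc d A b c (g z)) (k z)\<bar>)"
        using Dint ig(1) by (intro integrable_abs Bochner_Integration.integrable_diff) auto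
      show "integrable (std_gaussian d) (\<lambda>z. ((frobenius_norm d A + (norm2 d b)\<^sup>2 + (norm2 d c)\<^sup>2) * t\<^sup>2) * (y z)\<^sup>2)"
        using yint by simp
      fix z
      have "\<bar>D A b c z - inner_prod d (grad_disc d A b c (g z)) (k z)\<bar>
        \<le> (frobenius_norm d A + (norm2 d b)\<^sup>2 + (norm2 d c)\<^sup>2) * (norm2 d (k z))\<^sup>2"
        unfolding D_def by (rule disc_Taylor) (rule Asym)
      also have "\<dots> \<le> (frobenius_norm d A + (norm2 d b)\<^sup>2 + (norm2 d c)\<^sup>2) * (t * y z)\<^sup>2"
        by (intro mult_left_mono power_mono ky) auto
      finally show "\<bar>D A b c z - inner_prod d (grad_disc d A b c (g z)) (k z)\<bar>
        \<le> ((frobenius_norm d A + (norm2 d b)\<^sup>2 + (norm2 d c)\<^sup>2) * t\<^sup>2) * (y z)\<^sup>2"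
        by (simp add: power_mult_distrib mult.assoc)
    qed
    also have "\<dots> = C2 * t\<^sup>2" by (simp add: C2_def Y_def mult_ac)
    finally have E: "\<bar>Z.expectation (D A b c) + L\<bar> \<le> C2 * t\<^sup>2" by simp
    have "\<bar>gan_loss d lam w P (\<lambda>i j. \<Lambda> i j + H i j) (\<lambda>i. \<mu> i + h i) - gan_loss d lam w P \<Lambda> \<mu> - L\<bar>
       \<le> C2 * t\<^sup>2 + 6 * C1\<^sup>2 / lam * t\<^sup>2"
      using E ub lb unfolding loss VV' by linarith
    then show "\<bar>gan_loss d lam w P (\<lambda>i j. \<Lambda> i j + H i j) (\<lambda>i. \<mu> i + h i) - gan_loss d lam w P \<Lambda> \<mu>
      - ((\<Sum>i<d. grad_mu d \<Lambda> \<mu> A b c i * h i) + (\<Sum>i<d. \<Sum>j<d. grad_Lambda d \<Lambda> \<mu> A b c i j * H i j))\<bar>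
     \<le> (C2 + 6 * C1\<^sup>2 / lam) * (norm2 d h + frobenius_norm d H)\<^sup>2"
      by (simp add: L_def t_def distrib_right)
  qed
qed

lemma has_gradient_on_if_quadratic_remainder:
  assumes C: "0 \<le> C" and q: "\<And>h. L2_set h I \<le> 1 \<Longrightarrow>
    \<bar>f (\<lambda>i. x i + h i) - f x - (\<Sum>i\<in>I. g i * h i)\<bar> \<le> C * (L2_set h I)\<^sup>2"
  shows "has_gradient_on I f x g"
  unfolding has_gradient_on_def
proof (intro allI impI)
  fix e :: real assume e: "0 < e"
  show "\<exists>r>0. \<forall>h. L2_set h I < r \<longrightarrow>
      \<bar>f (\<lambda>i. x i + h i) - f x - (\<Sum>i\<in>I. g i * h i)\<bar> \<le> e * L2_set h I"
  proof (intro exI[of _ "min 1 (e / (C + 1))"] conjI allI impI)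
    show "0 < min 1 (e / (C + 1))" using e C by simp
    fix h :: "'a \<Rightarrow> real" assume h: "L2_set h I < min 1 (e / (C + 1))"
    have "L2_set h I * (C + 1) \<le> e" using h C by (simp add: field_simps)
    moreover have "L2_set h I * (C + 1) = C * L2_set h I + L2_set h I" by (simp add: algebra_simps)
    ultimately have "C * L2_set h I \<le> e" using L2_set_nonneg[of h I] by linarith
    then have "(C * L2_set h I) * L2_set h I \<le> e * L2_set h I"
      by (intro mult_right_mono L2_set_nonneg)
    then show "\<bar>f (\<lambda>i. x i + h i) - f x - (\<Sum>i\<in>I. g i * h i)\<bar> \<le> e * L2_set h I"
      using q[of h] h by (simp add: power2_eq_square)
  qed
qed

text \<open>Each gradient is read off the joint expansion by setting the other perturbation to
  0.\<close>

lemma gan_loss_gradients: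
  assumes P: "l2_law P d" and lam: "0 < lam"
    and b: "strong_argmax d lam w P (affine_law d \<Lambda> \<mu>) b" and c: "strong_argmax d lam w (affine_law d \<Lambda> \<mu>) P c"
    and A: "A = opt_matrix lam P (affine_law d \<Lambda> \<mu>)"
  shows "has_vec_gradient d (\<lambda>m. gan_loss d lam w P \<Lambda> m) \<mu> (grad_mu d \<Lambda> \<mu> A b c)"
    "has_mat_gradient d (\<lambda>L. gan_loss d lam w P L \<mu>) \<Lambda> (grad_Lambda d \<Lambda> \<mu> A b c)"
proof -
  obtain C where C: "0 \<le> C" and ex: "\<And>H h. norm2 d h + frobenius_norm d H \<le> 1 \<Longrightarrow>
    \<bar>gan_loss d lam w P (\<lambda>i j. \<Lambda> i j + H i j) (\<lambda>i. \<mu> i + h i) - gan_loss d lam w P \<Lambda> \<mu>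
      - ((\<Sum>i<d. grad_mu d \<Lambda> \<mu> A b c i * h i) + (\<Sum>i<d. \<Sum>j<d. grad_Lambda d \<Lambda> \<mu> A b c i j * H i j))\<bar>
     \<le> C * (norm2 d h + frobenius_norm d H)\<^sup>2"
    using gan_loss_expansion[OF assms] by blast
  show "has_vec_gradient d (\<lambda>m. gan_loss d lam w P \<Lambda> m) \<mu> (grad_mu d \<Lambda> \<mu> A b c)"
    unfolding has_vec_gradient_def
  proof (rule has_gradient_on_if_quadratic_remainder[OF C])
    fix h :: rvec assume "L2_set h {..<d} \<le> 1"
    then show "\<bar>gan_loss d lam w P \<Lambda> (\<lambda>i. \<mu> i + h i) - gan_loss d lam w P \<Lambda> \<mu> - (\<Sum>i<d. grad_mu d \<Lambda> \<mu> A b c i * h i)\<bar>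
       \<le> C * (L2_set h {..<d})\<^sup>2"
      using ex[of h "\<lambda>_ _. 0"] by (simp add: norm2_def frobenius_norm_def L2_set_def case_prod_beta')
  qed
  show "has_mat_gradient d (\<lambda>L. gan_loss d lam w P L \<mu>) \<Lambda> (grad_Lambda d \<Lambda> \<mu> A b c)"
    unfolding has_mat_gradient_def
  proof (rule has_gradient_on_if_quadratic_remainder[OF C])
    fix h :: "nat \<times> nat \<Rightarrow> real" assume h: "L2_set h ({..<d} \<times> {..<d}) \<le> 1"
    have f: "frobenius_norm d (curry h) = L2_set h ({..<d} \<times> {..<d})"
      by (simp add: frobenius_norm_def)
    have s: "(\<Sum>i\<in>{..<d} \<times> {..<d}. case_prod (grad_Lambda d \<Lambda> \<mu> A b c) i * h i)
        = (\<Sum>i<d. \<Sum>j<d. grad_Lambda d \<Lambda> \<mu> A b c i j * curry h i j)"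
      unfolding sum.cartesian_product by (intro sum.cong) auto
    have cu: "curry (\<lambda>i. case_prod \<Lambda> i + h i) = (\<lambda>i j. \<Lambda> i j + curry h i j)" by (simp add: fun_eq_iff)
    show "\<bar>gan_loss d lam w P (curry (\<lambda>i. case_prod \<Lambda> i + h i)) \<mu> - gan_loss d lam w P (curry (case_prod \<Lambda>)) \<mu>
        - (\<Sum>i\<in>{..<d} \<times> {..<d}. case_prod (grad_Lambda d \<Lambda> \<mu> A b c) i * h i)\<bar>
       \<le> C * (L2_set h ({..<d} \<times> {..<d}))\<^sup>2"
      unfolding s cu f[symmetric] using ex[of "\<lambda>_. 0" "curry h"] h by (simp add: f norm2_def L2_set_def)
  qed
qed

subsection \<open>Stability under a change of the data law\<close>

text \<open>The second-moment matrix is tested against itself: its squared Frobenius norm is the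
  mean of its own quadratic form, which is at most its Frobenius norm times the mean of the squared
  length.\<close>

lemma (in l2_law) frobenius_norm_moment_le: "frobenius_norm d (moment P) \<le> second_moment d P"
proof (cases "frobenius_norm d (moment P) = 0")
  case True
  then show ?thesis by (simp add: second_moment_def)
next
  case False
  then have pos: "0 < frobenius_norm d (moment P)" using frobenius_norm_nonneg[of d "moment P"] by linarith
  have sq: "integrable P (\<lambda>x. (norm2 d x)\<^sup>2)" unfolding norm2_sq using coord_sq by auto
  have "(frobenius_norm d (moment P))\<^sup>2 = expectation (\<lambda>x. bilin d (moment P) x x)"
    unfolding frobenius_norm_sq expectation_bilin(2) by (simp add: power2_eq_square)
  also have "\<dots> \<le> expectation (\<lambda>x. frobenius_norm d (moment P) * (norm2 d x)\<^sup>2)"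
  proof (rule integral_mono[OF expectation_bilin(1)])
    show "integrable P (\<lambda>x. frobenius_norm d (moment P) * (norm2 d x)\<^sup>2)" using sq by simp
    show "bilin d (moment P) x x \<le> frobenius_norm d (moment P) * (norm2 d x)\<^sup>2" for x
      using bilin_le[of d "moment P" x x] by (simp add: power2_eq_square)
  qed
  also have "\<dots> = frobenius_norm d (moment P) * second_moment d P" by (simp add: second_moment_def)
  finally show ?thesis using pos by (simp add: power2_eq_square)
qed

lemma (in l2_law) moment_bound_if_frobenius:
  assumes "frobenius_norm d (moment P) \<le> a\<^sup>2"
  shows "moment_bound d P a"
  unfolding moment_bound_def
proof
  fix u
  have "expectation (\<lambda>x. (inner_prod d u x)\<^sup>2) = bilin d (moment P) u u"
    unfolding power2_eq_square expectation_inner_prod_mult by (simp add: bilin_def mult.commute)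
  also have "\<dots> \<le> frobenius_norm d (moment P) * (norm2 d u)\<^sup>2"
    using bilin_le[of d "moment P" u u] by (simp add: power2_eq_square)
  also have "\<dots> \<le> a\<^sup>2 * (norm2 d u)\<^sup>2" using assms by (intro mult_right_mono) auto
  finally show "expectation (\<lambda>x. (inner_prod d u x)\<^sup>2) \<le> a\<^sup>2 * (norm2 d u)\<^sup>2" .
qed

lemma strong_argmax_exists:
  assumes "l2_law P d" "l2_law Q d" "0 < lam" "moment_bound d P a" "moment_bound d Q a" "0 < a" "a\<^sup>2 \<le> 3 / 2 * lam"
  obtains b where "strong_argmax d lam w P Q b" "norm2 d (\<lambda>i. b i - w i) \<le> 2 * a / lam"
proof -
  obtain b where b: "\<And>b'. avg_logcosh d P b' - avg_logcosh d Q b' - lam * (norm2 d (\<lambda>i. b' i - w i))\<^sup>2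
       \<le> avg_logcosh d P b - avg_logcosh d Q b - lam * (norm2 d (\<lambda>i. b i - w i))\<^sup>2
         - lam / 8 * (norm2 d (\<lambda>i. b' i - b i))\<^sup>2"
    "norm2 d (\<lambda>i. b i - w i) \<le> (a + a) / lam"
    using penalized_logcosh_argmax[of P d Q lam a a w] assms by blast
  show ?thesis
  proof (rule that)
    show "strong_argmax d lam w P Q b" unfolding strong_argmax_def penalized_def using b(1) by simp
    show "norm2 d (\<lambda>i. b i - w i) \<le> 2 * a / lam" using b(2) by simp
  qed
qed

text \<open>The two growth inequalities, each applied at the other maximiser, add up to
  \<open>lam / 4\<close> times the squared distance; the left-hand side of \<open>L\<close> bounds
  this by \<open>\<Delta>\<close> times the distance.\<close>

lemma strong_argmax_stable:
  assumes lam: "0 < lam" and b: "strong_argmax d lam w P Q b" and b': "strong_argmax d lam w P' Q' b'"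
    and L: "\<bar>(penalized d lam w P' Q' b' - penalized d lam w P Q b') - (penalized d lam w P' Q' b - penalized d lam w P Q b)\<bar>
      \<le> \<Delta> * norm2 d (\<lambda>i. b' i - b i)" and \<Delta>: "0 \<le> \<Delta>"
  shows "norm2 d (\<lambda>i. b' i - b i) \<le> 4 * \<Delta> / lam"
proof (cases "norm2 d (\<lambda>i. b' i - b i) = 0")
  case False
  define N where "N = norm2 d (\<lambda>i. b' i - b i)"
  have N: "0 < N" using False norm2_nonneg[of d "\<lambda>i. b' i - b i"] unfolding N_def by linarith
  have "penalized d lam w P Q b' \<le> penalized d lam w P Q b - lam / 8 * N\<^sup>2"
    using b unfolding strong_argmax_def N_def by blast
  moreover have "penalized d lam w P' Q' b \<le> penalized d lam w P' Q' b' - lam / 8 * N\<^sup>2"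
    using b' unfolding strong_argmax_def N_def norm2_minus_commute[of d b' b] by blast
  ultimately have "lam / 4 * N\<^sup>2 \<le> \<Delta> * N" using L unfolding N_def by linarith
  then have "(lam / 4 * N) * N \<le> \<Delta> * N" by (simp add: power2_eq_square mult.assoc)
  then have "lam / 4 * N \<le> \<Delta>" using N by simp
  then show ?thesis using lam by (simp add: N_def field_simps)
qed (use lam \<Delta> in simp)

lemma expectation_affine_inner_prod_mult_le:
  assumes a: "moment_bound d (affine_law d \<Lambda> \<mu>) a" "0 < a"
    and \<xi>: "\<xi> \<in> borel_measurable (std_gaussian d)" "integrable (std_gaussian d) (\<lambda>z. (\<xi> z)\<^sup>2)"
      "(\<integral>z. (\<xi> z)\<^sup>2 \<partial>std_gaussian d) \<le> 1"
  shows "integrable (std_gaussian d) (\<lambda>z. inner_prod d v (affine_map d \<Lambda> \<mu> z) * \<xi> z)"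
    "(\<integral>z. \<bar>inner_prod d v (affine_map d \<Lambda> \<mu> z) * \<xi> z\<bar> \<partial>std_gaussian d) \<le> a * norm2 d v"
proof -
  interpret Q: l2_law "affine_law d \<Lambda> \<mu>" d by (rule l2_law_affine_law)
  have m: "(\<lambda>z. inner_prod d v (affine_map d \<Lambda> \<mu> z)) \<in> borel_measurable (std_gaussian d)"
    using Q.inner_prod_measurable[of v] unfolding measurable_affine_law
    by (rule measurable_compose[OF affine_map_measurable])
  have sq: "integrable (std_gaussian d) (\<lambda>z. (inner_prod d v (affine_map d \<Lambda> \<mu> z))\<^sup>2)"
    using Q.integrable_inner_prod_sq[of v] unfolding affine_law_def
    by (rule integrable_distr[OF affine_map_measurable])
  have "(\<integral>z. (inner_prod d v (affine_map d \<Lambda> \<mu> z))\<^sup>2 \<partial>std_gaussian d) = (\<integral>x. (inner_prod d v x)\<^sup>2 \<partial>affine_law d \<Lambda> \<mu>)"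
    by (rule integral_affine_law[symmetric]) (rule borel_measurable_integrable[OF Q.integrable_inner_prod_sq])
  also have "\<dots> \<le> (a * norm2 d v)\<^sup>2" using a(1) by (simp add: moment_bound_def power_mult_distrib)
  finally have le: "(\<integral>z. (inner_prod d v (affine_map d \<Lambda> \<mu> z))\<^sup>2 \<partial>std_gaussian d) \<le> (a * norm2 d v)\<^sup>2" .
  have "integrable (std_gaussian d) (\<lambda>z. inner_prod d v (affine_map d \<Lambda> \<mu> z) * \<xi> z) \<and>
    (\<integral>z. \<bar>inner_prod d v (affine_map d \<Lambda> \<mu> z) * \<xi> z\<bar> \<partial>std_gaussian d) \<le> a * norm2 d v"
  proof (cases "norm2 d v = 0")
    case True
    then have "inner_prod d v x = 0" for x using abs_inner_prod_le[of d v x] by simp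
    then show ?thesis using True by simp
  next
    case False
    then have "0 < a * norm2 d v" using a(2) norm2_nonneg[of d v] by (simp add: less_le)
    then show ?thesis
      using expectation_abs_mult_le[OF m \<xi>(1) sq le _ \<xi>(2), of 1] \<xi>(3) by simp
  qed
  then show "integrable (std_gaussian d) (\<lambda>z. inner_prod d v (affine_map d \<Lambda> \<mu> z) * \<xi> z)"
    "(\<integral>z. \<bar>inner_prod d v (affine_map d \<Lambda> \<mu> z) * \<xi> z\<bar> \<partial>std_gaussian d) \<le> a * norm2 d v" by auto
qed

section \<open>Stability of the gradients in the maximiser\<close>

lemma tanh_term_difference_le:
  assumes u: "norm2 d u \<le> 1"
  shows "\<bar>inner_prod d u b' * tanh (inner_prod d b' x) - inner_prod d u b * tanh (inner_prod d b x)\<bar>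
    \<le> norm2 d (\<lambda>i. b' i - b i) + norm2 d b * \<bar>inner_prod d (\<lambda>i. b' i - b i) x\<bar>"
proof -
  define e where "e = (\<lambda>i. b' i - b i)"
  have ip: "inner_prod d u b' = inner_prod d u e + inner_prod d u b"
    by (simp add: e_def inner_prod_def algebra_simps sum.distrib sum_subtractf)
  have u1: "\<bar>inner_prod d u v\<bar> \<le> norm2 d v" for v
    using abs_inner_prod_le[of d u v] mult_right_mono[OF u norm2_nonneg[of d v]] by simp
  have "\<bar>inner_prod d u e * tanh (inner_prod d b' x)\<bar> \<le> norm2 d e * 1"
    unfolding abs_mult using u1[of e] abs_tanh_le_1 by (intro mult_mono) auto
  moreover have "\<bar>inner_prod d u b * (tanh (inner_prod d b' x) - tanh (inner_prod d b x))\<bar>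
      \<le> norm2 d b * \<bar>inner_prod d e x\<bar>"
    unfolding abs_mult e_def inner_prod_diff using u1[of b] tanh_Lipschitz by (intro mult_mono) auto
  moreover have "inner_prod d u b' * tanh (inner_prod d b' x) - inner_prod d u b * tanh (inner_prod d b x)
     = inner_prod d u e * tanh (inner_prod d b' x) + inner_prod d u b * (tanh (inner_prod d b' x) - tanh (inner_prod d b x))"
    by (simp add: ip algebra_simps)
  ultimately show ?thesis unfolding e_def by linarith
qed

text \<open>The test function \<open>\<xi>\<close> treats both gradients at once: the constant 1
  gives the gradient in \<open>\<mu>\<close>, and a linear function of \<open>z\<close> the one in
  \<open>\<Lambda>\<close>. Only its second moment matters.\<close>

lemma grad_disc_difference_le:
  assumes a: "moment_bound d (affine_law d \<Lambda> \<mu>) a" "0 < a" and u: "norm2 d u \<le> 1"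
    and \<xi>: "\<xi> \<in> borel_measurable (std_gaussian d)" "integrable (std_gaussian d) (\<lambda>z. (\<xi> z)\<^sup>2)"
      "(\<integral>z. (\<xi> z)\<^sup>2 \<partial>std_gaussian d) \<le> 1"
    and int: "integrable (std_gaussian d) (\<lambda>z. (inner_prod d u (grad_disc d A' b' c' (affine_map d \<Lambda> \<mu> z))
        - inner_prod d u (grad_disc d A b c (affine_map d \<Lambda> \<mu> z))) * \<xi> z)"
  shows "\<bar>\<integral>z. (inner_prod d u (grad_disc d A' b' c' (affine_map d \<Lambda> \<mu> z))
        - inner_prod d u (grad_disc d A b c (affine_map d \<Lambda> \<mu> z))) * \<xi> z \<partial>std_gaussian d\<bar>
    \<le> frobenius_norm d (\<lambda>i j. A' i j - A i j) * a
      + norm2 d (\<lambda>i. b' i - b i) * (1 + norm2 d b * a) + norm2 d (\<lambda>i. c' i - c i) * (1 + norm2 d c * a)"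
proof -
  interpret Z: l2_law "std_gaussian d" d by (rule l2_law_std_gaussian)
  define g where "g = affine_map d \<Lambda> \<mu>"
  define E where "E = (\<lambda>i j. A' i j - A i j)"
  define v where "v = mat_vec d (\<lambda>i j. E j i) u"
  define e where "e = (\<lambda>i. b' i - b i)"
  define f where "f = (\<lambda>i. c' i - c i)"
  have v: "norm2 d v \<le> frobenius_norm d E"
  proof -
    have "frobenius_norm d (\<lambda>i j. E j i) = frobenius_norm d E"
    proof -
      have "(frobenius_norm d (\<lambda>i j. E j i))\<^sup>2 = (frobenius_norm d E)\<^sup>2"
        unfolding frobenius_norm_sq by (rule sum.swap)
      then show ?thesis by (simp add: power2_eq_iff_nonneg)
    qed
    then have "norm2 d v \<le> frobenius_norm d E * norm2 d u"
      using norm2_mat_vec_le[of d "\<lambda>i j. E j i" u] by (simp add: v_def)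
    also have "\<dots> \<le> frobenius_norm d E * 1" using u by (intro mult_left_mono) auto
    finally show ?thesis by simp
  qed
  have vg: "inner_prod d u (mat_vec d A' x) - inner_prod d u (mat_vec d A x) = inner_prod d v x" for x
  proof -
    have "inner_prod d v x = bilin d (\<lambda>i j. E j i) x u" by (simp add: v_def inner_prod_mat_vec)
    also have "\<dots> = bilin d E u x"
      unfolding bilin_def by (subst sum.swap) (simp add: mult.commute)
    also have "\<dots> = inner_prod d u (mat_vec d A' x) - inner_prod d u (mat_vec d A x)"
      unfolding E_def bilin_diff_matrix
      by (simp add: inner_prod_def mat_vec_def bilin_def sum_distrib_left mult_ac)
    finally show ?thesis by simp
  qed
  have ug: "inner_prod d u (grad_disc d A b c x) = inner_prod d u (mat_vec d A x)
     + inner_prod d u b * tanh (inner_prod d b x) - inner_prod d u c * tanh (inner_prod d c x)" for A b c x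
    by (simp add: grad_disc_def inner_prod_def algebra_simps sum.distrib sum_subtractf sum_distrib_left sum_distrib_right)
  have pw: "\<bar>(inner_prod d u (grad_disc d A' b' c' x) - inner_prod d u (grad_disc d A b c x)) * t\<bar>
      \<le> \<bar>inner_prod d v x * t\<bar> + (norm2 d e + norm2 d f) * \<bar>t\<bar>
        + norm2 d b * \<bar>inner_prod d e x * t\<bar> + norm2 d c * \<bar>inner_prod d f x * t\<bar>" for x t
  proof -
    have "\<bar>inner_prod d u (grad_disc d A' b' c' x) - inner_prod d u (grad_disc d A b c x)\<bar>
      \<le> \<bar>inner_prod d v x\<bar> + (norm2 d e + norm2 d f) + norm2 d b * \<bar>inner_prod d e x\<bar> + norm2 d c * \<bar>inner_prod d f x\<bar>"
      using tanh_term_difference_le[OF u, of b' x b] tanh_term_difference_le[OF u, of c' x c]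
      unfolding ug vg[symmetric] e_def f_def by linarith
    from mult_right_mono[OF this abs_ge_zero[of t]] show ?thesis
      by (simp add: abs_mult distrib_right mult.assoc)
  qed
  note iv = expectation_affine_inner_prod_mult_le[OF a \<xi>, folded g_def]
  have \<xi>1: "integrable (std_gaussian d) \<xi>" using \<xi>(1,2) by (rule Z.square_integrable_imp_integrable)
  have "(\<integral>z. \<bar>\<xi> z * 1\<bar> \<partial>std_gaussian d) \<le> 1 * 1"
    by (rule expectation_abs_mult_le(2)[OF \<xi>(1)]) (use \<xi> in \<open>auto simp: Z.prob_space\<close>)
  then have \<xi>2: "(\<integral>z. \<bar>\<xi> z\<bar> \<partial>std_gaussian d) \<le> 1" by simp
  have "\<bar>\<integral>z. (inner_prod d u (grad_disc d A' b' c' (g z)) - inner_prod d u (grad_disc d A b c (g z))) * \<xi> z \<partial>std_gaussian d\<bar>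
     \<le> (\<integral>z. \<bar>(inner_prod d u (grad_disc d A' b' c' (g z)) - inner_prod d u (grad_disc d A b c (g z))) * \<xi> z\<bar> \<partial>std_gaussian d)"
    by (rule integral_abs_bound)
  also have "\<dots> \<le> (\<integral>z. \<bar>inner_prod d v (g z) * \<xi> z\<bar> + (norm2 d e + norm2 d f) * \<bar>\<xi> z\<bar>
        + norm2 d b * \<bar>inner_prod d e (g z) * \<xi> z\<bar> + norm2 d c * \<bar>inner_prod d f (g z) * \<xi> z\<bar> \<partial>std_gaussian d)"
    using int[folded g_def] iv(1) \<xi>1
    by (intro integral_mono pw integrable_abs Bochner_Integration.integrable_add integrable_mult_right) auto
  also have "\<dots> = (\<integral>z. \<bar>inner_prod d v (g z) * \<xi> z\<bar> \<partial>std_gaussian d) + (norm2 d e + norm2 d f) * (\<integral>z. \<bar>\<xi> z\<bar> \<partial>std_gaussian d)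
        + norm2 d b * (\<integral>z. \<bar>inner_prod d e (g z) * \<xi> z\<bar> \<partial>std_gaussian d) + norm2 d c * (\<integral>z. \<bar>inner_prod d f (g z) * \<xi> z\<bar> \<partial>std_gaussian d)"
    using integrable_abs[OF iv(1)] integrable_abs[OF \<xi>1] by (simp add: Bochner_Integration.integral_add)
  also have "\<dots> \<le> a * norm2 d v + (norm2 d e + norm2 d f) * 1 + norm2 d b * (a * norm2 d e) + norm2 d c * (a * norm2 d f)"
    by (intro add_mono mult_left_mono iv(2) \<xi>2) auto
  also have "\<dots> \<le> a * frobenius_norm d E + (norm2 d e + norm2 d f) * 1 + norm2 d b * (a * norm2 d e) + norm2 d c * (a * norm2 d f)"
    using v a(2) by simp
  also have "\<dots> = frobenius_norm d E * a + norm2 d e * (1 + norm2 d b * a) + norm2 d f * (1 + norm2 d c * a)"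
    by (simp add: algebra_simps)
  finally show ?thesis unfolding g_def E_def e_def f_def .
qed

text \<open>By duality. For the spectral norm, vectors \<open>u\<close> and \<open>v\<close> in the
  unit ball are tested with \<open>\<xi> z = inner_prod d v z\<close>, whose second moment is
  \<open>(norm2 d v)\<^sup>2 \<le> 1\<close>; the estimate thus needs no sum over the columns and
  has no factor \<open>d\<close>.\<close>

lemma gradient_difference_le:
  assumes a: "moment_bound d (affine_law d \<Lambda> \<mu>) a" "0 < a"
    and B: "frobenius_norm d (\<lambda>i j. A' i j - A i j) * a
      + norm2 d (\<lambda>i. b' i - b i) * (1 + norm2 d b * a) + norm2 d (\<lambda>i. c' i - c i) * (1 + norm2 d c * a) \<le> B"
  shows "norm2 d (\<lambda>i. grad_mu d \<Lambda> \<mu> A' b' c' i - grad_mu d \<Lambda> \<mu> A b c i) \<le> B"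
    "spectral_norm d (\<lambda>i j. grad_Lambda d \<Lambda> \<mu> A' b' c' i j - grad_Lambda d \<Lambda> \<mu> A b c i j) \<le> B"
proof -
  interpret Z: l2_law "std_gaussian d" d by (rule l2_law_std_gaussian)
  have B0: "0 \<le> B" by (rule order_trans[OF _ B]) (use a(2) in simp)
  define \<phi>' where "\<phi>' = (\<lambda>z. grad_disc d A' b' c' (affine_map d \<Lambda> \<mu> z))"
  define \<phi> where "\<phi> = (\<lambda>z. grad_disc d A b c (affine_map d \<Lambda> \<mu> z))"
  have int: "integrable (std_gaussian d) (\<lambda>z. \<phi> z i)" "j < d \<Longrightarrow> integrable (std_gaussian d) (\<lambda>z. \<phi> z i * z j)"
     "integrable (std_gaussian d) (\<lambda>z. \<phi>' z i)" "j < d \<Longrightarrow> integrable (std_gaussian d) (\<lambda>z. \<phi>' z i * z j)"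
    if "i < d" for i j
    using integrable_grad_disc_affine[OF that] by (simp_all add: \<phi>_def \<phi>'_def)
  show "norm2 d (\<lambda>i. grad_mu d \<Lambda> \<mu> A' b' c' i - grad_mu d \<Lambda> \<mu> A b c i) \<le> B"
  proof (rule norm2_le_if_inner_prod_le[OF _ B0])
    fix u assume u: "norm2 d u \<le> 1"
    have e: "(inner_prod d u (\<phi>' z) - inner_prod d u (\<phi> z)) * 1 = (\<Sum>i<d. u i * (\<phi>' z i - \<phi> z i))" for z
      by (simp add: inner_prod_def right_diff_distrib sum_subtractf)
    have i1: "integrable (std_gaussian d) (\<lambda>z. (inner_prod d u (\<phi>' z) - inner_prod d u (\<phi> z)) * 1)"
      unfolding e by (intro Bochner_Integration.integrable_sum integrable_mult_right Bochner_Integration.integrable_diff int) auto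
    have "(\<integral>z. (inner_prod d u (\<phi>' z) - inner_prod d u (\<phi> z)) * 1 \<partial>std_gaussian d)
       = (\<Sum>i<d. \<integral>z. u i * (\<phi>' z i - \<phi> z i) \<partial>std_gaussian d)"
      unfolding e by (intro Bochner_Integration.integral_sum integrable_mult_right Bochner_Integration.integrable_diff int) auto
    also have "\<dots> = (\<Sum>i<d. u i * ((\<integral>z. \<phi>' z i \<partial>std_gaussian d) - (\<integral>z. \<phi> z i \<partial>std_gaussian d)))"
      using int by (intro sum.cong refl) (simp add: Bochner_Integration.integral_diff)
    also have "\<dots> = - inner_prod d u (\<lambda>i. grad_mu d \<Lambda> \<mu> A' b' c' i - grad_mu d \<Lambda> \<mu> A b c i)"
      unfolding inner_prod_def sum_negf[symmetric]
      by (intro sum.cong refl) (simp add: grad_mu_def \<phi>_def \<phi>'_def algebra_simps)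
    finally have eq: "(\<integral>z. (inner_prod d u (\<phi>' z) - inner_prod d u (\<phi> z)) * 1 \<partial>std_gaussian d)
       = - inner_prod d u (\<lambda>i. grad_mu d \<Lambda> \<mu> A' b' c' i - grad_mu d \<Lambda> \<mu> A b c i)" .
    have "\<bar>\<integral>z. (inner_prod d u (\<phi>' z) - inner_prod d u (\<phi> z)) * 1 \<partial>std_gaussian d\<bar> \<le> B"
      unfolding \<phi>_def \<phi>'_def
      by (rule order_trans[OF grad_disc_difference_le[OF a u] B])
         (use i1[unfolded \<phi>_def \<phi>'_def] in \<open>auto simp: Z.prob_space\<close>)
    then show "inner_prod d u (\<lambda>i. grad_mu d \<Lambda> \<mu> A' b' c' i - grad_mu d \<Lambda> \<mu> A b c i) \<le> B"
      unfolding eq by linarith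
  qed
  show "spectral_norm d (\<lambda>i j. grad_Lambda d \<Lambda> \<mu> A' b' c' i j - grad_Lambda d \<Lambda> \<mu> A b c i j) \<le> B"
    unfolding spectral_norm_def
  proof (rule cSUP_least)
    have "norm2 d (\<lambda>_. 0) \<le> 1" by (simp add: norm2_def L2_set_def)
    then show "{v. norm2 d v \<le> 1} \<noteq> {}" by blast
    fix v assume "v \<in> {v. norm2 d v \<le> 1}"
    then have v: "norm2 d v \<le> 1" by simp
    let ?M = "\<lambda>i j. grad_Lambda d \<Lambda> \<mu> A' b' c' i j - grad_Lambda d \<Lambda> \<mu> A b c i j"
    show "norm2 d (mat_vec d ?M v) \<le> B"
    proof (rule norm2_le_if_inner_prod_le[OF _ B0])
      fix u assume u: "norm2 d u \<le> 1"
      have e: "(inner_prod d u (\<phi>' z) - inner_prod d u (\<phi> z)) * inner_prod d v z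
          = (\<Sum>i<d. \<Sum>j<d. (u i * v j) * (\<phi>' z i * z j - \<phi> z i * z j))" for z
      proof -
        have "inner_prod d u (\<phi>' z) - inner_prod d u (\<phi> z) = (\<Sum>i<d. u i * (\<phi>' z i - \<phi> z i))"
          by (simp add: inner_prod_def right_diff_distrib sum_subtractf)
        then show ?thesis
          unfolding inner_prod_def[of d v z] by (simp only: sum_product) (intro sum.cong refl, simp add: algebra_simps)
      qed
      have i0: "integrable (std_gaussian d) (\<lambda>z. (u i * v j) * (\<phi>' z i * z j - \<phi> z i * z j))" if "i < d" "j < d" for i j
        using that by (intro integrable_mult_right Bochner_Integration.integrable_diff int) auto
      have i1: "integrable (std_gaussian d) (\<lambda>z. (inner_prod d u (\<phi>' z) - inner_prod d u (\<phi> z)) * inner_prod d v z)"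
        unfolding e by (intro Bochner_Integration.integrable_sum i0) auto
      have "(\<integral>z. (inner_prod d u (\<phi>' z) - inner_prod d u (\<phi> z)) * inner_prod d v z \<partial>std_gaussian d)
         = (\<Sum>i<d. \<integral>z. (\<Sum>j<d. (u i * v j) * (\<phi>' z i * z j - \<phi> z i * z j)) \<partial>std_gaussian d)"
        unfolding e by (intro Bochner_Integration.integral_sum Bochner_Integration.integrable_sum i0) auto
      also have "\<dots> = (\<Sum>i<d. \<Sum>j<d. \<integral>z. (u i * v j) * (\<phi>' z i * z j - \<phi> z i * z j) \<partial>std_gaussian d)"
        by (intro sum.cong refl Bochner_Integration.integral_sum i0) auto
      also have "\<dots> = (\<Sum>i<d. \<Sum>j<d. (u i * v j) * - ?M i j)"
      proof (intro sum.cong refl)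
        fix i j assume "i \<in> {..<d}" "j \<in> {..<d}"
        then have "(\<integral>z. \<phi>' z i * z j - \<phi> z i * z j \<partial>std_gaussian d) = - ?M i j"
          using int(2)[of i j] int(4)[of i j] by (simp add: grad_Lambda_def \<phi>_def \<phi>'_def)
        then show "(\<integral>z. (u i * v j) * (\<phi>' z i * z j - \<phi> z i * z j) \<partial>std_gaussian d) = (u i * v j) * - ?M i j"
          by (simp only: integral_mult_right_zero)
      qed
      also have "\<dots> = - inner_prod d u (mat_vec d ?M v)"
        by (simp add: inner_prod_def mat_vec_def sum_distrib_left sum_negf[symmetric] algebra_simps)
      finally have eq: "(\<integral>z. (inner_prod d u (\<phi>' z) - inner_prod d u (\<phi> z)) * inner_prod d v z \<partial>std_gaussian d)
         = - inner_prod d u (mat_vec d ?M v)" .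
      have v2: "(\<integral>z. (inner_prod d v z)\<^sup>2 \<partial>std_gaussian d) \<le> 1"
      proof -
        have "(\<integral>z. (inner_prod d v z)\<^sup>2 \<partial>std_gaussian d) = (norm2 d v)\<^sup>2"
          using std_gaussian_inner_prod_mult[of d v v] unfolding norm2_sq inner_prod_def[of d v v]
          by (simp add: power2_eq_square)
        then show ?thesis using v by (simp add: power_le_one)
      qed
      have "\<bar>\<integral>z. (inner_prod d u (\<phi>' z) - inner_prod d u (\<phi> z)) * inner_prod d v z \<partial>std_gaussian d\<bar> \<le> B"
        unfolding \<phi>_def \<phi>'_def
        by (rule order_trans[OF grad_disc_difference_le[OF a u Z.inner_prod_measurable Z.integrable_inner_prod_sq v2] B])
           (use i1[unfolded \<phi>_def \<phi>'_def] in auto)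
      then show "inner_prod d u (mat_vec d ?M v) \<le> B" unfolding eq by linarith
    qed
  qed
qed

text \<open>The conclusion of the theorem for one generator, with separate bounds for value and
  gradients so that they can be relaxed independently.\<close>

definition losses_close ::
  "nat \<Rightarrow> real \<Rightarrow> rvec \<Rightarrow> rvec measure \<Rightarrow> rvec measure \<Rightarrow> rmat \<Rightarrow> rvec \<Rightarrow> real \<Rightarrow> real \<Rightarrow> bool" where
  "losses_close d lam w P' P \<Lambda> \<mu> r s \<longleftrightarrow>
    \<bar>gan_loss d lam w P' \<Lambda> \<mu> - gan_loss d lam w P \<Lambda> \<mu>\<bar> \<le> r \<and>
    (\<exists>g\<mu>' g\<mu> g\<Lambda>' g\<Lambda>.
       has_vec_gradient d (\<lambda>m. gan_loss d lam w P' \<Lambda> m) \<mu> g\<mu>' \<and>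
       has_vec_gradient d (\<lambda>m. gan_loss d lam w P \<Lambda> m) \<mu> g\<mu> \<and>
       has_mat_gradient d (\<lambda>L. gan_loss d lam w P' L \<mu>) \<Lambda> g\<Lambda>' \<and>
       has_mat_gradient d (\<lambda>L. gan_loss d lam w P L \<mu>) \<Lambda> g\<Lambda> \<and>
       norm2 d (\<lambda>i. g\<mu>' i - g\<mu> i) + spectral_norm d (\<lambda>i j. g\<Lambda>' i j - g\<Lambda> i j) \<le> s)"

lemma losses_close_mono:
  "losses_close d lam w P' P \<Lambda> \<mu> r s \<Longrightarrow> r \<le> r' \<Longrightarrow> s \<le> s' \<Longrightarrow> losses_close d lam w P' P \<Lambda> \<mu> r' s'"
  unfolding losses_close_def by (meson order_trans)

text \<open>The distance of the optimal matrices is governed by \<open>\<epsilon>\<close>, that of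
  the optimal vectors by \<open>\<Delta>\<close>. All four vectors lie within
  \<open>2 * a / lam\<close> of \<open>w\<close>, so deviations are needed only in the ball of
  radius \<open>\<beta>\<close>.\<close>

lemma gan_loss_comparison:
  assumes P: "l2_law P d" and P': "l2_law P' d" and lam: "0 < lam" and a: "0 < a" "a\<^sup>2 \<le> 3 / 2 * lam"
    and M: "frobenius_norm d (moment P) \<le> a\<^sup>2" and M': "frobenius_norm d (moment P') \<le> a\<^sup>2"
    and MQ: "frobenius_norm d (moment (affine_law d \<Lambda> \<mu>)) \<le> a\<^sup>2"
    and \<epsilon>: "frobenius_norm d (\<lambda>i j. moment P' i j - moment P i j) \<le> \<epsilon>"
    and \<beta>: "norm2 d w + 2 * a / lam < \<beta>"
    and \<Delta>: "\<And>c. norm2 d c < \<beta> \<Longrightarrow> norm2 d (\<lambda>k. avg_tanh d P' c k - avg_tanh d P c k) \<le> \<Delta>"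
  shows "losses_close d lam w P' P \<Lambda> \<mu> ((a\<^sup>2 * \<epsilon> + 4 * a * \<Delta>) / lam)
    ((a * \<epsilon> + 16 * \<Delta> * (4 + norm2 d w * a)) / lam)"
proof -
  interpret P: l2_law P d by (rule P)
  interpret P': l2_law P' d by (rule P')
  define Q where "Q = affine_law d \<Lambda> \<mu>"
  interpret Q: l2_law Q d unfolding Q_def by (rule l2_law_affine_law)
  note Ql = Q.l2_law_axioms
  have mb: "moment_bound d P a" "moment_bound d P' a" "moment_bound d Q a"
    using P.moment_bound_if_frobenius[OF M] P'.moment_bound_if_frobenius[OF M'] Q.moment_bound_if_frobenius MQ
    unfolding Q_def by auto
  have wb: "norm2 d b < \<beta>" "norm2 d b \<le> norm2 d w + 2 * a / lam" if "norm2 d (\<lambda>i. b i - w i) \<le> 2 * a / lam" for b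
    using norm2_triangle[of d w "\<lambda>i. b i - w i"] that \<beta> by auto
  obtain b where b: "strong_argmax d lam w P Q b" "norm2 d (\<lambda>i. b i - w i) \<le> 2 * a / lam"
    using strong_argmax_exists[OF P Ql lam mb(1,3) a] .
  obtain c where c: "strong_argmax d lam w Q P c" "norm2 d (\<lambda>i. c i - w i) \<le> 2 * a / lam"
    using strong_argmax_exists[OF Ql P lam mb(3,1) a] .
  obtain b' where b': "strong_argmax d lam w P' Q b'" "norm2 d (\<lambda>i. b' i - w i) \<le> 2 * a / lam"
    using strong_argmax_exists[OF P' Ql lam mb(2,3) a] .
  obtain c' where c': "strong_argmax d lam w Q P' c'" "norm2 d (\<lambda>i. c' i - w i) \<le> 2 * a / lam"
    using strong_argmax_exists[OF Ql P' lam mb(3,2) a] .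
  define A where "A = opt_matrix lam P Q"
  define A' where "A' = opt_matrix lam P' Q"
  have \<Delta>0: "0 \<le> \<Delta>" using \<Delta>[OF wb(1)[OF b(2)]] norm2_nonneg order_trans by blast
  have \<epsilon>0: "0 \<le> \<epsilon>" using \<epsilon> frobenius_norm_nonneg order_trans by blast
  have L: "\<bar>(avg_logcosh d P' x - avg_logcosh d P x) - (avg_logcosh d P' y - avg_logcosh d P y)\<bar>
      \<le> \<Delta> * norm2 d (\<lambda>i. x i - y i)" if "norm2 d x < \<beta>" "norm2 d y < \<beta>" for x y
    by (rule avg_logcosh_diff_Lipschitz[OF P' P \<Delta> that])
  have bb: "norm2 d (\<lambda>i. b' i - b i) \<le> 4 * \<Delta> / lam"
  proof (rule strong_argmax_stable[OF lam b(1) b'(1) _ \<Delta>0])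
    show "\<bar>(penalized d lam w P' Q b' - penalized d lam w P Q b') - (penalized d lam w P' Q b - penalized d lam w P Q b)\<bar>
      \<le> \<Delta> * norm2 d (\<lambda>i. b' i - b i)"
      using L[OF wb(1)[OF b'(2)] wb(1)[OF b(2)]] by (simp add: penalized_def)
  qed
  have cc: "norm2 d (\<lambda>i. c' i - c i) \<le> 4 * \<Delta> / lam"
  proof (rule strong_argmax_stable[OF lam c(1) c'(1) _ \<Delta>0])
    show "\<bar>(penalized d lam w Q P' c' - penalized d lam w Q P c') - (penalized d lam w Q P' c - penalized d lam w Q P c)\<bar>
      \<le> \<Delta> * norm2 d (\<lambda>i. c' i - c i)"
      using L[OF wb(1)[OF c'(2)] wb(1)[OF c(2)]] by (simp add: penalized_def)
  qed
  \<comment> \<open>This distance multiplies \<open>\<Delta>\<close> in the value: the deviations of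
    the two log-cosh averages are subtracted from each other.\<close>
  have bc: "norm2 d (\<lambda>i. x i - y i) \<le> 4 * a / lam"
    if "norm2 d (\<lambda>i. x i - w i) \<le> 2 * a / lam" "norm2 d (\<lambda>i. y i - w i) \<le> 2 * a / lam" for x y
  proof -
    have "norm2 d (\<lambda>i. (x i - w i) - (y i - w i)) \<le> 2 * a / lam + 2 * a / lam"
      by (rule order_trans[OF norm2_triangle_diff add_mono[OF that]])
    then show ?thesis by simp
  qed
  have opt: "frobenius_norm d (opt_matrix lam R Q) \<le> a\<^sup>2 / lam" if "frobenius_norm d (moment R) \<le> a\<^sup>2" for R
  proof -
    have "frobenius_norm d (opt_matrix lam R Q) = \<bar>1 / (2 * lam)\<bar> * frobenius_norm d (\<lambda>i j. moment R i j - moment Q i j)"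
      unfolding opt_matrix_def frobenius_norm_scale[symmetric] by simp
    also have "\<dots> \<le> \<bar>1 / (2 * lam)\<bar> * (a\<^sup>2 + a\<^sup>2)"
      using order_trans[OF frobenius_norm_triangle_diff add_mono[OF that MQ]]
      unfolding Q_def by (intro mult_left_mono) auto
    also have "\<dots> = a\<^sup>2 / lam" using lam by simp
    finally show ?thesis .
  qed
  have val: "\<bar>gan_value d lam w P' Q X x y - gan_value d lam w P Q X x y\<bar> \<le> (a\<^sup>2 * \<epsilon> + 4 * a * \<Delta>) / lam"
    if X: "frobenius_norm d X \<le> a\<^sup>2 / lam" and x: "norm2 d (\<lambda>i. x i - w i) \<le> 2 * a / lam" and y: "norm2 d (\<lambda>i. y i - w i) \<le> 2 * a / lam"
    for X x y
  proof -
    have "gan_value d lam w P' Q X x y - gan_value d lam w P Q X x y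
      = (\<Sum>i<d. \<Sum>j<d. X i j * (moment P' i j - moment P i j)) / 2
        + ((avg_logcosh d P' x - avg_logcosh d P x) - (avg_logcosh d P' y - avg_logcosh d P y))"
      unfolding gan_value_def P.expectation_disc(2) P'.expectation_disc(2)
      by (simp add: right_diff_distrib sum_subtractf diff_divide_distrib)
    moreover have "\<bar>\<Sum>i<d. \<Sum>j<d. X i j * (moment P' i j - moment P i j)\<bar> \<le> a\<^sup>2 / lam * \<epsilon>"
      using lam by (intro order_trans[OF sum_mult_le_frobenius] mult_mono X \<epsilon>) auto
    moreover have "\<bar>(avg_logcosh d P' x - avg_logcosh d P x) - (avg_logcosh d P' y - avg_logcosh d P y)\<bar> \<le> \<Delta> * (4 * a / lam)"
      by (rule order_trans[OF L[OF wb(1)[OF x] wb(1)[OF y]] mult_left_mono[OF bc[OF x y] \<Delta>0]])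
    moreover have "0 \<le> a\<^sup>2 / lam * \<epsilon>" using lam \<epsilon>0 by simp
    ultimately have "\<bar>gan_value d lam w P' Q X x y - gan_value d lam w P Q X x y\<bar> \<le> a\<^sup>2 / lam * \<epsilon> + \<Delta> * (4 * a / lam)"
      by linarith
    then show ?thesis by (simp add: add_divide_distrib mult_ac)
  qed
  have loss: "gan_loss d lam w P \<Lambda> \<mu> = gan_value d lam w P Q A b c"
    using gan_loss_eq_gan_value[OF P lam b(1)[unfolded Q_def] c(1)[unfolded Q_def]] unfolding Q_def A_def .
  have loss': "gan_loss d lam w P' \<Lambda> \<mu> = gan_value d lam w P' Q A' b' c'"
    using gan_loss_eq_gan_value[OF P' lam b'(1)[unfolded Q_def] c'(1)[unfolded Q_def]] unfolding Q_def A'_def .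
  \<comment> \<open>Each value is maximal at its own discriminator, so the difference of the maxima
    lies between the differences taken at these two discriminators.\<close>
  have max: "gan_value d lam w P Q A' b' c' \<le> gan_value d lam w P Q A b c"
    "gan_value d lam w P' Q A b c \<le> gan_value d lam w P' Q A' b' c'"
  proof -
    have nn: "0 \<le> lam / 8 * (x\<^sup>2 + y\<^sup>2 + z\<^sup>2)" for x y z :: real using lam by simp
    show "gan_value d lam w P Q A' b' c' \<le> gan_value d lam w P Q A b c"
      unfolding A_def
      by (meson diff_le_eq gan_value_le[OF P Ql lam b(1) c(1)] le_add_same_cancel1 order_trans nn)
    show "gan_value d lam w P' Q A b c \<le> gan_value d lam w P' Q A' b' c'"
      unfolding A'_def
      by (meson diff_le_eq gan_value_le[OF P' Ql lam b'(1) c'(1)] le_add_same_cancel1 order_trans nn)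
  qed
  have loss_le: "\<bar>gan_loss d lam w P' \<Lambda> \<mu> - gan_loss d lam w P \<Lambda> \<mu>\<bar> \<le> (a\<^sup>2 * \<epsilon> + 4 * a * \<Delta>) / lam"
    using val[OF opt[OF M] b(2) c(2)] val[OF opt[OF M'] b'(2) c'(2)] max
    unfolding loss loss' A_def[symmetric] A'_def[symmetric] by linarith
  have AA: "frobenius_norm d (\<lambda>i j. A' i j - A i j) \<le> \<epsilon> / (2 * lam)"
  proof -
    have "(\<lambda>i j. A' i j - A i j) = (\<lambda>i j. 1 / (2 * lam) * (moment P' i j - moment P i j))"
      by (simp add: A_def A'_def opt_matrix_def diff_divide_distrib fun_eq_iff)
    then have "frobenius_norm d (\<lambda>i j. A' i j - A i j) = \<bar>1 / (2 * lam)\<bar> * frobenius_norm d (\<lambda>i j. moment P' i j - moment P i j)"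
      by (simp only: frobenius_norm_scale)
    also have "\<dots> \<le> \<bar>1 / (2 * lam)\<bar> * \<epsilon>" by (intro mult_left_mono \<epsilon>) auto
    finally show ?thesis using lam by simp
  qed
  \<comment> \<open>The term \<open>2 * a / lam\<close> of the radius contributes
    \<open>2 * a\<^sup>2 / lam \<le> 3\<close>, so this factor stays bounded however small
    \<open>lam\<close> is.\<close>
  have ba: "1 + norm2 d x * a \<le> 4 + norm2 d w * a" if "norm2 d (\<lambda>i. x i - w i) \<le> 2 * a / lam" for x
  proof -
    have "norm2 d x * a \<le> (norm2 d w + 2 * a / lam) * a" using wb(2)[OF that] a by (intro mult_right_mono) auto
    also have "\<dots> = norm2 d w * a + 2 * (a\<^sup>2 / lam)" by (simp add: algebra_simps power2_eq_square)
    also have "a\<^sup>2 / lam \<le> 3 / 2" using a lam by (simp add: field_simps)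
    finally show ?thesis by simp
  qed
  \<comment> \<open>Half of the target, because the two gradient norms are bounded separately and
    then added.\<close>
  define B where "B = (a * \<epsilon> + 16 * \<Delta> * (4 + norm2 d w * a)) / lam / 2"
  have grad: "frobenius_norm d (\<lambda>i j. A' i j - A i j) * a
      + norm2 d (\<lambda>i. b' i - b i) * (1 + norm2 d b * a) + norm2 d (\<lambda>i. c' i - c i) * (1 + norm2 d c * a) \<le> B"
  proof -
    have "frobenius_norm d (\<lambda>i j. A' i j - A i j) * a \<le> \<epsilon> / (2 * lam) * a"
      using a by (intro mult_right_mono AA) auto
    moreover have "norm2 d (\<lambda>i. b' i - b i) * (1 + norm2 d b * a) \<le> 4 * \<Delta> / lam * (4 + norm2 d w * a)"
      by (rule mult_mono[OF bb ba[OF b(2)]]) (use a lam \<Delta>0 in auto)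
    moreover have "norm2 d (\<lambda>i. c' i - c i) * (1 + norm2 d c * a) \<le> 4 * \<Delta> / lam * (4 + norm2 d w * a)"
      by (rule mult_mono[OF cc ba[OF c(2)]]) (use a lam \<Delta>0 in auto)
    ultimately have "frobenius_norm d (\<lambda>i j. A' i j - A i j) * a
      + norm2 d (\<lambda>i. b' i - b i) * (1 + norm2 d b * a) + norm2 d (\<lambda>i. c' i - c i) * (1 + norm2 d c * a)
      \<le> \<epsilon> / (2 * lam) * a + 4 * \<Delta> / lam * (4 + norm2 d w * a) + 4 * \<Delta> / lam * (4 + norm2 d w * a)"
      by linarith
    also have "\<dots> = B" using lam by (simp add: B_def field_simps)
    finally show ?thesis .
  qed
  note G = gradient_difference_le[OF mb(3)[unfolded Q_def] a(1) grad]
  have "norm2 d (\<lambda>i. grad_mu d \<Lambda> \<mu> A' b' c' i - grad_mu d \<Lambda> \<mu> A b c i)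
      + spectral_norm d (\<lambda>i j. grad_Lambda d \<Lambda> \<mu> A' b' c' i j - grad_Lambda d \<Lambda> \<mu> A b c i j)
     \<le> (a * \<epsilon> + 16 * \<Delta> * (4 + norm2 d w * a)) / lam"
    using G unfolding B_def by linarith
  then show ?thesis
    unfolding losses_close_def using loss_le gan_loss_gradients[OF P lam b(1)[unfolded Q_def] c(1)[unfolded Q_def] A_def[unfolded Q_def]]
      gan_loss_gradients[OF P' lam b'(1)[unfolded Q_def] c'(1)[unfolded Q_def] A'_def[unfolded Q_def]]
    by blast
qed

subsection \<open>The uniform generalisation bound\<close>

lemma integral_empirical:
  fixes f :: "rvec \<Rightarrow> real"
  assumes "0 < n"
  shows "(\<integral>x. f x \<partial>empirical n xs) = (\<Sum>j<n. f (xs j)) / n"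
  using assms unfolding empirical_def by (simp add: integral_pmf_of_set lessThan_empty_iff)

lemma l2_law_empirical:
  assumes "0 < n"
  shows "l2_law (empirical n xs) d"
proof -
  interpret prob_space "empirical n xs"
    unfolding empirical_def by (rule prob_space_measure_pmf)
  show ?thesis
  proof
    show "(\<lambda>x. x k) \<in> borel_measurable (empirical n xs)" for k by (simp add: empirical_def)
    show "integrable (empirical n xs) (\<lambda>x. (x k)\<^sup>2)" for k
      unfolding empirical_def using assms
      by (intro integrable_measure_pmf_finite) (simp add: set_pmf_of_set lessThan_empty_iff)
  qed
qed

context subgaussian_law
begin

text \<open>The generator does not occur: one event, which is the complement of two exceptional
  ones, controls all data quantities that the comparison of losses uses. This is the source of the
  uniformity in \<open>\<mu>\<close> and \<open>\<Lambda>\<close>.\<close>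

lemma empirical_concentration:
  assumes d: "0 < d" and n: "0 < n" and \<beta>: "0 < \<beta>" and \<tau>: "0 < \<tau>" "\<tau> \<le> 50"
  obtains E where "E \<in> sets (sample_measure n)"
    "measure (sample_measure n) E \<ge> 1 - 16 * exp (- (n * \<tau>\<^sup>2 / 1600))"
    "\<And>xs. xs \<in> E \<Longrightarrow> frobenius_norm d (\<lambda>i j. moment (empirical n xs) i j - moment P i j) \<le> total_var * \<tau>"
    "\<And>xs b. xs \<in> E \<Longrightarrow> norm2 d b < \<beta> \<Longrightarrow>
      norm2 d (\<lambda>k. avg_tanh d (empirical n xs) b k - avg_tanh d P b k) \<le> \<beta> * total_var * \<tau>"
proof -
  interpret S: prob_space "sample_measure n" by (rule prob_space_sample)
  obtain A where A: "A \<in> sets (sample_measure n)"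
    "emeasure (sample_measure n) A \<le> ennreal (8 * exp (- (n * \<tau>\<^sup>2 / 1600)))"
    "\<And>xs b. xs \<in> space (sample_measure n) - A \<Longrightarrow> norm2 d b < \<beta> \<Longrightarrow>
      norm2 d (\<lambda>k. \<Sum>i<n. centered tanh k b (xs i)) \<le> n * (\<beta> * total_var * \<tau>)"
    using tanh_dev_uniform[OF d \<beta> \<tau>] by blast
  define A' where "A' = {xs \<in> space (sample_measure n).
      n * (total_var * \<tau>) < L2_set (\<lambda>(k, l). \<Sum>i<n. cov_dev k l (xs i)) ({..<d} \<times> {..<d})}"
  have A'm: "A' \<in> sets (sample_measure n)"
  proof -
    have "(\<lambda>xs. L2_set (\<lambda>(k, l). \<Sum>i<n. cov_dev k l (xs i)) ({..<d} \<times> {..<d})) \<in> borel_measurable (sample_measure n)"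
      unfolding L2_set_def case_prod_beta'
      by (intro borel_measurable_sqrt[THEN measurable_compose[rotated]] borel_measurable_sum borel_measurable_power
          sample_cov_dev_measurable) auto
    then show ?thesis unfolding A'_def by measurable
  qed
  have A': "emeasure (sample_measure n) A' \<le> ennreal (8 * exp (- (n * \<tau>\<^sup>2 / 1600)))"
    unfolding A'_def by (rule cov_dev_tail[OF d \<tau>])
  define E where "E = space (sample_measure n) - (A \<union> A')"
  have n0: "real n * x / n = x" "(real n * x) / real n = x" for x using n by simp_all
  show ?thesis
  proof (rule that[of E])
    show "E \<in> sets (sample_measure n)" unfolding E_def using A(1) A'm by auto
    have "S.prob (A \<union> A') \<le> S.prob A + S.prob A'" using A(1) A'm by (intro measure_Un_le) auto
    also have "\<dots> \<le> 8 * exp (- (n * \<tau>\<^sup>2 / 1600)) + 8 * exp (- (n * \<tau>\<^sup>2 / 1600))"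
      using A(2) A' by (intro add_mono) (simp_all add: S.emeasure_eq_measure)
    finally show "S.prob E \<ge> 1 - 16 * exp (- (n * \<tau>\<^sup>2 / 1600))"
      unfolding E_def using A(1) A'm by (subst S.prob_compl) auto
    fix xs assume xs: "xs \<in> E"
    show "frobenius_norm d (\<lambda>i j. moment (empirical n xs) i j - moment P i j) \<le> total_var * \<tau>"
    proof -
      have "moment (empirical n xs) i j - moment P i j = 1 / n * (\<Sum>r<n. cov_dev i j (xs r))" for i j
        using n by (simp add: moment_def integral_empirical[OF n] cov_dev_def sum_subtractf field_simps)
      then have "frobenius_norm d (\<lambda>i j. moment (empirical n xs) i j - moment P i j)
         = \<bar>1 / n\<bar> * frobenius_norm d (\<lambda>i j. \<Sum>r<n. cov_dev i j (xs r))"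
        by (simp only: frobenius_norm_scale)
      also have "\<dots> \<le> \<bar>1 / n\<bar> * (n * (total_var * \<tau>))"
        using xs unfolding E_def A'_def frobenius_norm_def by (intro mult_left_mono) auto
      also have "\<dots> = total_var * \<tau>" using n by simp
      finally show ?thesis .
    qed
    fix b assume b: "norm2 d b < \<beta>"
    have "avg_tanh d (empirical n xs) b k - avg_tanh d P b k = 1 / n * (\<Sum>r<n. centered tanh k b (xs r))" for k
      using n by (simp add: avg_tanh_def integral_empirical[OF n] centered_def sum_subtractf field_simps)
    then have "norm2 d (\<lambda>k. avg_tanh d (empirical n xs) b k - avg_tanh d P b k)
       = \<bar>1 / n\<bar> * norm2 d (\<lambda>k. \<Sum>r<n. centered tanh k b (xs r))"
      by (simp only: norm2_scale)
    also have "\<dots> \<le> \<bar>1 / n\<bar> * (n * (\<beta> * total_var * \<tau>))"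
      using A(3)[OF _ b] xs unfolding E_def by (intro mult_left_mono) auto
    also have "\<dots> = \<beta> * total_var * \<tau>" using n by simp
    finally show "norm2 d (\<lambda>k. avg_tanh d (empirical n xs) b k - avg_tanh d P b k) \<le> \<beta> * total_var * \<tau>" .
  qed
qed

end

lemma sym_mixture_uniform_bounds:
  fixes B R :: real
  assumes d: "1 \<le> d" and n: "1 \<le> n" and lam: "0 < lam" and B: "0 \<le> B" and R: "0 \<le> R"
    and m: "second_moment d (sym_mixture d \<mu>X SX) \<le> B" "second_moment d (sym_mixture d \<mu>X SX) \<le> lam"
    and w: "norm2 d w \<le> R" and \<tau>: "0 < \<tau>" "\<tau> \<le> 1 / (4 * (B + 1))"
  obtains E where "E \<in> sets (\<Pi>\<^sub>M j\<in>{..<n}. sym_mixture d \<mu>X SX)"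
    "measure (\<Pi>\<^sub>M j\<in>{..<n}. sym_mixture d \<mu>X SX) E \<ge> 1 - 16 * exp (- (n * \<tau>\<^sup>2 / 1600))"
    "\<And>xs \<mu> \<Lambda>. xs \<in> E \<Longrightarrow>
       frobenius_norm d (\<lambda>i j. \<mu> i * \<mu> j + gram d \<Lambda> i j) \<le> second_moment d (sym_mixture d \<mu>X SX) \<Longrightarrow>
       losses_close d lam w (empirical n xs) (sym_mixture d \<mu>X SX) \<Lambda> \<mu>
         (16 * (R + 5) * (B + 1)\<^sup>2 * (R * (B + 1) + 5) * (\<tau> / lam))
         (16 * (R + 5) * (B + 1)\<^sup>2 * (R * (B + 1) + 5) * (\<tau> / lam))"
proof -
  define P where "P = sym_mixture d \<mu>X SX"
  \<comment> \<open>The positive amount added to the variances, shared out as \<open>l1 / d\<close>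
    so that its total is free of \<open>d\<close>. The cap \<open>lam\<close> protects the concavity
    condition, the cap 1 keeps the total variance below \<open>B + 1\<close>.\<close>
  define l1 where "l1 = min lam 1"
  have l1: "0 < l1" "l1 \<le> lam" "l1 \<le> 1" using lam by (auto simp: l1_def)
  interpret X: subgaussian_law P d "\<lambda>k. moment P k k + l1 / d"
    unfolding P_def by (rule subgaussian_law_sym_mixture) (use l1 d in simp)
  have Pl: "l2_law P d" by (rule X.l2_law_axioms)
  define m where "m = second_moment d P"
  have m0: "0 \<le> m" "m \<le> B" "m \<le> lam" using m by (auto simp: m_def P_def second_moment_def)
  have tv: "X.total_var = m + l1"
    using d by (simp add: X.total_var_def m_def X.second_moment_eq sum.distrib)
  \<comment> \<open>Half of \<open>l1\<close> is reserved for the sampling error, so that the same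
    \<open>a\<close> bounds the population, empirical and generator moments.\<close>
  define a where "a = sqrt (m + l1 / 2)"
  have a2: "a\<^sup>2 = m + l1 / 2" using m0 l1 by (simp add: a_def)
  have a0: "0 < a" using m0 l1 by (simp add: a_def)
  have B1: "1 \<le> B + 1" using B by simp
  have aB: "a \<le> B + 1" "a\<^sup>2 \<le> B + 1"
  proof -
    show le: "a\<^sup>2 \<le> B + 1" using m0 l1 by (simp add: a2)
    have "(B + 1) * 1 \<le> (B + 1) * (B + 1)" using B1 by (intro mult_left_mono) auto
    then have "a\<^sup>2 \<le> (B + 1)\<^sup>2" using le by (simp add: power2_eq_square)
    then show "a \<le> B + 1" by (rule power2_le_imp_le) (use B in simp)
  qed
  have alam: "a\<^sup>2 \<le> 3 / 2 * lam" using m0 l1 by (simp add: a2)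
  \<comment> \<open>Radius of a ball around 0 that contains every maximiser; the extra 1 makes the
    inclusion strict.\<close>
  define \<beta> where "\<beta> = R + 1 + 2 * a / lam"
  have \<beta>: "0 < \<beta>" using R a0 lam by (simp add: \<beta>_def add_nonneg_pos add_pos_nonneg)
  have \<tau>4: "\<tau> \<le> 1 / 4"
  proof -
    have "1 / (4 * (B + 1)) \<le> 1 / 4" using B by (simp add: field_simps)
    then show ?thesis using \<tau> by linarith
  qed
  then have \<tau>50: "\<tau> \<le> 50" by linarith
  have d0: "0 < d" and n0: "0 < n" using d n by auto
  obtain E where E: "E \<in> sets (X.sample_measure n)"
    "measure (X.sample_measure n) E \<ge> 1 - 16 * exp (- (n * \<tau>\<^sup>2 / 1600))"
    "\<And>xs. xs \<in> E \<Longrightarrow> frobenius_norm d (\<lambda>i j. moment (empirical n xs) i j - moment P i j) \<le> X.total_var * \<tau>"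
    "\<And>xs b. xs \<in> E \<Longrightarrow> norm2 d b < \<beta> \<Longrightarrow>
      norm2 d (\<lambda>k. avg_tanh d (empirical n xs) b k - avg_tanh d P b k) \<le> \<beta> * X.total_var * \<tau>"
    using X.empirical_concentration[OF d0 n0 \<beta> \<tau>(1) \<tau>50] by blast
  define \<epsilon> where "\<epsilon> = (m + l1) * \<tau>"
  define \<Delta> where "\<Delta> = \<beta> * (m + l1) * \<tau>"
  have \<epsilon>0: "0 \<le> \<epsilon>" and \<Delta>0: "0 \<le> \<Delta>" using m0 l1 \<tau> \<beta> by (simp_all add: \<epsilon>_def \<Delta>_def)
  have \<epsilon>B: "\<epsilon> \<le> (B + 1) * \<tau>" unfolding \<epsilon>_def using m0 l1 \<tau> by (intro mult_right_mono) auto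
  \<comment> \<open>For \<open>lam \<le> 1\<close> the total variance is at most
    \<open>2 * l1\<close> and \<open>\<tau> \<le> 1 / 4\<close> is enough. For larger
    \<open>lam\<close> the room is the constant \<open>1 / 2\<close>, and the bound on
    \<open>\<tau>\<close> in terms of \<open>B\<close> provides it.\<close>
  have \<epsilon>l: "\<epsilon> \<le> l1 / 2"
  proof (cases "lam \<le> 1")
    case True
    then have "m + l1 \<le> 2 * l1" using m0 by (simp add: l1_def)
    then have "(m + l1) * \<tau> \<le> (2 * l1) * (1 / 4)" using \<tau>(1) \<tau>4 l1 by (intro mult_mono) auto
    then show ?thesis by (simp add: \<epsilon>_def)
  next
    case False
    then have l: "l1 = 1" by (simp add: l1_def)
    have "(B + 1) * \<tau> \<le> (B + 1) * (1 / (4 * (B + 1)))" using \<tau> B by (intro mult_left_mono) auto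
    also have "\<dots> = 1 / 4" using B by (simp add: field_simps)
    finally show ?thesis using \<epsilon>B l by simp
  qed
  have \<Delta>B: "\<Delta> \<le> (R + 5) * (B + 1) * \<tau>"
  proof -
    \<comment> \<open>Here the two powers of \<open>lam\<close> cancel: the radius is of order
      \<open>a / lam\<close>, the total variance at most \<open>2 * lam\<close>.\<close>
    have "2 * a / lam * (m + l1) \<le> 2 * a / lam * (2 * lam)"
      using m0 l1 a0 lam by (intro mult_left_mono) auto
    also have "\<dots> = 4 * a" using lam by simp
    also have "\<dots> \<le> 4 * (B + 1)" using aB by simp
    finally have "2 * a / lam * (m + l1) \<le> 4 * (B + 1)" .
    moreover have "(R + 1) * (m + l1) \<le> (R + 1) * (B + 1)" using R m0 l1 by (intro mult_left_mono) auto
    ultimately have "\<beta> * (m + l1) \<le> (R + 5) * (B + 1)" by (simp add: \<beta>_def algebra_simps)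
    then show ?thesis unfolding \<Delta>_def using \<tau> by (intro mult_right_mono) auto
  qed
  \<comment> \<open>One generous constant that covers both the value and the gradients.\<close>
  define K where "K = 16 * (R + 5) * (B + 1)\<^sup>2 * (R * (B + 1) + 5)"
  have RB: "0 \<le> R * (B + 1)" using R B by simp
  have val: "(a\<^sup>2 * \<epsilon> + 4 * a * \<Delta>) / lam \<le> K * (\<tau> / lam)"
  proof -
    have "a\<^sup>2 * \<epsilon> + 4 * a * \<Delta> \<le> (B + 1) * ((B + 1) * \<tau>) + 4 * (B + 1) * ((R + 5) * (B + 1) * \<tau>)"
      using aB \<epsilon>B \<Delta>B \<epsilon>0 \<Delta>0 a0 B by (intro add_mono mult_mono) auto
    also have "\<dots> = (1 + 4 * (R + 5)) * ((B + 1)\<^sup>2 * \<tau>)" by (simp add: power2_eq_square algebra_simps)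
    also have "\<dots> \<le> (16 * (R + 5) * (R * (B + 1) + 5)) * ((B + 1)\<^sup>2 * \<tau>)"
    proof (rule mult_right_mono)
      have "1 + 4 * (R + 5) \<le> 16 * (R + 5) * 5" using R by simp
      also have "\<dots> \<le> 16 * (R + 5) * (R * (B + 1) + 5)" using R RB by (intro mult_left_mono) auto
      finally show "1 + 4 * (R + 5) \<le> 16 * (R + 5) * (R * (B + 1) + 5)" .
    qed (use \<tau> in simp)
    also have "\<dots> = K * \<tau>" by (simp add: K_def mult_ac)
    finally show ?thesis using lam by (simp add: divide_right_mono)
  qed
  have grd: "(a * \<epsilon> + 16 * \<Delta> * (4 + norm2 d w * a)) / lam \<le> K * (\<tau> / lam)"
  proof -
    have "norm2 d w * a \<le> R * (B + 1)" using w aB a0 R by (intro mult_mono) auto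
    then have "a * \<epsilon> + 16 * \<Delta> * (4 + norm2 d w * a) \<le> (B + 1) * ((B + 1) * \<tau>) + 16 * ((R + 5) * (B + 1) * \<tau>) * (4 + R * (B + 1))"
      using aB \<epsilon>B \<Delta>B \<epsilon>0 \<Delta>0 a0 B R \<tau> RB by (intro add_mono[OF mult_mono mult_mono]) auto
    also have "\<dots> = (B + 1)\<^sup>2 * \<tau> + 16 * (R + 5) * (4 + R * (B + 1)) * ((B + 1) * \<tau>)"
      by (simp add: power2_eq_square algebra_simps)
    also have "\<dots> \<le> (B + 1)\<^sup>2 * \<tau> + 16 * (R + 5) * (4 + R * (B + 1)) * ((B + 1)\<^sup>2 * \<tau>)"
    proof (intro add_left_mono mult_left_mono mult_right_mono)
      have "(B + 1) * 1 \<le> (B + 1) * (B + 1)" using B1 by (intro mult_left_mono) auto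
      then show "B + 1 \<le> (B + 1)\<^sup>2" by (simp add: power2_eq_square)
    qed (use R RB \<tau> in auto)
    also have "\<dots> = (1 + 16 * (R + 5) * (4 + R * (B + 1))) * ((B + 1)\<^sup>2 * \<tau>)" by (simp add: algebra_simps)
    also have "\<dots> \<le> (16 * (R + 5) * (R * (B + 1) + 5)) * ((B + 1)\<^sup>2 * \<tau>)"
    proof (rule mult_right_mono)
      have "16 * (R + 5) * (R * (B + 1) + 5) = 16 * (R + 5) * (4 + R * (B + 1)) + 16 * (R + 5)"
        by (simp add: algebra_simps)
      then show "1 + 16 * (R + 5) * (4 + R * (B + 1)) \<le> 16 * (R + 5) * (R * (B + 1) + 5)" using R by simp
    qed (use \<tau> in simp)
    also have "\<dots> = K * \<tau>" by (simp add: K_def mult_ac)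
    finally show ?thesis using lam by (simp add: divide_right_mono)
  qed
  show ?thesis
  proof (rule that[of E])
    show "E \<in> sets (\<Pi>\<^sub>M j\<in>{..<n}. sym_mixture d \<mu>X SX)" using E(1) by (simp add: P_def)
    show "measure (\<Pi>\<^sub>M j\<in>{..<n}. sym_mixture d \<mu>X SX) E \<ge> 1 - 16 * exp (- (n * \<tau>\<^sup>2 / 1600))"
      using E(2) by (simp add: P_def)
    fix xs \<mu> \<Lambda>
    assume xs: "xs \<in> E" and F: "frobenius_norm d (\<lambda>i j. \<mu> i * \<mu> j + gram d \<Lambda> i j) \<le> second_moment d (sym_mixture d \<mu>X SX)"
    define P' where "P' = empirical n xs"
    have P': "l2_law P' d" unfolding P'_def using n by (intro l2_law_empirical) simp
    have M: "frobenius_norm d (moment P) \<le> m" unfolding m_def by (rule X.frobenius_norm_moment_le)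
    have MM: "frobenius_norm d (\<lambda>i j. moment P' i j - moment P i j) \<le> \<epsilon>"
      using E(3)[OF xs] by (simp add: P'_def \<epsilon>_def tv)
    have M': "frobenius_norm d (moment P') \<le> m + \<epsilon>"
      using frobenius_norm_triangle[of d "moment P" "\<lambda>i j. moment P' i j - moment P i j"] M MM by simp
    have MQ: "frobenius_norm d (moment (affine_law d \<Lambda> \<mu>)) \<le> m"
    proof -
      have "frobenius_norm d (moment (affine_law d \<Lambda> \<mu>)) = frobenius_norm d (\<lambda>i j. \<mu> i * \<mu> j + gram d \<Lambda> i j)"
        unfolding frobenius_norm_def by (rule L2_set_cong) (auto simp: moment_affine_law)
      then show ?thesis using F by (simp add: m_def P_def)
    qed
    have "norm2 d w + 2 * a / lam < \<beta>" using w by (simp add: \<beta>_def)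
    note cmp = gan_loss_comparison[OF Pl P' lam a0 alam _ _ _ MM this, of \<Lambda> \<mu> \<Delta>]
    have dev: "norm2 d (\<lambda>k. avg_tanh d P' c k - avg_tanh d P c k) \<le> \<Delta>" if "norm2 d c < \<beta>" for c
      using E(4)[OF xs that] by (simp add: P'_def \<Delta>_def tv)
    have "frobenius_norm d (moment P) \<le> a\<^sup>2" "frobenius_norm d (moment P') \<le> a\<^sup>2"
      "frobenius_norm d (moment (affine_law d \<Lambda> \<mu>)) \<le> a\<^sup>2"
      using M M' MQ \<epsilon>l l1 unfolding a2 by linarith+
    from losses_close_mono[OF cmp[OF this dev] val grd]
    show "losses_close d lam w (empirical n xs) (sym_mixture d \<mu>X SX) \<Lambda> \<mu>
         (16 * (R + 5) * (B + 1)\<^sup>2 * (R * (B + 1) + 5) * (\<tau> / lam))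
         (16 * (R + 5) * (B + 1)\<^sup>2 * (R * (B + 1) + 5) * (\<tau> / lam))"
      unfolding P_def P'_def K_def .
  qed
qed

text \<open>The choice of \<open>\<tau>\<close> makes the exponent equal to \<open>K * l\<close>. As
  \<open>l \<ge> l0\<close>, the summand \<open>ln 16 / l0\<close> of \<open>K\<close> pays for the
  numerical factor 16 in the probability. The number 25600 is 1600 times 16 and turns the sample
  size condition into the upper bound on \<open>\<tau>\<close>.\<close>

lemma sample_size_calibration:
  fixes l l0 B :: real
  assumes l0: "0 < l0" "l0 \<le> l" and B: "0 \<le> B" and n: "1 \<le> n"
    and K: "K = 1 + ln 16 / l0" and big: "real n \<ge> 25600 * K * (B + 1)\<^sup>2 * l"
    and \<tau>: "\<tau> = 40 * sqrt K * sqrt (l / n)"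
  shows "0 < \<tau>" "\<tau> \<le> 1 / (4 * (B + 1))" "16 * exp (- (n * \<tau>\<^sup>2 / 1600)) \<le> exp (- l)"
proof -
  have ln16: "0 < ln (16::real)" by simp
  have K1: "1 \<le> K" using l0 ln16 by (simp add: K)
  have l: "0 < l" using l0 by simp
  have \<tau>2: "\<tau>\<^sup>2 = 1600 * K * (l / n)" using K1 l by (simp add: \<tau> power_mult_distrib)
  show "0 < \<tau>" using K1 l n by (simp add: \<tau>)
  show "\<tau> \<le> 1 / (4 * (B + 1))"
  proof (rule power2_le_imp_le)
    have "1600 * K * l * (16 * (B + 1)\<^sup>2) \<le> n" using big by (simp add: mult_ac)
    then have "1600 * K * (l / n) \<le> 1 / (16 * (B + 1)\<^sup>2)"
      using n B by (simp add: field_simps)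
    moreover have "(1 / (4 * (B + 1)))\<^sup>2 = 1 / (16 * (B + 1)\<^sup>2)"
      by (simp only: power_divide power_mult_distrib) simp
    ultimately show "\<tau>\<^sup>2 \<le> (1 / (4 * (B + 1)))\<^sup>2" by (simp only: \<tau>2)
  qed (use B in simp)
  have "n * \<tau>\<^sup>2 / 1600 = K * l" using n by (simp add: \<tau>2)
  moreover have "ln 16 + l \<le> K * l"
  proof -
    have "ln 16 / l0 * l0 \<le> ln 16 / l0 * l" using l0 ln16 by (intro mult_left_mono) auto
    then show ?thesis using l0 by (simp add: K distrib_right)
  qed
  ultimately have "exp (- (n * \<tau>\<^sup>2 / 1600)) \<le> exp (- (ln 16 + l))" by simp
  also have "\<dots> = exp (- l) / 16" by (simp add: exp_diff exp_minus exp_add divide_simps)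
  finally show "16 * exp (- (n * \<tau>\<^sup>2 / 1600)) \<le> exp (- l)" by simp
qed

text \<open>The constants behind the order symbols depend only on \<open>B\<close>, \<open>R\<close>
  and \<open>\<delta>0\<close>, not on the dimension, \<open>lam\<close>, the laws or the feasible
  set. Keeping \<open>\<delta>\<close> below \<open>\<delta>0 < 1\<close> bounds
  \<open>ln (1 / \<delta>)\<close> away from 0, and the bounds refer to samples of size at least
  \<open>N * ln (1 / \<delta>)\<close>. Existence of all gradients is part of the claim.\<close>

theorem theorem5:
  fixes B R \<delta>0 :: real
  assumes "\<delta>0 < 1"
  shows "\<exists>C>0. \<exists>N>0.
    \<forall>(d::nat) (lam::real) (w::rvec) (\<mu>X::rvec) (SX::rmat) (F::(rmat \<times> rvec) set) (\<rho>::real)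
      (n::nat) (\<delta>::real).
      d \<ge> 1 \<longrightarrow> lam > 0 \<longrightarrow> psd d SX \<longrightarrow>
      second_moment d (sym_mixture d \<mu>X SX) \<le> B \<longrightarrow> norm2 d w \<le> R \<longrightarrow>
      separable d \<mu>X SX w \<longrightarrow>
      is_max_first_moment d F \<rho> \<longrightarrow>
      (\<forall>(\<Lambda>, \<mu>)\<in>F. \<forall>v. norm2 d (\<lambda>i. v i - w i) \<le> \<rho> / lam \<longrightarrow> separable d \<mu> (gram d \<Lambda>) v) \<longrightarrow>
      (\<forall>(\<Lambda>, \<mu>)\<in>F. second_moment d (sym_mixture d \<mu>X SX) + gen_second_moment d \<Lambda> \<mu> \<le> lam) \<longrightarrow>
      0 < \<delta> \<longrightarrow> \<delta> \<le> \<delta>0 \<longrightarrow> n \<ge> 1 \<longrightarrow> real n \<ge> N * ln (1 / \<delta>) \<longrightarrow>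
      (\<exists>E \<in> sets (\<Pi>\<^sub>M j\<in>{..<n}. sym_mixture d \<mu>X SX).
         measure (\<Pi>\<^sub>M j\<in>{..<n}. sym_mixture d \<mu>X SX) E \<ge> 1 - \<delta> \<and>
         (\<forall>xs\<in>E. \<forall>\<mu> \<Lambda>.
            frobenius_norm d (\<lambda>i j. \<mu> i * \<mu> j + gram d \<Lambda> i j)
              \<le> second_moment d (sym_mixture d \<mu>X SX) \<longrightarrow>
            \<bar>gan_loss d lam w (empirical n xs) \<Lambda> \<mu>
               - gan_loss d lam w (sym_mixture d \<mu>X SX) \<Lambda> \<mu>\<bar>
              \<le> C * sqrt ((real d)\<^sup>2 * ln (1 / \<delta>) / (lam\<^sup>2 * real n)) \<and>
            (\<exists>g\<mu>' g\<mu> g\<Lambda>' g\<Lambda>.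
               has_vec_gradient d (\<lambda>m. gan_loss d lam w (empirical n xs) \<Lambda> m) \<mu> g\<mu>' \<and>
               has_vec_gradient d (\<lambda>m. gan_loss d lam w (sym_mixture d \<mu>X SX) \<Lambda> m) \<mu> g\<mu> \<and>
               has_mat_gradient d (\<lambda>L. gan_loss d lam w (empirical n xs) L \<mu>) \<Lambda> g\<Lambda>' \<and>
               has_mat_gradient d (\<lambda>L. gan_loss d lam w (sym_mixture d \<mu>X SX) L \<mu>) \<Lambda> g\<Lambda> \<and>
               norm2 d (\<lambda>i. g\<mu>' i - g\<mu> i) + spectral_norm d (\<lambda>i j. g\<Lambda>' i j - g\<Lambda> i j)
                 \<le> C * sqrt (real d * ln (1 / \<delta>) / (lam\<^sup>2 * real n)))))"
proof (cases "0 < \<delta>0 \<and> 0 \<le> B \<and> 0 \<le> R")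
  \<comment> \<open>Second moments and norms are nonnegative and \<open>\<delta>\<close> is
    positive, so a wrong sign of \<open>B\<close>, \<open>R\<close> or \<open>\<delta>0\<close>
    contradicts the premises and any constants do.\<close>
  case False
  have "0 \<le> second_moment d P" "0 \<le> norm2 d w" for d P w
    by (simp_all add: second_moment_def)
  note nn = this
  show ?thesis
  proof (intro exI[of _ 1] conjI allI impI, goal_cases)
    case (3 d lam w \<mu>X SX F \<rho> n \<delta>)
    then have False using False nn order_trans order_less_le_trans by metis
    then show ?case ..
  qed simp_all
next
  case True
  then have \<delta>0: "0 < \<delta>0" and B: "0 \<le> B" and R: "0 \<le> R" by auto
  define l0 where "l0 = ln (1 / \<delta>0)"
  have l0: "0 < l0" using \<delta>0 assms by (simp add: l0_def)
  define K where "K = 1 + ln 16 / l0"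
  have K: "0 < K" using l0 by (simp add: K_def add_pos_nonneg)
  define N where "N = 25600 * K * (B + 1)\<^sup>2"
  define C0 where "C0 = 16 * (R + 5) * (B + 1)\<^sup>2 * (R * (B + 1) + 5)"
  have C0: "0 < C0" using R B by (auto simp: C0_def intro!: mult_pos_pos add_nonneg_pos)
  define C where "C = C0 * (40 * sqrt K)"
  have C: "0 < C" using C0 K by (simp add: C_def)
  show ?thesis
  proof (rule exI[of _ C], rule conjI, rule C, intro exI[of _ N] conjI allI impI, goal_cases)
    case 1
    show ?case using K B by (simp add: N_def)
  next
    case (2 d lam w \<mu>X SX F \<rho> n \<delta>)
    note d = 2(1) and lam = 2(2) and mB = 2(4) and w = 2(5) and F = 2(7) and Flam = 2(9)
      and \<delta> = 2(10,11) and n = 2(12) and big = 2(13)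
    define P where "P = sym_mixture d \<mu>X SX"
    define l where "l = ln (1 / \<delta>)"
    have l: "l0 \<le> l" using \<delta> \<delta>0 by (simp add: l_def l0_def field_simps)
    have el: "exp (- l) = \<delta>" using \<delta> by (simp add: l_def ln_div)
    \<comment> \<open>The attained maximum makes the feasible set nonempty; the moment condition at
      one feasible generator, whose own second moment is nonnegative, bounds the second moment of
      the data by \<open>lam\<close>.\<close>
    obtain \<Lambda>F \<mu>F where "(\<Lambda>F, \<mu>F) \<in> F" using F unfolding is_max_first_moment_def by auto
    then have "second_moment d P + gen_second_moment d \<Lambda>F \<mu>F \<le> lam" using Flam by (auto simp: P_def)
    moreover have "0 \<le> gen_second_moment d \<Lambda>F \<mu>F" by (simp add: gen_second_moment_def)
    ultimately have mlam: "second_moment d (sym_mixture d \<mu>X SX) \<le> lam" by (simp add: P_def)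
    define \<tau> where "\<tau> = 40 * sqrt K * sqrt (l / n)"
    note \<tau> = sample_size_calibration[OF l0 l B n K_def _ \<tau>_def]
    have "real n \<ge> 25600 * K * (B + 1)\<^sup>2 * l" using big by (simp add: N_def l_def)
    note \<tau> = \<tau>[OF this, unfolded el]
    obtain E where E: "E \<in> sets (\<Pi>\<^sub>M j\<in>{..<n}. P)"
      "measure (\<Pi>\<^sub>M j\<in>{..<n}. P) E \<ge> 1 - 16 * exp (- (n * \<tau>\<^sup>2 / 1600))"
      and bd: "\<And>xs \<mu> \<Lambda>. xs \<in> E \<Longrightarrow>
       frobenius_norm d (\<lambda>i j. \<mu> i * \<mu> j + gram d \<Lambda> i j) \<le> second_moment d P \<Longrightarrow>
       losses_close d lam w (empirical n xs) P \<Lambda> \<mu> (C0 * (\<tau> / lam)) (C0 * (\<tau> / lam))"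
      using sym_mixture_uniform_bounds[OF d n lam B R mB mlam w \<tau>(1,2)] unfolding C0_def P_def by blast
    \<comment> \<open>The estimate is dimension-free, of order \<open>sqrt (l / n) / lam\<close>. It
      is relaxed to both required rates by inserting a factor \<open>x \<ge> 1\<close>, namely the
      square of \<open>d\<close> for the value and \<open>d\<close> for the gradients.\<close>
    have rate: "C0 * (\<tau> / lam) \<le> C * sqrt (x * ln (1 / \<delta>) / (lam\<^sup>2 * real n))" if x: "1 \<le> x" for x
    proof -
      have "C0 * (\<tau> / lam) = C * (sqrt (l / n) / lam)" by (simp add: C_def \<tau>_def)
      also have "sqrt (l / n) / lam = sqrt (1 * (l / (lam\<^sup>2 * n)))" using lam by (simp add: real_sqrt_divide real_sqrt_mult)
      also have "C * \<dots> \<le> C * sqrt (x * (l / (lam\<^sup>2 * n)))"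
        using x l l0 C by (intro mult_left_mono real_sqrt_le_mono mult_right_mono) auto
      finally show ?thesis by (simp add: l_def)
    qed
    have d1: "1 \<le> (real d)\<^sup>2" "1 \<le> real d" using d by (auto simp: one_le_power)
    have "1 - \<delta> \<le> measure (\<Pi>\<^sub>M j\<in>{..<n}. P) E" using E(2) \<tau>(3) by linarith
    moreover note losses_close_mono[OF bd rate[OF d1(1)] rate[OF d1(2)], unfolded losses_close_def]
    ultimately show ?case
      unfolding P_def[symmetric] using E(1) by (intro bexI[OF _ E(1)] conjI[of "1 - \<delta> \<le> _"] ballI allI impI)
  qed
qed

end
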